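(* All elements of $l_3(\mathbb Z)$ are elementary.
   Context: The ring is $\mathbb Z$ with trivial involution and $\epsilon=-1$ ($l_3(\mathbb Z)$ is the monoid $l_{2q+1}(\mathbb Z)$ for $q$ odd); modules are finitely generated free abelian groups. $Q_-(M)$ is the cokernel of $1-T$ on $\mathrm{Hom}(M,M^* )$, $T\phi=-\phi^*$. A skew-quadratic form is $(M,\psi)$, $\psi\in Q_-(M)$; it is nonsingular if $\psi-\psi^*\colon M\to M^*$ is an isomorphism; isometries are isomorphisms preserving $\psi$. $H_-(L)=(L\oplus L^*,\begin{pmatrix}0&1\\0&0\end{pmatrix})$. A Lagrangian of $(M,\psi)$ is a direct summand $L$ with $L=L^\perp$ (with respect to $\psi-\psi^*$) and $\psi|_L=0\in Q_-(L)$. A quasi-formation $(M,\psi;L,V)$ is a nonsingular skew-quadratic form with a Lagrangian $L$ and a half-rank direct summand $V$. Isomorphisms are isometries carrying $L$ to $L'$ and $V$ to $V'$. Trivial formations are $(H_-(P);P,P^* )$; stable isomorphism is isomorphism after adding trivial formations. $l_3(\mathbb Z)$ is the abelian monoid (direct sum) of stable isomorphism classes of quasi-formations modulo $(M,\psi;K,L)\oplus(M,\psi;L,V)\sim(M,\psi;K,V)$ for Lagrangians $K,L$. An element is elementary if it is represented by a boundary $\delta(K,\rho)=(H_-(K);K,\begin{pmatrix}1\\\rho\end{pmatrix}K)$ with $\rho\in\mathrm{Hom}(K,K^* )$ arbitrary (equivalently, by a quasi-formation $(M,\psi;L,V)$ with $M=L\oplus V$). *)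

theory Defs
  imports "HOL-Algebra.Free_Abelian_Groups"
begin

definition free_of_rank :: "('a, 'b) monoid_scheme \<Rightarrow> nat \<Rightarrow> bool" where
  "free_of_rank G k \<longleftrightarrow> comm_group G \<and> free_Abelian_group {..<k} \<cong> G"

definition fg_free :: "('a, 'b) monoid_scheme \<Rightarrow> bool" where
  "fg_free G \<longleftrightarrow> (\<exists>k. free_of_rank G k)"

text \<open>The group of homomorphisms under pointwise operations. Homomorphisms are taken
  extensional, so that equality in this group is equality on the carrier of the source.\<close>

definition Hom_group :: "('a, 'c) monoid_scheme \<Rightarrow> ('b, 'd) monoid_scheme \<Rightarrow> ('a \<Rightarrow> 'b) monoid" where
  "Hom_group G H =
     \<lparr>carrier = hom G H \<inter> extensional (carrier G),
      monoid.mult = (\<lambda>f g. \<lambda>x\<in>carrier G. f x \<otimes>\<^bsub>H\<^esub> g x),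
      one = (\<lambda>x\<in>carrier G. \<one>\<^bsub>H\<^esub>)\<rparr>"

definition dual :: "('a, 'b) monoid_scheme \<Rightarrow> ('a \<Rightarrow> int) monoid" where
  "dual G = Hom_group G integer_group"

definition direct_summand :: "('a, 'b) monoid_scheme \<Rightarrow> 'a set \<Rightarrow> bool" where
  "direct_summand G N \<longleftrightarrow> subgroup N G \<and>
     (\<exists>N'. subgroup N' G \<and> N \<inter> N' = {\<one>\<^bsub>G\<^esub>} \<and> N <#>\<^bsub>G\<^esub> N' = carrier G)"

text \<open>An element \<open>\<phi>\<close> of \<open>Hom(M, M\<^sup>*)\<close> is identified with the bilinear map
  \<open>(x, y) \<mapsto> \<phi> x y\<close>. Under \<open>M = M\<^sup>*\<^sup>*\<close> its adjoint is \<open>(x, y) \<mapsto> \<phi> y x\<close>.\<close>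

definition Forms :: "('a, 'b) monoid_scheme \<Rightarrow> ('a \<Rightarrow> 'a \<Rightarrow> int) monoid" where
  "Forms M = Hom_group M (dual M)"

definition adj :: "('a, 'b) monoid_scheme \<Rightarrow> ('a \<Rightarrow> 'a \<Rightarrow> int) \<Rightarrow> ('a \<Rightarrow> 'a \<Rightarrow> int)" where
  "adj M \<phi> = (\<lambda>x\<in>carrier M. \<lambda>y\<in>carrier M. \<phi> y x)"

definition T_minus :: "('a, 'b) monoid_scheme \<Rightarrow> ('a \<Rightarrow> 'a \<Rightarrow> int) \<Rightarrow> ('a \<Rightarrow> 'a \<Rightarrow> int)" where
  "T_minus M \<phi> = (\<lambda>x\<in>carrier M. \<lambda>y\<in>carrier M. - adj M \<phi> x y)"

definition one_minus_T :: "('a, 'b) monoid_scheme \<Rightarrow> ('a \<Rightarrow> 'a \<Rightarrow> int) \<Rightarrow> ('a \<Rightarrow> 'a \<Rightarrow> int)" where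
  "one_minus_T M \<phi> = (\<lambda>x\<in>carrier M. \<lambda>y\<in>carrier M. \<phi> x y - T_minus M \<phi> x y)"

definition Q_minus :: "('a, 'b) monoid_scheme \<Rightarrow> ('a \<Rightarrow> 'a \<Rightarrow> int) set monoid" where
  "Q_minus M = Forms M Mod (one_minus_T M ` carrier (Forms M))"

definition Q_class :: "('a, 'b) monoid_scheme \<Rightarrow> ('a \<Rightarrow> 'a \<Rightarrow> int) \<Rightarrow> ('a \<Rightarrow> 'a \<Rightarrow> int) set" where
  "Q_class M \<phi> = (one_minus_T M ` carrier (Forms M)) #>\<^bsub>Forms M\<^esub> \<phi>"

text \<open>The maps out of \<open>Q_minus\<close> below are defined on representatives. As the result does not
  depend on the representative, the unions range over equal cosets and the image in
  \<open>skew_sym\<close>, which is \<open>\<psi> - \<psi>\<^sup>*\<close>, is a singleton.\<close>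

definition Q_pullback ::
  "('a, 'c) monoid_scheme \<Rightarrow> ('a \<Rightarrow> 'b) \<Rightarrow> ('b \<Rightarrow> 'b \<Rightarrow> int) set \<Rightarrow> ('a \<Rightarrow> 'a \<Rightarrow> int) set" where
  "Q_pullback N f \<psi> =
     (\<Union>\<phi>\<in>\<psi>. Q_class N (\<lambda>x\<in>carrier N. \<lambda>y\<in>carrier N. \<phi> (f x) (f y)))"

definition Q_sum ::
  "('a, 'c) monoid_scheme \<Rightarrow> ('b, 'd) monoid_scheme \<Rightarrow>
   ('a \<Rightarrow> 'a \<Rightarrow> int) set \<Rightarrow> ('b \<Rightarrow> 'b \<Rightarrow> int) set \<Rightarrow> ('a \<times> 'b \<Rightarrow> 'a \<times> 'b \<Rightarrow> int) set" where
  "Q_sum M N \<psi> \<psi>' = (\<Union>\<phi>\<in>\<psi>. \<Union>\<phi>'\<in>\<psi>'. Q_class (M \<times>\<times> N)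
     (\<lambda>x\<in>carrier (M \<times>\<times> N). \<lambda>y\<in>carrier (M \<times>\<times> N).
        \<phi> (fst x) (fst y) + \<phi>' (snd x) (snd y)))"

definition skew_sym ::
  "('a, 'b) monoid_scheme \<Rightarrow> ('a \<Rightarrow> 'a \<Rightarrow> int) set \<Rightarrow> ('a \<Rightarrow> 'a \<Rightarrow> int)" where
  "skew_sym M \<psi> =
     the_elem ((\<lambda>\<phi>. \<lambda>x\<in>carrier M. \<lambda>y\<in>carrier M. \<phi> x y - adj M \<phi> x y) ` \<psi>)"

definition skew_quadratic_form ::
  "('a, 'b) monoid_scheme \<Rightarrow> ('a \<Rightarrow> 'a \<Rightarrow> int) set \<Rightarrow> bool" where
  "skew_quadratic_form M \<psi> \<longleftrightarrow> fg_free M \<and> \<psi> \<in> carrier (Q_minus M)"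

definition nonsingular ::
  "('a, 'b) monoid_scheme \<Rightarrow> ('a \<Rightarrow> 'a \<Rightarrow> int) set \<Rightarrow> bool" where
  "nonsingular M \<psi> \<longleftrightarrow> skew_sym M \<psi> \<in> iso M (dual M)"

definition isometry ::
  "('a, 'c) monoid_scheme \<Rightarrow> ('a \<Rightarrow> 'a \<Rightarrow> int) set \<Rightarrow>
   ('b, 'd) monoid_scheme \<Rightarrow> ('b \<Rightarrow> 'b \<Rightarrow> int) set \<Rightarrow> ('a \<Rightarrow> 'b) \<Rightarrow> bool" where
  "isometry M \<psi> N \<psi>' f \<longleftrightarrow> f \<in> iso M N \<and> Q_pullback M f \<psi>' = \<psi>"

definition perp ::
  "('a, 'b) monoid_scheme \<Rightarrow> ('a \<Rightarrow> 'a \<Rightarrow> int) set \<Rightarrow> 'a set \<Rightarrow> 'a set" where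
  "perp M \<psi> L = {x \<in> carrier M. \<forall>y\<in>L. skew_sym M \<psi> x y = 0}"

definition Lagrangian ::
  "('a, 'b) monoid_scheme \<Rightarrow> ('a \<Rightarrow> 'a \<Rightarrow> int) set \<Rightarrow> 'a set \<Rightarrow> bool" where
  "Lagrangian M \<psi> L \<longleftrightarrow> direct_summand M L \<and> L = perp M \<psi> L \<and>
     Q_pullback (M\<lparr>carrier := L\<rparr>) (\<lambda>x. x) \<psi> = \<one>\<^bsub>Q_minus (M\<lparr>carrier := L\<rparr>)\<^esub>"

text \<open>The matrix with rows \<open>(0, 1)\<close> and \<open>(0, 0)\<close> sends \<open>(x, f) \<in> L \<oplus> L\<^sup>*\<close> to
  \<open>(f, 0) \<in> L\<^sup>* \<oplus> L\<^sup>*\<^sup>*\<close>, whose value at \<open>(y, g)\<close> is \<open>f y\<close>.\<close>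

definition hyp_module :: "('a, 'b) monoid_scheme \<Rightarrow> ('a \<times> ('a \<Rightarrow> int)) monoid" where
  "hyp_module L = L \<times>\<times> dual L"

definition hyp_form ::
  "('a, 'b) monoid_scheme \<Rightarrow> ('a \<times> ('a \<Rightarrow> int) \<Rightarrow> 'a \<times> ('a \<Rightarrow> int) \<Rightarrow> int) set" where
  "hyp_form L = Q_class (hyp_module L)
     (\<lambda>x\<in>carrier (hyp_module L). \<lambda>y\<in>carrier (hyp_module L). snd x (fst y))"

record 'a quasi_formation =
  qf_module :: "'a monoid"
  qf_form :: "('a \<Rightarrow> 'a \<Rightarrow> int) set"
  qf_lag :: "'a set"
  qf_half :: "'a set"

definition half_rank_summand :: "('a, 'b) monoid_scheme \<Rightarrow> 'a set \<Rightarrow> bool" where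
  "half_rank_summand M V \<longleftrightarrow> direct_summand M V \<and>
     (\<exists>k. free_of_rank M (2 * k) \<and> free_of_rank (M\<lparr>carrier := V\<rparr>) k)"

definition is_quasi_formation :: "'a quasi_formation \<Rightarrow> bool" where
  "is_quasi_formation X \<longleftrightarrow>
     skew_quadratic_form (qf_module X) (qf_form X) \<and>
     nonsingular (qf_module X) (qf_form X) \<and>
     Lagrangian (qf_module X) (qf_form X) (qf_lag X) \<and>
     half_rank_summand (qf_module X) (qf_half X)"

definition qf_iso :: "'a quasi_formation \<Rightarrow> 'b quasi_formation \<Rightarrow> bool" where
  "qf_iso X Y \<longleftrightarrow> (\<exists>f. isometry (qf_module X) (qf_form X) (qf_module Y) (qf_form Y) f \<and>
     f ` qf_lag X = qf_lag Y \<and> f ` qf_half X = qf_half Y)"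

definition qf_sum ::
  "'a quasi_formation \<Rightarrow> 'b quasi_formation \<Rightarrow> ('a \<times> 'b) quasi_formation" where
  "qf_sum X Y =
     \<lparr>qf_module = qf_module X \<times>\<times> qf_module Y,
      qf_form = Q_sum (qf_module X) (qf_module Y) (qf_form X) (qf_form Y),
      qf_lag = qf_lag X \<times> qf_lag Y,
      qf_half = qf_half X \<times> qf_half Y\<rparr>"

definition trivial_formation :: "'a monoid \<Rightarrow> ('a \<times> ('a \<Rightarrow> int)) quasi_formation" where
  "trivial_formation P =
     \<lparr>qf_module = hyp_module P, qf_form = hyp_form P,
      qf_lag = carrier P \<times> {\<one>\<^bsub>dual P\<^esub>},
      qf_half = {\<one>\<^bsub>P\<^esub>} \<times> carrier (dual P)\<rparr>"

definition boundary :: "'a monoid \<Rightarrow> ('a \<Rightarrow> 'a \<Rightarrow> int) \<Rightarrow> ('a \<times> ('a \<Rightarrow> int)) quasi_formation" where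
  "boundary K \<rho> =
     \<lparr>qf_module = hyp_module K, qf_form = hyp_form K,
      qf_lag = carrier K \<times> {\<one>\<^bsub>dual K\<^esub>},
      qf_half = (\<lambda>x. (x, \<rho> x)) ` carrier K\<rparr>"

text \<open>To have a set of isomorphism classes, all modules are taken with carrier in one type
  that contains a copy of every finitely generated free abelian group. Constructions that
  leave this type (direct sums, hyperbolic forms) are brought back along isomorphisms.\<close>

type_synonym univ = "nat \<Rightarrow>\<^sub>0 int"

definition stably_iso :: "univ quasi_formation \<Rightarrow> univ quasi_formation \<Rightarrow> bool" where
  "stably_iso X Y \<longleftrightarrow> (\<exists>(P :: univ monoid) (P' :: univ monoid). fg_free P \<and> fg_free P' \<and>
     qf_iso (qf_sum X (trivial_formation P)) (qf_sum Y (trivial_formation P')))"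

text \<open>The smallest congruence for the direct sum that contains stable isomorphism and the
  relation \<open>(M,\<psi>;K,L) \<oplus> (M,\<psi>;L,V) \<sim> (M,\<psi>;K,V)\<close>\<close>

inductive l3_equiv :: "univ quasi_formation \<Rightarrow> univ quasi_formation \<Rightarrow> bool" where
  l3_stable: "\<lbrakk>is_quasi_formation X; is_quasi_formation Y; stably_iso X Y\<rbrakk> \<Longrightarrow> l3_equiv X Y"
| l3_compose: "\<lbrakk>is_quasi_formation \<lparr>qf_module = M, qf_form = \<psi>, qf_lag = K, qf_half = V\<rparr>;
     Lagrangian M \<psi> L; is_quasi_formation Z;
     qf_iso Z (qf_sum \<lparr>qf_module = M, qf_form = \<psi>, qf_lag = K, qf_half = L\<rparr>
                      \<lparr>qf_module = M, qf_form = \<psi>, qf_lag = L, qf_half = V\<rparr>)\<rbrakk>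
   \<Longrightarrow> l3_equiv Z \<lparr>qf_module = M, qf_form = \<psi>, qf_lag = K, qf_half = V\<rparr>"
| l3_sum: "\<lbrakk>l3_equiv X Y; is_quasi_formation (C :: univ quasi_formation); is_quasi_formation Z; is_quasi_formation W;
     qf_iso Z (qf_sum X C); qf_iso W (qf_sum Y C)\<rbrakk> \<Longrightarrow> l3_equiv Z W"
| l3_sym: "l3_equiv X Y \<Longrightarrow> l3_equiv Y X"
| l3_trans: "\<lbrakk>l3_equiv X Y; l3_equiv Y Z\<rbrakk> \<Longrightarrow> l3_equiv X Z"

definition l3_Z :: "univ quasi_formation set monoid" where
  "l3_Z =
     \<lparr>carrier = {X. is_quasi_formation X} // {(X, Y). l3_equiv X Y},
      monoid.mult = (\<lambda>a b. {Z. \<exists>X\<in>a. \<exists>Y\<in>b. \<exists>W. is_quasi_formation W \<and>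
                              qf_iso W (qf_sum X Y) \<and> l3_equiv W Z}),
      one = {Z. \<exists>W (P :: univ monoid). fg_free P \<and> is_quasi_formation W \<and>
                  qf_iso W (trivial_formation P) \<and> l3_equiv W Z}\<rparr>"

definition elementary :: "univ quasi_formation set \<Rightarrow> bool" where
  "elementary a \<longleftrightarrow> (\<exists>X\<in>a. \<exists>(K :: univ monoid) \<rho>. fg_free K \<and> \<rho> \<in> carrier (Forms K) \<and>
     qf_iso X (boundary K \<rho>))"

end

theory Submission
  imports Defs "Jordan_Normal_Form.Determinant" "HOL-Library.Z2"
begin

text \<open>Every quasi-formation becomes isomorphic to a boundary after a single trivial formation has
been added, so that its class contains an elementary representative.

Let \<open>(M, \<psi>; L, V)\<close> be a quasi-formation. A Lagrangian of a nonsingular form has a Lagrangian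
complement, which identifies \<open>(M, \<psi>)\<close> with the hyperbolic form on \<open>\<int>\<^sup>n \<oplus> \<int>\<^sup>n\<close> and \<open>L\<close> with the
first summand. A basis of the half-rank summand \<open>V\<close> then consists of the columns of an
\<open>n \<times> n\<close> matrix \<open>A\<close> stacked on an \<open>n \<times> n\<close> matrix \<open>B\<close>. That \<open>V\<close> is a summand means that
\<open>C A + D B = 1\<close> for some \<open>C\<close> and \<open>D\<close>; such pairs are called primitive. If \<open>det A = \<plusminus>1\<close>, then \<open>V\<close>
is the graph of \<open>B A\<^sup>-\<^sup>1\<close> over \<open>L\<close> and the quasi-formation is a boundary. There are two ways to change
\<open>A\<close> and \<open>B\<close>: adding the trivial formation of rank \<open>k\<close> replaces them by \<open>A \<oplus> 0\<close> and \<open>B \<oplus> 1\<close>, and the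
isometry \<open>(x, y) \<mapsto> (x + (R + R\<^sup>T) y, y)\<close>, which fixes \<open>L\<close> pointwise, replaces \<open>A\<close> by
\<open>A + (R + R\<^sup>T) B\<close>. Everything therefore rests on the statement about integer matrices
\<open>exists_stab_shear_unimodular\<close>: a primitive pair can be stabilised and sheared until
\<open>det A = \<plusminus>1\<close>.

Its proof is a minimality argument in place of a Euclidean algorithm. First, a determinant
different from zero can be reached: as long as \<open>A\<close> is singular modulo 2, bordering it by a
suitable column makes its kernel modulo 2 smaller. Now let \<open>\<bar>det A\<bar>\<close> be minimal among the
nonzero reachable values, and put \<open>S = B A\<^sup>-\<^sup>1\<close>, a rational matrix. Bordering \<open>A\<close> by a matrix \<open>b\<close>
and a symmetric matrix \<open>d\<close> with even diagonal gives the determinant \<open>det A \<cdot> det (d - b\<^sup>T S b)\<close>.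
By minimality the second factor is never strictly between 0 and 1 in absolute value. If \<open>b\<close> is a
column, this says that the quadratic form of \<open>S\<close> is integral, so that \<open>S\<^sub>i\<^sub>i\<close> and \<open>S\<^sub>i\<^sub>j + S\<^sub>j\<^sub>i\<close> are
integers. A border of width three gives in addition that \<open>2 S\<^sub>i\<^sub>j S\<^sub>j\<^sub>i\<close> is an integer. Two
rational numbers whose sum and whose doubled product are integers are themselves integers, so
\<open>S\<close> is integral. Then \<open>(C + D S) A = 1\<close>, which means \<open>det A = \<plusminus>1\<close>.

The remaining sections translate between quasi-formations and matrices. Classes in \<open>Q\<^sub>-\<close> are
handled through biadditive representatives (\<open>Q_class_eq_iff\<close>), a quasi-formation is transported along
isomorphisms of its module (\<open>quasi_formation_transport\<close>), and \<open>quasi_formation_iso_matrix_formation\<close> gives the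
matrices \<open>A\<close> and \<open>B\<close>.\<close>

section \<open>Primitive pairs of integer matrices, stabilisation and shears\<close>

definition block_sum :: "int mat \<Rightarrow> int mat \<Rightarrow> int mat" where
  "block_sum A B = four_block_mat A (0\<^sub>m (dim_row A) (dim_col B)) (0\<^sub>m (dim_row B) (dim_col A)) B"

lemma block_sum_carrier [simp, intro]:
  "A \<in> carrier_mat a b \<Longrightarrow> B \<in> carrier_mat c d \<Longrightarrow> block_sum A B \<in> carrier_mat (a + c) (b + d)"
  unfolding block_sum_def by auto

lemma block_sum_dim [simp]:
  "dim_row (block_sum A B) = dim_row A + dim_row B" "dim_col (block_sum A B) = dim_col A + dim_col B"
  unfolding block_sum_def by auto

lemma block_sum_assoc: "block_sum A (block_sum B C) = block_sum (block_sum A B) C"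
  unfolding block_sum_def by (rule assoc_four_block_mat)

lemma block_sum_zero: "block_sum (0\<^sub>m a b) (0\<^sub>m c d) = 0\<^sub>m (a + c) (b + d)"
  unfolding block_sum_def by simp

lemma block_sum_one: "block_sum (1\<^sub>m a) (1\<^sub>m c) = 1\<^sub>m (a + c)"
  unfolding block_sum_def by simp

lemma block_sum_mult:
  assumes "A \<in> carrier_mat a b" "A' \<in> carrier_mat a' b'" "B \<in> carrier_mat b c" "B' \<in> carrier_mat b' c'"
  shows "block_sum A A' * block_sum B B' = block_sum (A * B) (A' * B')"
  unfolding block_sum_def using assms
  by (subst mult_four_block_mat[of _ a b _ b' _ a' _ _ c _ c']) auto

lemma block_sum_add:
  assumes "A \<in> carrier_mat a b" "A' \<in> carrier_mat a' b'" "B \<in> carrier_mat a b" "B' \<in> carrier_mat a' b'"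
  shows "block_sum A A' + block_sum B B' = block_sum (A + B) (A' + B')"
  unfolding block_sum_def using assms
  by (subst add_four_block_mat[of _ a b _ b' _ a']) auto

lemma block_sum_transpose: "transpose_mat (block_sum A B) = block_sum (transpose_mat A) (transpose_mat B)"
  unfolding block_sum_def by (rule eq_matI) auto

text \<open>The columns of \<open>A\<close> stacked on \<open>B\<close> form a basis of a direct summand of \<open>\<int>\<^sup>n \<oplus> \<int>\<^sup>n\<close>.\<close>

definition primitive_pair :: "nat \<Rightarrow> int mat \<Rightarrow> int mat \<Rightarrow> bool" where
  "primitive_pair n A B \<longleftrightarrow> A \<in> carrier_mat n n \<and> B \<in> carrier_mat n n \<and>
     (\<exists>C D. C \<in> carrier_mat n n \<and> D \<in> carrier_mat n n \<and> C * A + D * B = 1\<^sub>m n)"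

text \<open>Stabilisation replaces \<open>A\<close> and \<open>B\<close> by \<open>A \<oplus> 0\<close> and \<open>B \<oplus> 1\<close>, because the dual summand of the added
hyperbolic form is added to \<open>V\<close>. Symmetric matrices with even diagonal are written as
\<open>R + R\<^sup>T\<close>, which exhibits the change of the form under the shear as a symmetrisation.\<close>

definition stab_shear :: "nat \<Rightarrow> int mat \<Rightarrow> int mat \<Rightarrow> nat \<Rightarrow> int mat \<Rightarrow> int mat \<Rightarrow> bool" where
  "stab_shear n A B N A1 B1 \<longleftrightarrow> (\<exists>k R. N = n + k \<and> R \<in> carrier_mat N N \<and>
     A1 = block_sum A (0\<^sub>m k k) + (R + transpose_mat R) * block_sum B (1\<^sub>m k) \<and> B1 = block_sum B (1\<^sub>m k))"

lemma primitive_pair_shear: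
  assumes "primitive_pair n A B" "R \<in> carrier_mat n n"
  shows "primitive_pair n (A + R * B) B"
proof -
  obtain C D where A: "A \<in> carrier_mat n n" and B: "B \<in> carrier_mat n n"
    and C: "C \<in> carrier_mat n n" and D: "D \<in> carrier_mat n n" and CD: "C * A + D * B = 1\<^sub>m n"
    using assms(1) unfolding primitive_pair_def by auto
  note [simp] = A B C D assms(2)
  have "C * (A + R * B) + (D - C * R) * B = (C * A + C * (R * B)) + (D * B - C * R * B)"
    by (simp add: mult_add_distrib_mat[OF C A mult_carrier_mat[OF assms(2) B]]
        minus_mult_distrib_mat[OF D mult_carrier_mat[OF C assms(2)] B])
  also have "C * R * B = C * (R * B)" by (rule assoc_mult_mat[of _ n n _ n _ n]) auto
  also have "(C * A + C * (R * B)) + (D * B - C * (R * B)) = C * A + D * B"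
  proof -
    have "X + Y + (Z - Y) = X + Z" if "X \<in> carrier_mat n n" "Y \<in> carrier_mat n n" "Z \<in> carrier_mat n n"
      for X Y Z :: "int mat" using that by (intro eq_matI) auto
    then show ?thesis by (meson A B C D assms(2) mult_carrier_mat)
  qed
  finally have "C * (A + R * B) + (D - C * R) * B = 1\<^sub>m n" using CD by simp
  moreover have "A + R * B \<in> carrier_mat n n" "D - C * R \<in> carrier_mat n n"
    using mult_carrier_mat[OF assms(2) B] mult_carrier_mat[OF C assms(2)] minus_carrier_mat by auto
  ultimately show ?thesis unfolding primitive_pair_def using B C by blast
qed

lemma primitive_pair_stab:
  assumes "primitive_pair n A B"
  shows "primitive_pair (n + k) (block_sum A (0\<^sub>m k k)) (block_sum B (1\<^sub>m k))"
proof -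
  obtain C D where A: "A \<in> carrier_mat n n" and B: "B \<in> carrier_mat n n"
    and C: "C \<in> carrier_mat n n" and D: "D \<in> carrier_mat n n" and CD: "C * A + D * B = 1\<^sub>m n"
    using assms(1) unfolding primitive_pair_def by auto
  have "block_sum C (0\<^sub>m k k) * block_sum A (0\<^sub>m k k) + block_sum D (1\<^sub>m k) * block_sum B (1\<^sub>m k) = block_sum (C * A + D * B) (1\<^sub>m k)"
    using A B C D by (simp add: block_sum_mult[of _ n n _ k k _ n _ k] block_sum_add[of _ n n _ k k])
  then show ?thesis unfolding primitive_pair_def using A B C D CD
    by (intro conjI exI[of _ "block_sum C (0\<^sub>m k k)"] exI[of _ "block_sum D (1\<^sub>m k)"]) (auto simp: block_sum_one)
qed

lemma primitive_pair_stab_shear: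
  assumes "primitive_pair n A B" "stab_shear n A B N A1 B1"
  shows "primitive_pair N A1 B1"
proof -
  obtain k R where "N = n + k" "R \<in> carrier_mat N N"
     "A1 = block_sum A (0\<^sub>m k k) + (R + transpose_mat R) * block_sum B (1\<^sub>m k)" "B1 = block_sum B (1\<^sub>m k)"
    using assms(2) unfolding stab_shear_def by auto
  then show ?thesis using primitive_pair_shear[OF primitive_pair_stab[OF assms(1), of k]] by auto
qed

lemma stab_shear_refl:
  assumes "A \<in> carrier_mat n n" "B \<in> carrier_mat n n"
  shows "stab_shear n A B n A B"
proof -
  have d0: "block_sum A (0\<^sub>m 0 0) = A" "block_sum B (1\<^sub>m 0) = B"
    using assms unfolding block_sum_def by (auto intro!: eq_matI)
  show ?thesis unfolding stab_shear_def
    by (rule exI[of _ 0], rule exI[of _ "0\<^sub>m n n"]) (use assms in \<open>simp add: d0\<close>)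
qed

text \<open>A further stabilisation turns the first shear into one with \<open>R \<oplus> 0\<close>, and shears add up. Thus a
minimum over all sheared stabilisations cannot be improved by repeating the operation.\<close>

lemma stab_shear_trans:
  assumes "A \<in> carrier_mat n n" "B \<in> carrier_mat n n"
    "stab_shear n A B N A1 B1" "stab_shear N A1 B1 P A2 B2"
  shows "stab_shear n A B P A2 B2"
proof -
  obtain k R where k: "N = n + k" "R \<in> carrier_mat N N"
     "A1 = block_sum A (0\<^sub>m k k) + (R + transpose_mat R) * block_sum B (1\<^sub>m k)" "B1 = block_sum B (1\<^sub>m k)"
    using assms(3) unfolding stab_shear_def by auto
  obtain j Q where j: "P = N + j" "Q \<in> carrier_mat P P"
     "A2 = block_sum A1 (0\<^sub>m j j) + (Q + transpose_mat Q) * block_sum B1 (1\<^sub>m j)" "B2 = block_sum B1 (1\<^sub>m j)"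
    using assms(4) unfolding stab_shear_def by auto
  let ?S = "R + transpose_mat R" and ?Z = "0\<^sub>m j j :: int mat"
  have cA: "block_sum A (0\<^sub>m k k) \<in> carrier_mat N N" and cB: "B1 \<in> carrier_mat N N" using assms k by auto
  have "block_sum A1 ?Z = block_sum (block_sum A (0\<^sub>m k k)) ?Z + block_sum (?S * B1) ?Z"
    using k cA cB mult_carrier_mat[of ?S N N B1 N] by (subst block_sum_add[of _ N N _ j j]) auto
  also have "block_sum (?S * B1) ?Z = block_sum ?S ?Z * block_sum B1 (1\<^sub>m j)"
    using k cA cB by (subst block_sum_mult[of _ N N _ j j _ N _ j]) auto
  finally have A1: "block_sum A1 ?Z = block_sum (block_sum A (0\<^sub>m k k)) ?Z + block_sum ?S ?Z * block_sum B1 (1\<^sub>m j)" .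
  let ?T = "block_sum R ?Z + Q"
  have T: "?T \<in> carrier_mat P P" using k j by auto
  have TT: "?T + transpose_mat ?T = block_sum ?S ?Z + (Q + transpose_mat Q)"
  proof -
    have "block_sum ?S ?Z = block_sum R ?Z + transpose_mat (block_sum R ?Z)"
      using k by (simp add: block_sum_transpose block_sum_add[of _ N N _ j j])
    moreover have "transpose_mat ?T = transpose_mat (block_sum R ?Z) + transpose_mat Q"
      using k j by (intro transpose_add[of _ P P]) auto
    ultimately show ?thesis
      using k j by (intro eq_matI) auto
  qed
  have "A2 = block_sum (block_sum A (0\<^sub>m k k)) ?Z + (?T + transpose_mat ?T) * block_sum B1 (1\<^sub>m j)"
  proof -
    have c: "block_sum (block_sum A (0\<^sub>m k k)) ?Z \<in> carrier_mat P P" "block_sum ?S ?Z \<in> carrier_mat P P"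
      "Q + transpose_mat Q \<in> carrier_mat P P" "block_sum B1 (1\<^sub>m j) \<in> carrier_mat P P"
      using k(2) j(1,2) cA cB by auto
    show ?thesis unfolding j(3) A1 TT add_mult_distrib_mat[OF c(2,3,4)]
      by (rule assoc_add_mat[OF c(1) mult_carrier_mat[OF c(2,4)] mult_carrier_mat[OF c(3,4)]])
  qed
  then show ?thesis unfolding stab_shear_def
    using k j T by (intro exI[of _ "k + j"] exI[of _ ?T])
      (auto simp: block_sum_assoc[symmetric] block_sum_zero block_sum_one add.assoc)
qed

text \<open>The special shears that leave \<open>A\<close> in place and border it; only these are used to change
determinants.\<close>

lemma stab_shear_border:
  assumes "A \<in> carrier_mat n n" "B \<in> carrier_mat n n" "b \<in> carrier_mat n k" "e \<in> carrier_mat k k"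
  shows "stab_shear n A B (n + k) (four_block_mat A b (transpose_mat b * B) (e + transpose_mat e)) (block_sum B (1\<^sub>m k))"
proof -
  let ?R = "four_block_mat (0\<^sub>m n n) b (0\<^sub>m k n) e"
  have "?R + transpose_mat ?R = four_block_mat (0\<^sub>m n n) b (transpose_mat b) (e + transpose_mat e)"
    using assms by (subst transpose_four_block_mat[of _ n n _ k _ k]) (auto intro!: eq_matI)
  moreover have "four_block_mat (0\<^sub>m n n) b (transpose_mat b) (e + transpose_mat e) * block_sum B (1\<^sub>m k)
     = four_block_mat (0\<^sub>m n n) b (transpose_mat b * B) (e + transpose_mat e)"
    unfolding block_sum_def using assms by (subst mult_four_block_mat[of _ n n _ k _ k _ _ n _ k]) auto
  moreover have "block_sum A (0\<^sub>m k k) + four_block_mat (0\<^sub>m n n) b (transpose_mat b * B) (e + transpose_mat e)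
     = four_block_mat A b (transpose_mat b * B) (e + transpose_mat e)"
    unfolding block_sum_def using assms by (subst add_four_block_mat[of _ n n _ k _ k]) auto
  ultimately show ?thesis unfolding stab_shear_def
    using assms by (intro exI[of _ k] exI[of _ ?R]) auto
qed

section \<open>Reaching an odd determinant\<close>

abbreviation mod2 :: "int mat \<Rightarrow> bit mat" where "mod2 \<equiv> map_mat of_int"

definition kernel_mod2 :: "nat \<Rightarrow> int mat \<Rightarrow> bit vec set" where
  "kernel_mod2 n A = {u \<in> carrier_vec n. mod2 A *\<^sub>v u = 0\<^sub>v n}"

lemma of_int_bit_eq_0_iff: "(of_int x :: bit) = 0 \<longleftrightarrow> even x"
  by (cases "even x") (auto elim!: evenE oddE)

lemma finite_bit_vec: "finite (carrier_vec n :: bit vec set)"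
proof -
  have "finite (UNIV :: bit set)"
    by (rule finite_subset[of _ "{0, 1}"]) (auto intro: bit.exhaust)
  then have "finite {xs :: bit list. set xs \<subseteq> UNIV \<and> length xs = n}"
    by (rule finite_lists_length_eq)
  moreover have "carrier_vec n \<subseteq> vec_of_list ` {xs :: bit list. set xs \<subseteq> UNIV \<and> length xs = n}"
  proof
    fix v :: "bit vec" assume "v \<in> carrier_vec n"
    then show "v \<in> vec_of_list ` {xs. set xs \<subseteq> UNIV \<and> length xs = n}"
      by (intro image_eqI[of _ _ "list_of_vec v"]) (auto simp: vec_list)
  qed
  ultimately show ?thesis by (rule finite_surj)
qed

text \<open>Over the field with two elements two proper hyperplanes do not cover the whole space.\<close>

lemma separating_vec:
  fixes w y :: "bit vec"
  assumes w: "w \<in> carrier_vec n" "w \<noteq> 0\<^sub>v n" and y: "y \<in> carrier_vec n" "y \<noteq> 0\<^sub>v n"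
  obtains b where "b \<in> carrier_vec n" "b \<bullet> w = 1" "b \<bullet> y = 1"
proof -
  have nz: "\<exists>i<n. v $ i \<noteq> 0" if "v \<in> carrier_vec n" "v \<noteq> 0\<^sub>v n" for v :: "bit vec"
    using that eq_vecI[of v "0\<^sub>v n"] by (metis carrier_vecD index_zero_vec)
  obtain i where i: "i < n" "w $ i \<noteq> 0" using nz[OF w] by blast
  obtain j where j: "j < n" "y $ j \<noteq> 0" using nz[OF y] by blast
  let ?e = "\<lambda>i. unit_vec n i :: bit vec"
  consider "y $ i \<noteq> 0" | "w $ j \<noteq> 0" | "y $ i = 0" "w $ j = 0" by blast
  then show thesis
  proof cases
    case 1 then show ?thesis using i w y by (intro that[of "?e i"]) auto
  next
    case 2 then show ?thesis using j w y by (intro that[of "?e j"]) auto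
  next
    case 3
    have "(?e i + ?e j) \<bullet> v = v $ i + v $ j" if "v \<in> carrier_vec n" for v
      using that i j by (simp add: add_scalar_prod_distrib[of _ n])
    then show ?thesis using i j w y 3 by (intro that[of "?e i + ?e j"]) auto
  qed
qed

text \<open>Let \<open>u\<close> and \<open>w\<close> be nonzero with \<open>A u = 0\<close> and \<open>A\<^sup>T w = 0\<close> modulo 2. Primitivity gives \<open>B u \<noteq> 0\<close>, so
there is a column \<open>b\<close> that pairs nontrivially with both \<open>w\<close> and \<open>B u\<close>. The kernel of \<open>A\<close> bordered
by \<open>b\<close> embeds into the kernel of \<open>A\<close> and misses \<open>u\<close>.\<close>

lemma border_shrinks_kernel_mod2:
  assumes P: "primitive_pair n A B" and ev: "even (det A)"
  shows "\<exists>b \<in> carrier_mat n 1. card (kernel_mod2 (n + 1) (four_block_mat A b (transpose_mat b * B) (0\<^sub>m 1 1)))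
           < card (kernel_mod2 n A)"
proof -
  obtain C D where A: "A \<in> carrier_mat n n" and B: "B \<in> carrier_mat n n"
    and C: "C \<in> carrier_mat n n" and D: "D \<in> carrier_mat n n" and CD: "C * A + D * B = 1\<^sub>m n"
    using P unfolding primitive_pair_def by auto
  let ?h = "map_mat of_int :: int mat \<Rightarrow> bit mat"
  have hA: "?h A \<in> carrier_mat n n" and hB: "?h B \<in> carrier_mat n n"
    and hC: "?h C \<in> carrier_mat n n" and hD: "?h D \<in> carrier_mat n n" using A B C D by auto
  have d0: "det (?h A) = 0" using ev by (simp add: of_int_bit_eq_0_iff)
  then obtain u where u: "u \<in> carrier_vec n" "u \<noteq> 0\<^sub>v n" "?h A *\<^sub>v u = 0\<^sub>v n"
    using det_0_iff_vec_prod_zero[OF hA] by auto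
  have "det (transpose_mat (?h A)) = 0" using d0 det_transpose[OF hA] by simp
  then obtain w where w: "w \<in> carrier_vec n" "w \<noteq> 0\<^sub>v n" "transpose_mat (?h A) *\<^sub>v w = 0\<^sub>v n"
    using det_0_iff_vec_prod_zero[of "transpose_mat (?h A)" n] hA by auto
  have Bu: "?h B *\<^sub>v u \<noteq> 0\<^sub>v n"
  proof
    assume z: "?h B *\<^sub>v u = 0\<^sub>v n"
    have "?h C * ?h A + ?h D * ?h B = 1\<^sub>m n"
    proof -
      have "?h (C * A + D * B) = ?h (C * A) + ?h (D * B)"
        using A B C D by (intro eq_matI) (auto simp del: index_mult_mat(1))
      then show ?thesis unfolding CD
        by (simp add: of_int_hom.mat_hom_mult[OF C A] of_int_hom.mat_hom_mult[OF D B] of_int_hom.mat_hom_one)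
    qed
    then have "u = (?h C * ?h A + ?h D * ?h B) *\<^sub>v u" using u by simp
    also have "\<dots> = ?h C *\<^sub>v (?h A *\<^sub>v u) + ?h D *\<^sub>v (?h B *\<^sub>v u)"
      using hA hB hC hD u by (simp add: add_mult_distrib_mat_vec[of _ n n])
    also have "\<dots> = 0\<^sub>v n" using hC hD unfolding z u(3) by (intro eq_vecI) auto
    finally show False using u by simp
  qed
  have cBu: "?h B *\<^sub>v u \<in> carrier_vec n" using hB u by auto
  (* Pairing with w forces the new coordinate of a kernel vector to vanish; pairing with B u
     then removes u from the kernel. *)
  obtain b where b: "b \<in> carrier_vec n" "b \<bullet> w = 1" "b \<bullet> (?h B *\<^sub>v u) = 1"
    using separating_vec[OF w(1,2) cBu Bu] by auto
  define b' :: "int mat" where "b' = mat n 1 (\<lambda>(i, j). if b $ i = 1 then 1 else 0)"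
  have b'c: "b' \<in> carrier_mat n 1" unfolding b'_def by simp
  have hb': "?h b' = mat n 1 (\<lambda>(i, j). b $ i)" unfolding b'_def by (rule eq_matI) auto
  have hb'_mult: "?h b' *\<^sub>v s = s $ 0 \<cdot>\<^sub>v b" if "s \<in> carrier_vec 1" for s
    unfolding hb' using that b by (intro eq_vecI) (auto simp: scalar_prod_def)
  have hbt_mult: "(transpose_mat (?h b') *\<^sub>v v) $ 0 = b \<bullet> v" if "v \<in> carrier_vec n" for v
    unfolding hb' using that b by (auto simp: scalar_prod_def)
  let ?X = "four_block_mat A b' (transpose_mat b' * B) (0\<^sub>m 1 1)"
  have hX: "?h ?X = four_block_mat (?h A) (?h b') (transpose_mat (?h b') * ?h B) (0\<^sub>m 1 1)"
    using A B b'c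
    by (subst map_four_block_mat[of _ n n _ 1 _ 1])
      (auto simp: of_int_hom.mat_hom_mult[of _ 1 n B n] map_mat_transpose[symmetric])
  have ker: "v \<in> (\<lambda>x. x @\<^sub>v 0\<^sub>v 1) ` (kernel_mod2 n A - {u})" if v: "v \<in> kernel_mod2 (n + 1) ?X" for v
  proof -
    have vc: "v \<in> carrier_vec (n + 1)" and v0: "?h ?X *\<^sub>v v = 0\<^sub>v (n + 1)"
      using v unfolding kernel_mod2_def by auto
    obtain x s where x: "x \<in> carrier_vec n" and s: "s \<in> carrier_vec 1" and vxs: "v = x @\<^sub>v s"
      using vc by (metis vec_first_carrier vec_last_carrier vec_first_last_append)
    have "(?h A *\<^sub>v x + ?h b' *\<^sub>v s) @\<^sub>v (transpose_mat (?h b') * ?h B *\<^sub>v x + 0\<^sub>m 1 1 *\<^sub>v s) = 0\<^sub>v n @\<^sub>v 0\<^sub>v 1"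
      using v0 hA hB b'c x s unfolding hX vxs
      by (subst four_block_mat_mult_vec[symmetric, of _ n n _ 1 _ 1]) (auto intro!: eq_vecI)
    moreover have "?h A *\<^sub>v x + ?h b' *\<^sub>v s \<in> carrier_vec n" using hA b'c x s by auto
    ultimately have "?h A *\<^sub>v x + ?h b' *\<^sub>v s = 0\<^sub>v n \<and>
        transpose_mat (?h b') * ?h B *\<^sub>v x + 0\<^sub>m 1 1 *\<^sub>v s = 0\<^sub>v 1"
      using append_vec_eq[OF _ zero_carrier_vec] by blast
    then have e1: "?h A *\<^sub>v x + ?h b' *\<^sub>v s = 0\<^sub>v n"
      and e2: "transpose_mat (?h b') * ?h B *\<^sub>v x + 0\<^sub>m 1 1 *\<^sub>v s = 0\<^sub>v 1" by auto
    have "w \<bullet> (?h A *\<^sub>v x + ?h b' *\<^sub>v s) = 0" unfolding e1 using w by simp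
    moreover have "w \<bullet> (?h A *\<^sub>v x) = (transpose_mat (?h A) *\<^sub>v w) \<bullet> x"
      using transpose_vec_mult_scalar[OF hA x w(1)] by simp
    ultimately have "w \<bullet> (s $ 0 \<cdot>\<^sub>v b) = 0"
      using hA w x b s by (simp add: hb'_mult scalar_prod_add_distrib[of _ n])
    moreover have "w \<bullet> b = 1" using b w comm_scalar_prod[of b n w] by simp
    ultimately have "s $ 0 = 0" using w b by simp
    then have s0: "s = 0\<^sub>v 1" using s by (intro eq_vecI) auto
    have "?h b' *\<^sub>v s = 0\<^sub>v n" proof -
      have "?h b' *\<^sub>v s = 0 \<cdot>\<^sub>v b" using hb'_mult[OF s] s0 by simp
      then show ?thesis using b(1) by (auto intro!: eq_vecI)
    qed
    then have Ax: "?h A *\<^sub>v x = 0\<^sub>v n" using e1 mult_mat_vec_carrier[OF hA x] by simp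
    have "transpose_mat (?h b') *\<^sub>v (?h B *\<^sub>v x) = 0\<^sub>v 1"
    proof -
      have "transpose_mat (?h b') * ?h B *\<^sub>v x = transpose_mat (?h b') *\<^sub>v (?h B *\<^sub>v x)"
        using b'c hB x by (intro assoc_mult_mat_vec[of _ 1 n _ n]) auto
      moreover have "0\<^sub>m 1 1 *\<^sub>v s = 0\<^sub>v 1" using s by auto
      moreover have "transpose_mat (?h b') *\<^sub>v (?h B *\<^sub>v x) \<in> carrier_vec 1"
        using b'c hB x by (intro mult_mat_vec_carrier[of _ 1 n]) auto
      ultimately show ?thesis using e2 by simp
    qed
    then have "b \<bullet> (?h B *\<^sub>v x) = 0" using hbt_mult[OF mult_mat_vec_carrier[OF hB x]] by simp
    then have "x \<noteq> u" using b by auto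
    then show ?thesis using Ax x unfolding vxs s0 kernel_mod2_def by auto
  qed
  have fin: "finite (kernel_mod2 n A)" unfolding kernel_mod2_def
    by (rule finite_subset[OF _ finite_bit_vec[of n]]) auto
  have "card (kernel_mod2 (n + 1) ?X) \<le> card (kernel_mod2 n A - {u})"
    using ker by (intro surj_card_le[of _ _ "\<lambda>x. x @\<^sub>v 0\<^sub>v 1"]) (auto simp: fin)
  also have "\<dots> < card (kernel_mod2 n A)"
    using fin u by (intro psubset_card_mono) (auto simp: kernel_mod2_def)
  finally show ?thesis using b'c by blast
qed

lemma exists_stab_shear_odd:
  assumes "primitive_pair n A B"
  shows "\<exists>N A1 B1. stab_shear n A B N A1 B1 \<and> odd (det A1)"
  using assms
proof (induction "card (kernel_mod2 n A)" arbitrary: n A B rule: less_induct)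
  case less
  have A: "A \<in> carrier_mat n n" and B: "B \<in> carrier_mat n n"
    using less.prems unfolding primitive_pair_def by auto
  show ?case
  proof (cases "odd (det A)")
    case True
    then show ?thesis using stab_shear_refl[OF A B] by blast
  next
    case False
    then obtain b where b: "b \<in> carrier_mat n 1"
      and lt: "card (kernel_mod2 (n + 1) (four_block_mat A b (transpose_mat b * B) (0\<^sub>m 1 1)))
           < card (kernel_mod2 n A)"
      using border_shrinks_kernel_mod2[OF less.prems] by auto
    have st: "stab_shear n A B (n + 1) (four_block_mat A b (transpose_mat b * B) (0\<^sub>m 1 1)) (block_sum B (1\<^sub>m 1))"
      using stab_shear_border[OF A B b, of "0\<^sub>m 1 1"] by simp
    show ?thesis
      using less.hyps[OF lt primitive_pair_stab_shear[OF less.prems st]] stab_shear_trans[OF A B st] by blast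
  qed
qed

section \<open>Reaching a unimodular matrix\<close>

text \<open>The Schur complement formula, with the inverse \<open>T\<close> of \<open>A\<close> given explicitly.\<close>

lemma det_border:
  fixes A b c d T :: "'a :: idom mat"
  assumes A: "A \<in> carrier_mat n n" and T: "T \<in> carrier_mat n n" and AT: "A * T = 1\<^sub>m n"
    and b: "b \<in> carrier_mat n k" and c: "c \<in> carrier_mat k n" and d: "d \<in> carrier_mat k k"
  shows "det (four_block_mat A b c d) = det A * det (d - c * (T * b))"
proof -
  let ?Y = "four_block_mat (1\<^sub>m n) (- (T * b)) (0\<^sub>m k n) (1\<^sub>m k)"
  have Tb: "T * b \<in> carrier_mat n k" using T b by auto
  have "A * (T * b) = (A * T) * b" using A T b by (intro assoc_mult_mat[symmetric]) auto
  then have ATb: "A * (T * b) = b" using AT b by simp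
  have "four_block_mat A b c d * ?Y =
      four_block_mat (A * 1\<^sub>m n + b * 0\<^sub>m k n) (A * (- (T * b)) + b * 1\<^sub>m k)
                     (c * 1\<^sub>m n + d * 0\<^sub>m k n) (c * (- (T * b)) + d * 1\<^sub>m k)"
    by (rule mult_four_block_mat[OF A b c d one_carrier_mat _ zero_carrier_mat one_carrier_mat]) (use Tb in simp)
  also have "A * (- (T * b)) + b * 1\<^sub>m k = 0\<^sub>m n k"
  proof -
    have "A * (- (T * b)) = - (A * (T * b))" using A T b by simp
    then show ?thesis unfolding ATb using b by (auto intro!: eq_matI)
  qed
  also have "c * (- (T * b)) + d * 1\<^sub>m k = d - c * (T * b)"
  proof -
    have "- X + Z = Z - X" if "X \<in> carrier_mat k k" "Z \<in> carrier_mat k k" for X Z :: "'a mat"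
      using that by (intro eq_matI) auto
    moreover have "c * (- (T * b)) + d * 1\<^sub>m k = - (c * (T * b)) + d" using c T b d by simp
    ultimately show ?thesis using c Tb d by (metis mult_carrier_mat)
  qed
  also have "A * 1\<^sub>m n + b * 0\<^sub>m k n = A" using A b by simp
  also have "c * 1\<^sub>m n + d * 0\<^sub>m k n = c" using c d by simp
  finally have e: "four_block_mat A b c d * ?Y = four_block_mat A (0\<^sub>m n k) c (d - c * (T * b))" .
  have "det ?Y = 1" using Tb by (subst det_four_block_mat_lower_left_zero[of _ n _ k]) auto
  then have "det (four_block_mat A b c d) = det (four_block_mat A b c d * ?Y)"
    using A b c d Tb by (subst det_mult[of _ "n + k"]) auto
  also have "\<dots> = det A * det (d - c * (T * b))" unfolding e
    by (rule det_four_block_mat_upper_right_zero[OF A refl c]) (rule minus_carrier_mat[OF mult_carrier_mat[OF c Tb]])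
  finally show ?thesis .
qed

text \<open>The even integer nearest to \<open>q\<close> is at distance at most 1, so the hypothesis makes the distance 0 or 1.\<close>

lemma rat_int_if_even_gaps:
  fixes q :: rat
  assumes "\<And>x :: int. 2 * of_int x = q \<or> \<bar>2 * of_int x - q\<bar> \<ge> 1"
  shows "q \<in> \<int>"
proof -
  define f where "f = \<lfloor>q / 2\<rfloor>"
  have "of_int f \<le> q / 2" "q / 2 < of_int f + 1" unfolding f_def by linarith+
  then have r: "0 \<le> q - 2 * of_int f" "q - 2 * of_int f < 2" by auto
  have "q - 2 * of_int f = 0 \<or> q - 2 * of_int f \<ge> 1" using assms[of f] r by linarith
  moreover have "q - 2 * of_int f \<le> 1" using assms[of "f + 1"] r by (auto simp: abs_if split: if_splits)
  ultimately have "q = of_int (2 * f) \<or> q = of_int (2 * f + 1)"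
    unfolding of_int_add of_int_mult of_int_numeral of_int_1 by linarith
  then show ?thesis by (elim disjE) (simp_all only: Ints_of_int)
qed

text \<open>The number \<open>2 s\<close> is a zero of a monic quadratic polynomial with integer coefficients, the lower
ones even. Hence it is an integer with even square, and so even. The proof says this for a
reduced fraction.\<close>

lemma rat_int_if_twice_square_int:
  fixes s t :: rat
  assumes m: "s + t \<in> \<int>" and p: "2 * (s * t) \<in> \<int>"
  shows "s \<in> \<int>"
proof -
  obtain m c :: int where mc: "s + t = of_int m" "2 * (s * t) = of_int c"
    using m p by (auto elim!: Ints_cases)
  obtain a b :: int where ab: "s = of_int a / of_int b" "b > 0" "coprime a b"
  proof -
    obtain a b where q: "quotient_of s = (a, b)" by (cases "quotient_of s")
    show thesis
      by (rule that[OF quotient_of_div[OF q] quotient_of_denom_pos[OF q] quotient_of_coprime[OF q]])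
  qed
  have "t = of_int m - s" using mc(1) by simp
  (* 2 s is a zero of X^2 - 2 m X + 2 c. *)
  then have "2 * (s * (of_int m - s)) = of_int c" using mc(2) by simp
  then have "2 * (of_int a * (of_int m * of_int b - of_int a)) = (of_int c * (of_int b * of_int b) :: rat)"
    using ab by (simp add: field_simps)
  then have "(of_int (2 * (a * (m * b - a))) :: rat) = of_int (c * (b * b))" by simp
  then have e: "2 * (a * (m * b - a)) = c * (b * b)" by (simp only: of_int_eq_iff)
  then have "2 * (a * a) = b * (2 * a * m - c * b)" by (simp add: algebra_simps)
  then have "b dvd 2 * (a * a)" by simp
  then have "b dvd 2" using ab(3) by (simp add: coprime_commute coprime_dvd_mult_left_iff)
  then have "b = 1 \<or> b = 2" using ab(2) by (smt (verit) zdvd_imp_le)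
  moreover have "b \<noteq> 2"
  proof
    assume b2: "b = 2"
    then have "a * (m * 2 - a) = 2 * c" using e by simp
    then have "even (a * (m * 2 - a))" by simp
    then have "even a" by simp
    then show False using ab(3) b2 by simp
  qed
  ultimately show ?thesis using ab by auto
qed

lemma det_2x2: "A \<in> carrier_mat 2 2 \<Longrightarrow> det A = A $$ (0,0) * A $$ (1,1) - A $$ (0,1) * A $$ (1,0)"
  for A :: "'a :: comm_ring_1 mat"
proof -
  assume A: "A \<in> carrier_mat 2 2"
  have "det A = (\<Sum>i<2. A $$ (i, 0) * cofactor A i 0)"
    using A by (rule laplace_expansion_column) simp
  also have "\<dots> = A $$ (0,0) * cofactor A 0 0 + A $$ (1,0) * cofactor A 1 0"
    by (simp add: numeral_2_eq_2)
  finally have e: "det A = A $$ (0,0) * cofactor A 0 0 + A $$ (1,0) * cofactor A 1 0" .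
  have c: "mat_delete A i 0 \<in> carrier_mat 1 1" for i using mat_delete_carrier[OF A] by simp
  have d: "dim_row A = 2" "dim_col A = 2" using A by auto
  have cof: "cofactor A 0 0 = A $$ (1,1)" "cofactor A 1 0 = - A $$ (0,1)"
    unfolding cofactor_def det_single[OF c] by (simp_all add: mat_delete_def d)
  show ?thesis unfolding e cof by (simp add: algebra_simps)
qed

lemma det_3x3: "A \<in> carrier_mat 3 3 \<Longrightarrow> det A =
    A $$ (0,0) * (A $$ (1,1) * A $$ (2,2) - A $$ (1,2) * A $$ (2,1))
  - A $$ (1,0) * (A $$ (0,1) * A $$ (2,2) - A $$ (0,2) * A $$ (2,1))
  + A $$ (2,0) * (A $$ (0,1) * A $$ (1,2) - A $$ (0,2) * A $$ (1,1))"
  for A :: "'a :: comm_ring_1 mat"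
proof -
  assume A: "A \<in> carrier_mat 3 3"
  have "det A = (\<Sum>i<3. A $$ (i, 0) * cofactor A i 0)"
    using A by (rule laplace_expansion_column) simp
  also have "\<dots> = A $$ (0,0) * cofactor A 0 0 + A $$ (1,0) * cofactor A 1 0 + A $$ (2,0) * cofactor A 2 0"
    by (simp add: numeral_3_eq_3 numeral_2_eq_2)
  finally have e: "det A = A $$ (0,0) * cofactor A 0 0 + A $$ (1,0) * cofactor A 1 0 + A $$ (2,0) * cofactor A 2 0" .
  have c: "mat_delete A i 0 \<in> carrier_mat 2 2" for i using mat_delete_carrier[OF A] by simp
  have d: "dim_row A = 3" "dim_col A = 3" using A by auto
  have 1: "det (mat_delete A 0 0) = A $$ (1,1) * A $$ (2,2) - A $$ (1,2) * A $$ (2,1)"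
    unfolding det_2x2[OF c] by (simp add: mat_delete_def d numeral_2_eq_2)
  have 2: "det (mat_delete A 1 0) = A $$ (0,1) * A $$ (2,2) - A $$ (0,2) * A $$ (2,1)"
    unfolding det_2x2[OF c] by (simp add: mat_delete_def d numeral_2_eq_2)
  have 3: "det (mat_delete A 2 0) = A $$ (0,1) * A $$ (1,2) - A $$ (0,2) * A $$ (1,1)"
    unfolding det_2x2[OF c] by (simp add: mat_delete_def d numeral_2_eq_2)
  have cof: "cofactor A 0 0 = det (mat_delete A 0 0)" "cofactor A 1 0 = - det (mat_delete A 1 0)"
    "cofactor A 2 0 = det (mat_delete A 2 0)" unfolding cofactor_def by simp_all
  show ?thesis unfolding e cof 1 2 3 by (simp add: algebra_simps)
qed

text \<open>The factor by which a border multiplies the determinant. Minimality of \<open>\<bar>det A\<bar>\<close> among the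
nonzero determinants of bordered matrices keeps it out of the open interval from 0 to 1.\<close>

lemma border_det_gap:
  fixes A B :: "int mat" and S :: "rat mat"
  assumes A: "A \<in> carrier_mat n n" and B: "B \<in> carrier_mat n n"
    and S: "S \<in> carrier_mat n n" and T: "T \<in> carrier_mat n n"
    and AT: "map_mat of_int A * T = 1\<^sub>m n" and SB: "S = map_mat of_int B * T"
    and nz: "det A \<noteq> 0"
    and min: "\<And>k b e. b \<in> carrier_mat n k \<Longrightarrow> e \<in> carrier_mat k k \<Longrightarrow>
      det (four_block_mat A b (transpose_mat b * B) (e + transpose_mat e)) = 0 \<or>
      \<bar>det A\<bar> \<le> \<bar>det (four_block_mat A b (transpose_mat b * B) (e + transpose_mat e))\<bar>"
    and b: "b \<in> carrier_mat n k" and e: "e \<in> carrier_mat k k"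
  defines "D \<equiv> det (map_mat of_int (e + transpose_mat e) - transpose_mat (map_mat of_int b) * (S * map_mat of_int b))"
  shows "D = 0 \<or> \<bar>D\<bar> \<ge> 1"
proof -
  let ?h = "map_mat of_int :: int mat \<Rightarrow> rat mat"
  let ?X = "four_block_mat A b (transpose_mat b * B) (e + transpose_mat e)"
  have hA: "?h A \<in> carrier_mat n n" and hB: "?h B \<in> carrier_mat n n" and hb: "?h b \<in> carrier_mat n k"
    and tb: "transpose_mat (?h b) \<in> carrier_mat k n"
    using A B b by auto
  have hX: "?h ?X = four_block_mat (?h A) (?h b) (transpose_mat (?h b) * ?h B) (?h (e + transpose_mat e))"
    using A B b e
    by (subst map_four_block_mat[of _ n n _ k _ k])
      (auto simp: of_int_hom.mat_hom_mult[of _ k n B n] map_mat_transpose[symmetric])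
  have "transpose_mat (?h b) * ?h B * (T * ?h b) = transpose_mat (?h b) * (?h B * (T * ?h b))"
    using assoc_mult_mat[OF tb hB mult_carrier_mat[OF T hb]] .
  also have "?h B * (T * ?h b) = S * ?h b" unfolding SB using assoc_mult_mat[OF hB T hb] by simp
  finally have eq: "transpose_mat (?h b) * ?h B * (T * ?h b) = transpose_mat (?h b) * (S * ?h b)" .
  have "of_int (det ?X) = det (?h ?X)" by simp
  also have "\<dots> = det (?h A) * D" unfolding hX D_def eq[symmetric]
    using e by (intro det_border[OF hA T AT hb mult_carrier_mat[OF tb hB]]) auto
  finally have "of_int (det ?X) = of_int (det A) * D" by simp
  moreover have "\<bar>of_int (det A) * D\<bar> = of_int \<bar>det A\<bar> * \<bar>D\<bar>" by (simp add: abs_mult)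
  ultimately have *: "of_int \<bar>det ?X\<bar> = of_int \<bar>det A\<bar> * \<bar>D\<bar>" by (metis of_int_abs)
  from min[OF b e] show ?thesis
  proof
    assume "det ?X = 0"
    then show ?thesis using * nz by auto
  next
    assume "\<bar>det A\<bar> \<le> \<bar>det ?X\<bar>"
    then have "(of_int \<bar>det A\<bar> :: rat) \<le> of_int \<bar>det A\<bar> * \<bar>D\<bar>" unfolding *[symmetric] by (simp only: of_int_le_iff)
    then show ?thesis using nz by (simp add: mult_le_cancel_left1)
  qed
qed

lemma congruence_entry:
  fixes S :: "rat mat"
  assumes S: "S \<in> carrier_mat n n" and b: "b \<in> carrier_mat n k" and p: "p < k" "q < k"
  shows "(transpose_mat b * (S * b)) $$ (p, q) = col b p \<bullet> (S *\<^sub>v col b q)"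
  using assms by (simp add: mult_mat_vec_def[symmetric] col_mult2[of _ n n _ k])

text \<open>Borders of width one show that \<open>S\<^sub>i\<^sub>i\<close> and \<open>S\<^sub>i\<^sub>j + S\<^sub>j\<^sub>i\<close> are integers. The skew part of \<open>S\<close> is invisible
to them. It enters through the determinant of a border of width three, which up to sign and
to an even integer that can be chosen freely is \<open>S\<^sub>i\<^sub>i + 2 S\<^sub>i\<^sub>j S\<^sub>j\<^sub>i\<close> or \<open>S\<^sub>i\<^sub>i - 2 S\<^sub>i\<^sub>j S\<^sub>j\<^sub>i\<close>.\<close>

lemma border_gap_imp_integral:
  fixes S :: "rat mat"
  assumes S: "S \<in> carrier_mat n n"
    and D: "\<And>k b e. b \<in> carrier_mat n k \<Longrightarrow> e \<in> carrier_mat k k \<Longrightarrow>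
       det (map_mat of_int (e + transpose_mat e) - transpose_mat (map_mat of_int b) * (S * map_mat of_int b)) = 0 \<or>
      \<bar>det (map_mat of_int (e + transpose_mat e) - transpose_mat (map_mat of_int b) * (S * map_mat of_int b))\<bar> \<ge> 1"
    and i: "i < n" and j: "j < n"
  shows "S $$ (i, j) \<in> \<int>"
proof -
  let ?h = "map_mat of_int :: int mat \<Rightarrow> rat mat" and ?v = "map_vec of_int :: int vec \<Rightarrow> rat vec"
  (* One extra row: the corner entry 2 x runs over all even integers, so the value of the
     quadratic form of S at v is at distance 0 or at least 1 from each of them. *)
  have q: "?v v \<bullet> (S *\<^sub>v ?v v) \<in> \<int>" if v: "v \<in> carrier_vec n" for v
  proof (rule rat_int_if_even_gaps)
    fix x :: int
    let ?b = "mat_of_cols n [v]" and ?e = "mat 1 1 (\<lambda>_. x)"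
    let ?M = "?h (?e + transpose_mat ?e) - transpose_mat (?h ?b) * (S * ?h ?b)"
    have M: "?M \<in> carrier_mat 1 1" using S by auto
    have "col (?h ?b) 0 = ?v v" using v by (intro eq_vecI) (auto simp: mat_of_cols_def)
    moreover have bc: "?h ?b \<in> carrier_mat n 1" by (auto simp: mat_of_cols_def)
    ultimately have W: "(transpose_mat (?h ?b) * (S * ?h ?b)) $$ (0, 0) = ?v v \<bullet> (S *\<^sub>v ?v v)"
      using congruence_entry[OF S bc, of 0 0] by simp
    have "?M $$ (0, 0) = ?h (?e + transpose_mat ?e) $$ (0, 0) - (transpose_mat (?h ?b) * (S * ?h ?b)) $$ (0, 0)"
      using S bc by (intro index_minus_mat) auto
    then have "det ?M = 2 * of_int x - ?v v \<bullet> (S *\<^sub>v ?v v)"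
      unfolding det_single[OF M] W by simp
    then show "2 * of_int x = ?v v \<bullet> (S *\<^sub>v ?v v) \<or> \<bar>2 * of_int x - ?v v \<bullet> (S *\<^sub>v ?v v)\<bar> \<ge> 1"
      using D[of ?b 1 ?e] by (simp add: mat_of_cols_carrier(1)[of n "[v]", simplified])
  qed
  let ?u = "unit_vec n :: nat \<Rightarrow> int vec" and ?ur = "unit_vec n :: nat \<Rightarrow> rat vec"
  have vu: "?v (?u l) = ?ur l" for l by (intro eq_vecI) (auto simp: unit_vec_def)
  have Su: "?ur k \<bullet> (S *\<^sub>v ?ur l) = S $$ (k, l)" if "k < n" "l < n" for k l
    using that S by simp
  have diag: "S $$ (l, l) \<in> \<int>" if "l < n" for l
    using q[of "?u l"] Su[OF that that] by (simp add: vu)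
  have sum: "S $$ (i, j) + S $$ (j, i) \<in> \<int>"
  proof -
    have vadd: "?v (?u i + ?u j) = ?ur i + ?ur j" by (intro eq_vecI) (auto simp: unit_vec_def)
    have c: "S *\<^sub>v ?ur i \<in> carrier_vec n" "S *\<^sub>v ?ur j \<in> carrier_vec n" using S by auto
    have "(?ur i + ?ur j) \<bullet> (S *\<^sub>v (?ur i + ?ur j)) =
      S $$ (i, i) + S $$ (j, i) + (S $$ (i, j) + S $$ (j, j))"
      unfolding mult_add_distrib_mat_vec[OF S unit_vec_carrier unit_vec_carrier]
      using c Su[OF i i] Su[OF i j] Su[OF j i] Su[OF j j]
      by (simp add: add_scalar_prod_distrib[of _ n] scalar_prod_add_distrib[of _ n])
    then have "S $$ (i, i) + S $$ (j, i) + (S $$ (i, j) + S $$ (j, j)) \<in> \<int>"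
      using q[of "?u i + ?u j"] unfolding vadd by simp
    then have "S $$ (i, i) + S $$ (j, i) + (S $$ (i, j) + S $$ (j, j)) - S $$ (i, i) - S $$ (j, j) \<in> \<int>"
      using diag[OF i] diag[OF j] by (intro Ints_diff)
    then show ?thesis by (simp add: algebra_simps)
  qed
  have "2 * (S $$ (i, j) * S $$ (j, i)) \<in> \<int>"
  proof -
    (* With t = 2 y - S(j,j) in {0, 1} the factor 2 t - 1 below is a sign. *)
    define y where "y = \<lceil>S $$ (j, j) / 2\<rceil>"
    obtain z where z: "S $$ (j, j) = of_int z" using diag[OF j] by (auto elim: Ints_cases)
    have y: "2 * of_int y - S $$ (j, j) = 0 \<or> 2 * of_int y - S $$ (j, j) = 1"
    proof -
      have "S $$ (j, j) / 2 \<le> of_int y" "of_int y < S $$ (j, j) / 2 + 1" unfolding y_def by linarith+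
      then have "(of_int z :: rat) \<le> of_int (2 * y)" "(of_int (2 * y) :: rat) < of_int (z + 2)" using z by auto
      then have "z \<le> 2 * y" "2 * y < z + 2" by (simp_all only: of_int_le_iff of_int_less_iff)
      then have "2 * y = z \<or> 2 * y = z + 1" by auto
      then have "(of_int (2 * y) :: rat) = of_int z \<or> (of_int (2 * y) :: rat) = of_int (z + 1)" by metis
      then show ?thesis using z by auto
    qed
    let ?p = "2 * (S $$ (i, j) * S $$ (j, i))"
    have key: "(2 * of_int x - S $$ (i, i)) * (2 * (2 * of_int y - S $$ (j, j)) - 1) - ?p = 0 \<or>
       \<bar>(2 * of_int x - S $$ (i, i)) * (2 * (2 * of_int y - S $$ (j, j)) - 1) - ?p\<bar> \<ge> 1" for x :: int
    proof -
      (* Three extra rows. The last one is not coupled to A; its corner entry 2 and its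
         coupling 1 to the second row turn the product of the mixed entries into twice it. *)
      let ?b = "mat_of_cols n [?u i, ?u j, 0\<^sub>v n]"
      let ?e = "mat_of_rows_list 3 [[x, 0, 0], [0, y, 1], [0, 0, 1]] :: int mat"
      define W where "W = transpose_mat (?h ?b) * (S * ?h ?b)"
      define E where "E = ?h (?e + transpose_mat ?e)"
      define M where "M = E - W"
      have bc: "?h ?b \<in> carrier_mat n 3" by (auto simp: mat_of_cols_def)
      have Wc: "W \<in> carrier_mat 3 3" using S by (auto simp: W_def)
      have M: "M \<in> carrier_mat 3 3" unfolding M_def by (rule minus_carrier_mat[OF Wc])
      have col: "col (?h ?b) 0 = ?ur i" "col (?h ?b) 1 = ?ur j" "col (?h ?b) 2 = 0\<^sub>v n"
        by (intro eq_vecI; auto simp: mat_of_cols_def unit_vec_def)+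
      have z: "S *\<^sub>v 0\<^sub>v n = 0\<^sub>v n" using S by (intro eq_vecI) auto
      have c: "S *\<^sub>v ?ur i \<in> carrier_vec n" "S *\<^sub>v ?ur j \<in> carrier_vec n" using S by auto
      note w = congruence_entry[OF S bc, folded W_def]
      have W: "W $$ (0, 0) = S $$ (i, i)" "W $$ (0, 1) = S $$ (i, j)" "W $$ (0, 2) = 0"
        "W $$ (1, 0) = S $$ (j, i)" "W $$ (1, 1) = S $$ (j, j)" "W $$ (1, 2) = 0"
        "W $$ (2, 0) = 0" "W $$ (2, 1) = 0" "W $$ (2, 2) = 0"
        using w[of 0 0] w[of 0 1] w[of 1 0] w[of 1 1] w[of 2 0] w[of 2 1] w[of 2 2] w[of 0 2] w[of 1 2]
          Su[OF i i] Su[OF i j] Su[OF j i] Su[OF j j] c unfolding col z by auto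
      have E: "E $$ (0, 0) = 2 * of_int x" "E $$ (0, 1) = 0" "E $$ (0, 2) = 0"
        "E $$ (1, 0) = 0" "E $$ (1, 1) = 2 * of_int y" "E $$ (1, 2) = 1"
        "E $$ (2, 0) = 0" "E $$ (2, 1) = 1" "E $$ (2, 2) = 2"
        unfolding E_def by (auto simp: mat_of_rows_list_def)
      have "M $$ (p, r) = E $$ (p, r) - W $$ (p, r)" if "p < 3" "r < 3" for p r
        using that Wc unfolding M_def by (intro index_minus_mat) auto
      then have "det M = (2 * of_int x - S $$ (i, i)) * (2 * (2 * of_int y - S $$ (j, j)) - 1) - ?p"
        unfolding det_3x3[OF M] by (simp only: E W) (simp add: E[simplified] W[simplified] algebra_simps)
      moreover have "?b \<in> carrier_mat n 3" "?e \<in> carrier_mat 3 3" by (auto simp: mat_of_rows_list_def mat_of_cols_def)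
      ultimately show ?thesis using D[of ?b 3 ?e] unfolding M_def E_def W_def by metis
    qed
    from y show ?thesis
    proof
      assume y0: "2 * of_int y - S $$ (j, j) = 0"
      have "S $$ (i, i) - ?p \<in> \<int>"
      proof (rule rat_int_if_even_gaps)
        fix x :: int
        have "(2 * of_int x - S $$ (i, i)) * (2 * 0 - 1) - ?p = - (2 * of_int x - (S $$ (i, i) - ?p))" by simp
        then show "2 * of_int x = S $$ (i, i) - ?p \<or> \<bar>2 * of_int x - (S $$ (i, i) - ?p)\<bar> \<ge> 1"
          using key[of x, unfolded y0] by (metis abs_minus_cancel eq_iff_diff_eq_0 neg_equal_0_iff_equal)
      qed
      from Ints_diff[OF diag[OF i] this] show ?thesis by simp
    next
      assume y1: "2 * of_int y - S $$ (j, j) = 1"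
      have "S $$ (i, i) + ?p \<in> \<int>"
      proof (rule rat_int_if_even_gaps)
        fix x :: int
        have "(2 * of_int x - S $$ (i, i)) * (2 * 1 - 1) - ?p = 2 * of_int x - (S $$ (i, i) + ?p)" by simp
        then show "2 * of_int x = S $$ (i, i) + ?p \<or> \<bar>2 * of_int x - (S $$ (i, i) + ?p)\<bar> \<ge> 1"
          using key[of x, unfolded y1] by (metis eq_iff_diff_eq_0)
      qed
      from Ints_diff[OF this diag[OF i]] show ?thesis by simp
    qed
  qed
  then show ?thesis using sum by (rule rat_int_if_twice_square_int[rotated])
qed

text \<open>If \<open>B = S A\<close> with \<open>S\<close> integral, then \<open>1 = C A + D B = (C + D S) A\<close>.\<close>

lemma integral_ratio_imp_unimodular:
  fixes A B :: "int mat"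
  assumes P: "primitive_pair n A B" and T: "T \<in> carrier_mat n n" and TA: "T * map_mat of_int A = 1\<^sub>m n"
    and int: "\<And>i j. i < n \<Longrightarrow> j < n \<Longrightarrow> (map_mat of_int B * T :: rat mat) $$ (i, j) \<in> \<int>"
  shows "\<bar>det A\<bar> = 1"
proof -
  obtain C D where A: "A \<in> carrier_mat n n" and B: "B \<in> carrier_mat n n"
    and C: "C \<in> carrier_mat n n" and D: "D \<in> carrier_mat n n" and CD: "C * A + D * B = 1\<^sub>m n"
    using P unfolding primitive_pair_def by auto
  let ?h = "map_mat of_int :: int mat \<Rightarrow> rat mat"
  have hA: "?h A \<in> carrier_mat n n" and hB: "?h B \<in> carrier_mat n n" using A B by auto
  (* The floor only converts the integral rational entries to the type of integers. *)
  define S where "S = map_mat floor (?h B * T)"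
  have S: "S \<in> carrier_mat n n" unfolding S_def using B T by auto
  have hS: "?h S = ?h B * T"
  proof (rule eq_matI)
    fix i j assume ij: "i < dim_row (?h B * T)" "j < dim_col (?h B * T)"
    then have "(?h B * T) $$ (i, j) \<in> \<int>" using int[of i j] B T by auto
    then show "?h S $$ (i, j) = (?h B * T) $$ (i, j)" using ij unfolding S_def
      by (auto simp del: index_mult_mat(1) elim: Ints_cases)
  qed (auto simp: S_def)
  have "?h (S * A) = ?h B"
    unfolding of_int_hom.mat_hom_mult[OF S A] hS assoc_mult_mat[OF hB T hA] TA using hB by simp
  then have SA: "S * A = B" by (rule of_int_hom.mat_hom_inj)
  have "(C + D * S) * A = C * A + D * (S * A)"
    unfolding add_mult_distrib_mat[OF C mult_carrier_mat[OF D S] A] assoc_mult_mat[OF D S A] ..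
  also have "\<dots> = 1\<^sub>m n" unfolding SA CD ..
  finally have "det ((C + D * S) * A) = 1" by simp
  moreover have "C + D * S \<in> carrier_mat n n" using mult_carrier_mat[OF D S] C by simp
  ultimately have "det (C + D * S) * det A = 1" using det_mult[OF _ A] by metis
  then show ?thesis by (metis abs_dvd_iff abs_ge_zero dvd_triv_right zdvd1_eq abs_of_nonneg)
qed

theorem exists_stab_shear_unimodular:
  assumes P: "primitive_pair n A B"
  shows "\<exists>N A1 B1. stab_shear n A B N A1 B1 \<and> \<bar>det A1\<bar> = 1"
proof -
  (* Determinants reachable by sheared stabilisations; the least one is shown to be 1. *)
  define good where "good d \<longleftrightarrow> (\<exists>N A1 B1. stab_shear n A B N A1 B1 \<and> det A1 \<noteq> 0 \<and> nat \<bar>det A1\<bar> = d)" for d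
  have An: "A \<in> carrier_mat n n" and Bn: "B \<in> carrier_mat n n" using P unfolding primitive_pair_def by auto
  obtain d0 where "good d0" using exists_stab_shear_odd[OF P] unfolding good_def by fastforce
  then have least: "good (LEAST d. good d)" "\<And>d. good d \<Longrightarrow> (LEAST d. good d) \<le> d"
    by (auto intro: LeastI Least_le)
  then obtain N A1 B1 where st: "stab_shear n A B N A1 B1" and nz: "det A1 \<noteq> 0"
    and dA1: "nat \<bar>det A1\<bar> = (LEAST d. good d)" unfolding good_def by auto
  have P1: "primitive_pair N A1 B1" by (rule primitive_pair_stab_shear[OF P st])
  then have A1: "A1 \<in> carrier_mat N N" and B1: "B1 \<in> carrier_mat N N" unfolding primitive_pair_def by auto
  have min: "det (four_block_mat A1 b (transpose_mat b * B1) (e + transpose_mat e)) = 0 \<or>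
      \<bar>det A1\<bar> \<le> \<bar>det (four_block_mat A1 b (transpose_mat b * B1) (e + transpose_mat e))\<bar>"
    if b: "b \<in> carrier_mat N k" and e: "e \<in> carrier_mat k k" for b e k
  proof (rule disjCI)
    let ?X = "four_block_mat A1 b (transpose_mat b * B1) (e + transpose_mat e)"
    assume "\<not> \<bar>det A1\<bar> \<le> \<bar>det ?X\<bar>"
    show "det ?X = 0"
    proof (rule ccontr)
      assume "det ?X \<noteq> 0"
      moreover have "stab_shear n A B (N + k) ?X (block_sum B1 (1\<^sub>m k))"
        by (rule stab_shear_trans[OF An Bn st stab_shear_border[OF A1 B1 b e]])
      ultimately have "good (nat \<bar>det ?X\<bar>)" unfolding good_def by blast
      then have "nat \<bar>det A1\<bar> \<le> nat \<bar>det ?X\<bar>" using least(2) dA1 by simp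
      then show False using \<open>\<not> \<bar>det A1\<bar> \<le> \<bar>det ?X\<bar>\<close> by simp
    qed
  qed
  let ?h = "map_mat of_int :: int mat \<Rightarrow> rat mat"
  have hA1: "?h A1 \<in> carrier_mat N N" using A1 by simp
  have "det (?h A1) \<noteq> 0" using nz by simp
  then obtain T where T: "T \<in> carrier_mat N N" "T * ?h A1 = 1\<^sub>m N" "?h A1 * T = 1\<^sub>m N"
    using det_non_zero_imp_unit[OF hA1] unfolding Units_def ring_mat_def by auto
  have S: "?h B1 * T \<in> carrier_mat N N" using B1 T by auto
  have "(?h B1 * T) $$ (i, j) \<in> \<int>" if "i < N" "j < N" for i j
    by (rule border_gap_imp_integral[OF S _ that])
      (rule border_det_gap[OF A1 B1 S T(1,3) refl nz min], assumption+)
  then have "\<bar>det A1\<bar> = 1" by (rule integral_ratio_imp_unimodular[OF P1 T(1,2)])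
  then show ?thesis using st by blast
qed

section \<open>Forms modulo symmetrised forms\<close>

definition biadditive :: "('a, 'b) monoid_scheme \<Rightarrow> ('a \<Rightarrow> 'a \<Rightarrow> int) \<Rightarrow> bool" where
  "biadditive M f \<longleftrightarrow> (\<forall>x\<in>carrier M. \<forall>y\<in>carrier M. \<forall>z\<in>carrier M.
     f (x \<otimes>\<^bsub>M\<^esub> y) z = f x z + f y z \<and> f x (y \<otimes>\<^bsub>M\<^esub> z) = f x y + f x z)"

text \<open>Elements of \<open>Forms M\<close> are extensional in both arguments; this is the extensional form of a map that
is only relevant on the carrier.\<close>

definition ext_form :: "('a, 'b) monoid_scheme \<Rightarrow> ('a \<Rightarrow> 'a \<Rightarrow> int) \<Rightarrow> 'a \<Rightarrow> 'a \<Rightarrow> int" where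
  "ext_form M f = (\<lambda>x\<in>carrier M. \<lambda>y\<in>carrier M. f x y)"

lemma ext_form_apply [simp]: "x \<in> carrier M \<Longrightarrow> y \<in> carrier M \<Longrightarrow> ext_form M f x y = f x y"
  unfolding ext_form_def by simp

lemma ext_form_cong: "(\<And>x y. x \<in> carrier M \<Longrightarrow> y \<in> carrier M \<Longrightarrow> f x y = g x y) \<Longrightarrow> ext_form M f = ext_form M g"
  unfolding ext_form_def by (intro restrict_ext) auto

lemma comm_group_closed: "comm_group M \<Longrightarrow> x \<in> carrier M \<Longrightarrow> y \<in> carrier M \<Longrightarrow> x \<otimes>\<^bsub>M\<^esub> y \<in> carrier M"
  by (simp add: comm_groupE)

lemma carrier_dual: "carrier (dual M) = {g \<in> extensional (carrier M). \<forall>x\<in>carrier M. \<forall>y\<in>carrier M.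
    g (x \<otimes>\<^bsub>M\<^esub> y) = g x + g y}"
  unfolding dual_def Hom_group_def by (auto simp: hom_def)

lemma mult_dual: "g \<otimes>\<^bsub>dual M\<^esub> h = (\<lambda>x\<in>carrier M. g x + h x)"
  unfolding dual_def Hom_group_def by simp

lemma one_dual: "\<one>\<^bsub>dual M\<^esub> = (\<lambda>x\<in>carrier M. 0)"
  unfolding dual_def Hom_group_def by simp

lemma Forms_iff:
  assumes "comm_group M"
  shows "\<phi> \<in> carrier (Forms M) \<longleftrightarrow> ext_form M \<phi> = \<phi> \<and> biadditive M \<phi>"
proof
  assume "\<phi> \<in> carrier (Forms M)"
  then have h: "\<phi> \<in> hom M (dual M)" and e: "\<phi> \<in> extensional (carrier M)"
    unfolding Forms_def Hom_group_def by auto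
  have c: "\<phi> x \<in> carrier (dual M)" if "x \<in> carrier M" for x using h that unfolding hom_def by auto
  have "ext_form M \<phi> = \<phi>"
  proof
    fix x show "ext_form M \<phi> x = \<phi> x"
    proof (cases "x \<in> carrier M")
      case True
      with c[OF True] show ?thesis by (auto simp: ext_form_def carrier_dual extensional_restrict)
    next
      case False
      with e show ?thesis by (simp add: ext_form_def extensional_def)
    qed
  qed
  moreover have "biadditive M \<phi>"
    using c h unfolding biadditive_def by (auto simp: carrier_dual hom_def mult_dual)
  ultimately show "ext_form M \<phi> = \<phi> \<and> biadditive M \<phi>" by simp
next
  assume *: "ext_form M \<phi> = \<phi> \<and> biadditive M \<phi>"
  then have b: "biadditive M \<phi>" by simp
  have e: "\<phi> x = restrict (\<phi> x) (carrier M)" if "x \<in> carrier M" for x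
    using * that unfolding ext_form_def by (metis restrict_apply')
  have "\<phi> (x \<otimes>\<^bsub>M\<^esub> y) = \<phi> x \<otimes>\<^bsub>dual M\<^esub> \<phi> y" if "x \<in> carrier M" "y \<in> carrier M" for x y
    using b that e[OF comm_group_closed[OF assms that]] unfolding mult_dual biadditive_def
    by (metis (no_types, lifting) restrict_ext)
  moreover have "\<phi> x \<in> carrier (dual M)" if "x \<in> carrier M" for x
    using b that e[OF that] unfolding carrier_dual biadditive_def by (auto simp: extensional_def restrict_def) metis
  moreover have "\<phi> \<in> extensional (carrier M)" using * unfolding ext_form_def by (metis restrict_extensional)
  ultimately show "\<phi> \<in> carrier (Forms M)" unfolding Forms_def Hom_group_def by (auto simp: hom_def)
qed

lemma ext_form_in_Forms:
  assumes "comm_group M" "biadditive M f"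
  shows "ext_form M f \<in> carrier (Forms M)"
  unfolding Forms_iff[OF assms(1)] using assms comm_group_closed[OF assms(1)]
  by (auto simp: biadditive_def intro!: ext_form_cong)

lemma Forms_biadditive: "comm_group M \<Longrightarrow> \<phi> \<in> carrier (Forms M) \<Longrightarrow> biadditive M \<phi>"
  by (simp add: Forms_iff)

lemma ext_form_Forms: "comm_group M \<Longrightarrow> \<phi> \<in> carrier (Forms M) \<Longrightarrow> ext_form M \<phi> = \<phi>"
  by (simp add: Forms_iff)

lemma biadditive_add: "biadditive M f \<Longrightarrow> biadditive M g \<Longrightarrow> biadditive M (\<lambda>x y. f x y + g x y)"
  unfolding biadditive_def by auto

lemma biadditive_diff: "biadditive M f \<Longrightarrow> biadditive M g \<Longrightarrow> biadditive M (\<lambda>x y. f x y - g x y)"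
  unfolding biadditive_def by auto

lemma biadditive_swap: "biadditive M f \<Longrightarrow> biadditive M (\<lambda>x y. f y x)"
  unfolding biadditive_def by auto

lemma biadditive_zero: "biadditive M (\<lambda>x y. 0)"
  unfolding biadditive_def by auto

lemma biadditive_comp:
  assumes "biadditive N g" "f \<in> hom M N"
  shows "biadditive M (\<lambda>x y. g (f x) (f y))"
  using assms unfolding biadditive_def hom_def by (auto simp: Pi_iff)

lemma biadditive_ext_form:
  "comm_group M \<Longrightarrow> biadditive M (ext_form M f) \<longleftrightarrow> biadditive M f"
  unfolding biadditive_def by (auto simp: comm_group_closed)

lemma mult_Forms: "\<phi> \<otimes>\<^bsub>Forms M\<^esub> \<chi> = ext_form M (\<lambda>x y. \<phi> x y + \<chi> x y)"
  unfolding Forms_def Hom_group_def mult_dual[unfolded dual_def] dual_def ext_form_def by (simp add: mult_dual[unfolded dual_def Hom_group_def] Hom_group_def)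

lemma one_minus_T_eq: "one_minus_T M \<chi> = ext_form M (\<lambda>x y. \<chi> x y + \<chi> y x)"
  unfolding one_minus_T_def T_minus_def adj_def ext_form_def by (intro restrict_ext) auto

lemma Q_class_eq: "Q_class M \<phi> = {ext_form M (\<lambda>x y. \<phi> x y + \<chi> x y + \<chi> y x) | \<chi>. \<chi> \<in> carrier (Forms M)}"
proof -
  have "one_minus_T M \<chi> \<otimes>\<^bsub>Forms M\<^esub> \<phi> = ext_form M (\<lambda>x y. \<phi> x y + \<chi> x y + \<chi> y x)" for \<chi>
    unfolding mult_Forms one_minus_T_eq by (intro ext_form_cong) auto
  then show ?thesis unfolding Q_class_def r_coset_def by auto
qed

lemma Q_class_self:
  assumes "comm_group M" "\<phi> \<in> carrier (Forms M)"
  shows "\<phi> \<in> Q_class M \<phi>"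
proof -
  have "\<phi> = ext_form M (\<lambda>x y. \<phi> x y + ext_form M (\<lambda>x y. 0) x y + ext_form M (\<lambda>x y. 0) y x)"
  proof -
    have "ext_form M \<phi> = ext_form M (\<lambda>x y. \<phi> x y + ext_form M (\<lambda>x y. 0) x y + ext_form M (\<lambda>x y. 0) y x)"
      by (rule ext_form_cong) simp
    then show ?thesis unfolding ext_form_Forms[OF assms] .
  qed
  then show ?thesis unfolding Q_class_eq using ext_form_in_Forms[OF assms(1) biadditive_zero] by blast
qed

lemma Q_class_subset_Forms:
  assumes "comm_group M" "\<phi> \<in> carrier (Forms M)"
  shows "Q_class M \<phi> \<subseteq> carrier (Forms M)"
  unfolding Q_class_eq
proof clarify
  fix \<chi> assume "\<chi> \<in> carrier (Forms M)"
  note b = Forms_biadditive[OF assms] Forms_biadditive[OF assms(1) this]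
  show "ext_form M (\<lambda>x y. \<phi> x y + \<chi> x y + \<chi> y x) \<in> carrier (Forms M)"
    by (rule ext_form_in_Forms[OF assms(1) biadditive_add[OF biadditive_add[OF b] biadditive_swap[OF b(2)]]])
qed

text \<open>Equality in \<open>Q\<^sub>-\<close> of the classes of two biadditive maps.\<close>

definition quadr_equiv :: "('a, 'b) monoid_scheme \<Rightarrow> ('a \<Rightarrow> 'a \<Rightarrow> int) \<Rightarrow> ('a \<Rightarrow> 'a \<Rightarrow> int) \<Rightarrow> bool" where
  "quadr_equiv M \<phi> \<phi>' \<longleftrightarrow> (\<exists>\<chi>. biadditive M \<chi> \<and>
     (\<forall>x\<in>carrier M. \<forall>y\<in>carrier M. \<phi>' x y = \<phi> x y + \<chi> x y + \<chi> y x))"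

lemma quadr_equiv_sym: "quadr_equiv M \<phi> \<phi>' \<Longrightarrow> quadr_equiv M \<phi>' \<phi>"
  unfolding quadr_equiv_def
proof (elim exE conjE)
  fix \<chi> assume "biadditive M \<chi>" "\<forall>x\<in>carrier M. \<forall>y\<in>carrier M. \<phi>' x y = \<phi> x y + \<chi> x y + \<chi> y x"
  then show "\<exists>\<chi>. biadditive M \<chi> \<and> (\<forall>x\<in>carrier M. \<forall>y\<in>carrier M. \<phi> x y = \<phi>' x y + \<chi> x y + \<chi> y x)"
    using biadditive_diff[OF biadditive_zero] by (intro exI[of _ "\<lambda>x y. 0 - \<chi> x y"]) auto
qed

lemma quadr_equiv_trans: "quadr_equiv M \<phi> \<phi>' \<Longrightarrow> quadr_equiv M \<phi>' \<phi>'' \<Longrightarrow> quadr_equiv M \<phi> \<phi>''"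
  unfolding quadr_equiv_def
proof (elim exE conjE)
  fix \<chi> \<chi>' assume "biadditive M \<chi>" "\<forall>x\<in>carrier M. \<forall>y\<in>carrier M. \<phi>' x y = \<phi> x y + \<chi> x y + \<chi> y x"
    "biadditive M \<chi>'" "\<forall>x\<in>carrier M. \<forall>y\<in>carrier M. \<phi>'' x y = \<phi>' x y + \<chi>' x y + \<chi>' y x"
  then show "\<exists>\<chi>. biadditive M \<chi> \<and> (\<forall>x\<in>carrier M. \<forall>y\<in>carrier M. \<phi>'' x y = \<phi> x y + \<chi> x y + \<chi> y x)"
    by (intro exI[of _ "\<lambda>x y. \<chi> x y + \<chi>' x y"]) (auto intro: biadditive_add)
qed

lemma quadr_equiv_cong:
  assumes "\<And>x y. x \<in> carrier M \<Longrightarrow> y \<in> carrier M \<Longrightarrow> \<phi> x y = \<psi> x y"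
    "\<And>x y. x \<in> carrier M \<Longrightarrow> y \<in> carrier M \<Longrightarrow> \<phi>' x y = \<psi>' x y"
  shows "quadr_equiv M \<phi> \<phi>' \<longleftrightarrow> quadr_equiv M \<psi> \<psi>'"
  unfolding quadr_equiv_def using assms by auto

lemma quadr_equiv_comp:
  assumes "quadr_equiv N \<phi> \<phi>'" "f \<in> hom M N"
  shows "quadr_equiv M (\<lambda>x y. \<phi> (f x) (f y)) (\<lambda>x y. \<phi>' (f x) (f y))"
proof -
  obtain \<chi> where "biadditive N \<chi>" "\<forall>x\<in>carrier N. \<forall>y\<in>carrier N. \<phi>' x y = \<phi> x y + \<chi> x y + \<chi> y x"
    using assms(1) unfolding quadr_equiv_def by auto
  then show ?thesis unfolding quadr_equiv_def using biadditive_comp[OF _ assms(2)] assms(2)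
    by (intro exI[of _ "\<lambda>x y. \<chi> (f x) (f y)"]) (auto simp: hom_def Pi_iff)
qed

lemma mem_Q_class_iff:
  assumes "comm_group M" "\<phi>' \<in> carrier (Forms M)"
  shows "\<phi>' \<in> Q_class M \<phi> \<longleftrightarrow> quadr_equiv M \<phi> \<phi>'"
proof
  assume "\<phi>' \<in> Q_class M \<phi>"
  then obtain \<chi> where "\<chi> \<in> carrier (Forms M)" "\<phi>' = ext_form M (\<lambda>x y. \<phi> x y + \<chi> x y + \<chi> y x)"
    unfolding Q_class_eq by auto
  then show "quadr_equiv M \<phi> \<phi>'" unfolding quadr_equiv_def
    using Forms_biadditive[OF assms(1)] by (intro exI[of _ \<chi>]) auto
next
  assume "quadr_equiv M \<phi> \<phi>'"
  then obtain \<chi> where \<chi>: "biadditive M \<chi>" "\<forall>x\<in>carrier M. \<forall>y\<in>carrier M. \<phi>' x y = \<phi> x y + \<chi> x y + \<chi> y x"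
    unfolding quadr_equiv_def by auto
  have "\<phi>' = ext_form M \<phi>'" using ext_form_Forms[OF assms] by simp
  also have "\<dots> = ext_form M (\<lambda>x y. \<phi> x y + ext_form M \<chi> x y + ext_form M \<chi> y x)"
    using \<chi> by (intro ext_form_cong) auto
  finally show "\<phi>' \<in> Q_class M \<phi>" unfolding Q_class_eq using ext_form_in_Forms[OF assms(1) \<chi>(1)] by blast
qed

lemma Q_class_eq_iff:
  assumes "comm_group M" "\<phi> \<in> carrier (Forms M)" "\<phi>' \<in> carrier (Forms M)"
  shows "Q_class M \<phi> = Q_class M \<phi>' \<longleftrightarrow> quadr_equiv M \<phi> \<phi>'"
proof
  assume "Q_class M \<phi> = Q_class M \<phi>'"
  then show "quadr_equiv M \<phi> \<phi>'" using Q_class_self[OF assms(1,3)] mem_Q_class_iff[OF assms(1,3)] by metis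
next
  assume e: "quadr_equiv M \<phi> \<phi>'"
  have "\<xi> \<in> Q_class M \<phi> \<longleftrightarrow> \<xi> \<in> Q_class M \<phi>'" for \<xi>
  proof (cases "\<xi> \<in> carrier (Forms M)")
    case True
    then show ?thesis unfolding mem_Q_class_iff[OF assms(1) True]
      using e quadr_equiv_trans quadr_equiv_sym by blast
  next
    case False
    then show ?thesis using Q_class_subset_Forms assms by blast
  qed
  then show "Q_class M \<phi> = Q_class M \<phi>'" by blast
qed

lemma carrier_Q_minus: "carrier (Q_minus M) = Q_class M ` carrier (Forms M)"
  unfolding Q_minus_def FactGroup_def RCOSETS_def Q_class_def by auto

lemma one_Q_minus:
  assumes "comm_group M"
  shows "\<one>\<^bsub>Q_minus M\<^esub> = Q_class M (ext_form M (\<lambda>x y. 0))"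
proof -
  have "\<one>\<^bsub>Q_minus M\<^esub> = one_minus_T M ` carrier (Forms M)" unfolding Q_minus_def FactGroup_def by simp
  also have "\<dots> = Q_class M (ext_form M (\<lambda>x y. 0))"
    unfolding Q_class_eq one_minus_T_eq by (auto intro!: ext_form_cong image_eqI) 
  finally show ?thesis .
qed

text \<open>For the operations on \<open>Q\<^sub>-\<close> that are defined as a union, or as the element of a singleton, over all
representatives.\<close>

lemma UN_constant_value: "a \<in> A \<Longrightarrow> (\<And>x. x \<in> A \<Longrightarrow> f x = c) \<Longrightarrow> (\<Union>x\<in>A. f x) = c"
  by auto

lemma image_constant_value: "a \<in> A \<Longrightarrow> (\<And>x. x \<in> A \<Longrightarrow> f x = c) \<Longrightarrow> f ` A = {c}"
  by auto

lemma Q_pullback_Q_class: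
  assumes N: "comm_group N" and M: "comm_group M" and f: "f \<in> hom N M" and \<phi>: "\<phi> \<in> carrier (Forms M)"
  shows "Q_pullback N f (Q_class M \<phi>) = Q_class N (ext_form N (\<lambda>x y. \<phi> (f x) (f y)))"
  unfolding Q_pullback_def ext_form_def[symmetric]
proof (rule UN_constant_value[OF Q_class_self[OF M \<phi>]])
  have c: "ext_form N (\<lambda>x y. \<xi> (f x) (f y)) \<in> carrier (Forms N)" if "\<xi> \<in> carrier (Forms M)" for \<xi>
    by (rule ext_form_in_Forms[OF N biadditive_comp[OF Forms_biadditive[OF M that] f]])
  fix \<phi>' assume \<phi>': "\<phi>' \<in> Q_class M \<phi>"
  then have "\<phi>' \<in> carrier (Forms M)" using Q_class_subset_Forms[OF M \<phi>] by auto
  with \<phi>' have "quadr_equiv M \<phi> \<phi>'" using mem_Q_class_iff[OF M] by blast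
  from quadr_equiv_sym[OF quadr_equiv_comp[OF this f]]
  show "Q_class N (ext_form N (\<lambda>x y. \<phi>' (f x) (f y))) = Q_class N (ext_form N (\<lambda>x y. \<phi> (f x) (f y)))"
    using Q_class_eq_iff[OF N c[OF \<open>\<phi>' \<in> carrier (Forms M)\<close>] c[OF \<phi>]] by (simp add: quadr_equiv_def)
qed

lemma skew_sym_Q_class:
  assumes M: "comm_group M" and \<phi>: "\<phi> \<in> carrier (Forms M)"
  shows "skew_sym M (Q_class M \<phi>) = ext_form M (\<lambda>x y. \<phi> x y - \<phi> y x)"
proof -
  have "(\<lambda>x\<in>carrier M. \<lambda>y\<in>carrier M. \<phi>' x y - adj M \<phi>' x y) = ext_form M (\<lambda>x y. \<phi> x y - \<phi> y x)"
    if "\<phi>' \<in> Q_class M \<phi>" for \<phi>'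
    using that unfolding Q_class_eq ext_form_def adj_def by (auto intro!: restrict_ext)
  then have "(\<lambda>\<phi>. \<lambda>x\<in>carrier M. \<lambda>y\<in>carrier M. \<phi> x y - adj M \<phi> x y) ` Q_class M \<phi> = {ext_form M (\<lambda>x y. \<phi> x y - \<phi> y x)}"
    by (rule image_constant_value[OF Q_class_self[OF M \<phi>]])
  then show ?thesis unfolding skew_sym_def by simp
qed

lemma Q_sum_Q_class:
  assumes M: "comm_group M" and N: "comm_group N" and MN: "comm_group (M \<times>\<times> N)"
    and \<phi>: "\<phi> \<in> carrier (Forms M)" and \<psi>: "\<psi> \<in> carrier (Forms N)"
  shows "Q_sum M N (Q_class M \<phi>) (Q_class N \<psi>) =
    Q_class (M \<times>\<times> N) (ext_form (M \<times>\<times> N) (\<lambda>x y. \<phi> (fst x) (fst y) + \<psi> (snd x) (snd y)))"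
proof -
  let ?P = "M \<times>\<times> N"
  have h: "fst \<in> hom ?P M" "snd \<in> hom ?P N" by (auto simp: hom_def DirProd_def)
  have c: "ext_form ?P (\<lambda>x y. \<xi> (fst x) (fst y) + \<xi>' (snd x) (snd y)) \<in> carrier (Forms ?P)"
    if "\<xi> \<in> carrier (Forms M)" "\<xi>' \<in> carrier (Forms N)" for \<xi> \<xi>'
    by (intro ext_form_in_Forms[OF MN] biadditive_add biadditive_comp[OF Forms_biadditive[OF M that(1)] h(1)]
        biadditive_comp[OF Forms_biadditive[OF N that(2)] h(2)])
  have eq: "Q_class ?P (ext_form ?P (\<lambda>x y. \<phi>' (fst x) (fst y) + \<psi>' (snd x) (snd y))) =
    Q_class ?P (ext_form ?P (\<lambda>x y. \<phi> (fst x) (fst y) + \<psi> (snd x) (snd y)))"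
    if "\<phi>' \<in> Q_class M \<phi>" "\<psi>' \<in> Q_class N \<psi>" for \<phi>' \<psi>'
  proof -
    have F: "\<phi>' \<in> carrier (Forms M)" "\<psi>' \<in> carrier (Forms N)"
      using that Q_class_subset_Forms[OF M \<phi>] Q_class_subset_Forms[OF N \<psi>] by auto
    have "quadr_equiv M \<phi> \<phi>'" "quadr_equiv N \<psi> \<psi>'"
      using that mem_Q_class_iff[OF M F(1)] mem_Q_class_iff[OF N F(2)] by auto
    from quadr_equiv_comp[OF quadr_equiv_sym[OF this(1)] h(1)] quadr_equiv_comp[OF quadr_equiv_sym[OF this(2)] h(2)]
    obtain \<chi> \<chi>' where "biadditive ?P \<chi>" "biadditive ?P \<chi>'"
      "\<forall>x\<in>carrier ?P. \<forall>y\<in>carrier ?P. \<phi> (fst x) (fst y) = \<phi>' (fst x) (fst y) + \<chi> x y + \<chi> y x"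
      "\<forall>x\<in>carrier ?P. \<forall>y\<in>carrier ?P. \<psi> (snd x) (snd y) = \<psi>' (snd x) (snd y) + \<chi>' x y + \<chi>' y x"
      unfolding quadr_equiv_def by blast
    note \<chi> = this
    have "\<phi> (fst x) (fst y) + \<psi> (snd x) (snd y) =
        \<phi>' (fst x) (fst y) + \<psi>' (snd x) (snd y) + (\<chi> x y + \<chi>' x y) + (\<chi> y x + \<chi>' y x)"
      if "x \<in> carrier ?P" "y \<in> carrier ?P" for x y
      using bspec[OF bspec[OF \<chi>(3) that(1)] that(2)] bspec[OF bspec[OF \<chi>(4) that(1)] that(2)] by linarith
    then show ?thesis
      unfolding Q_class_eq_iff[OF MN c[OF F] c[OF \<phi> \<psi>]] quadr_equiv_def
      using biadditive_add[OF \<chi>(1,2)] by (intro exI[of _ "\<lambda>x y. \<chi> x y + \<chi>' x y"]) simp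
  qed
  show ?thesis unfolding Q_sum_def ext_form_def[symmetric]
    by (intro UN_constant_value[OF Q_class_self[OF M \<phi>]] UN_constant_value[OF Q_class_self[OF N \<psi>]] eq)
qed

definition mk_formation :: "'a monoid \<Rightarrow> ('a \<Rightarrow> 'a \<Rightarrow> int) \<Rightarrow> 'a set \<Rightarrow> 'a set \<Rightarrow> 'a quasi_formation" where
  "mk_formation M f L V = \<lparr>qf_module = M, qf_form = Q_class M (ext_form M f), qf_lag = L, qf_half = V\<rparr>"

text \<open>The conditions under which isomorphisms and sums can be computed on representatives. They are
weaker than being a quasi-formation, and so immediate for sums and hyperbolic forms.\<close>

definition formation_data :: "'a monoid \<Rightarrow> ('a \<Rightarrow> 'a \<Rightarrow> int) \<Rightarrow> 'a set \<Rightarrow> 'a set \<Rightarrow> bool" where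
  "formation_data M f L V \<longleftrightarrow> comm_group M \<and> biadditive M f \<and> L \<subseteq> carrier M \<and> V \<subseteq> carrier M"

lemma qf_iso_mk_formation_iff:
  assumes "formation_data M f L V" "formation_data N g K W"
  shows "qf_iso (mk_formation M f L V) (mk_formation N g K W) \<longleftrightarrow>
    (\<exists>h. h \<in> iso M N \<and> quadr_equiv M f (\<lambda>x y. g (h x) (h y)) \<and> h ` L = K \<and> h ` V = W)"
proof -
  have M: "comm_group M" and N: "comm_group N" and f: "biadditive M f" and g: "biadditive N g"
    using assms unfolding formation_data_def by auto
  have "isometry M (Q_class M (ext_form M f)) N (Q_class N (ext_form N g)) h \<longleftrightarrow>
      h \<in> iso M N \<and> quadr_equiv M f (\<lambda>x y. g (h x) (h y))" for h
  proof (cases "h \<in> iso M N")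
    case True
    then have h: "h \<in> hom M N" unfolding iso_def by auto
    have c: "ext_form M (\<lambda>x y. ext_form N g (h x) (h y)) \<in> carrier (Forms M)"
      using ext_form_in_Forms[OF M biadditive_comp[OF _ h]] biadditive_ext_form[OF N] g by blast
    have "Q_pullback M h (Q_class N (ext_form N g)) = Q_class M (ext_form M f) \<longleftrightarrow>
        quadr_equiv M (ext_form M f) (ext_form M (\<lambda>x y. ext_form N g (h x) (h y)))"
      unfolding Q_pullback_Q_class[OF M N h ext_form_in_Forms[OF N g]]
      using Q_class_eq_iff[OF M ext_form_in_Forms[OF M f] c] by auto
    also have "\<dots> \<longleftrightarrow> quadr_equiv M f (\<lambda>x y. g (h x) (h y))"
      using h by (intro quadr_equiv_cong) (auto simp: hom_def Pi_iff)
    finally show ?thesis unfolding isometry_def using True by simp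
  qed (simp add: isometry_def)
  then show ?thesis unfolding qf_iso_def mk_formation_def by auto
qed

lemma qf_iso_mk_formation_I:
  assumes "formation_data M f L V" "formation_data N g K W" "h \<in> iso M N" "biadditive M \<chi>"
    "\<And>x y. x \<in> carrier M \<Longrightarrow> y \<in> carrier M \<Longrightarrow> g (h x) (h y) = f x y + \<chi> x y + \<chi> y x"
    "h ` L = K" "h ` V = W"
  shows "qf_iso (mk_formation M f L V) (mk_formation N g K W)"
  unfolding qf_iso_mk_formation_iff[OF assms(1,2)] quadr_equiv_def using assms(3-) by blast

lemma quasi_formation_cases:
  assumes "comm_group (qf_module X)" "qf_form X \<in> carrier (Q_minus (qf_module X))"
    "qf_lag X \<subseteq> carrier (qf_module X)" "qf_half X \<subseteq> carrier (qf_module X)"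
  obtains f where "X = mk_formation (qf_module X) f (qf_lag X) (qf_half X)"
    "formation_data (qf_module X) f (qf_lag X) (qf_half X)"
proof -
  obtain f where f: "f \<in> carrier (Forms (qf_module X))" "qf_form X = Q_class (qf_module X) f"
    using assms(2) unfolding carrier_Q_minus by auto
  show thesis
    by (rule that[of f])
      (use f assms in \<open>auto simp: mk_formation_def formation_data_def ext_form_Forms[OF assms(1)] Forms_biadditive\<close>)
qed

lemma qf_iso_mk_formation_trans:
  assumes "formation_data M f L V" "formation_data N g K W" "formation_data P k J U"
    "qf_iso (mk_formation M f L V) (mk_formation N g K W)" "qf_iso (mk_formation N g K W) (mk_formation P k J U)"
  shows "qf_iso (mk_formation M f L V) (mk_formation P k J U)"
proof -
  obtain h where h: "h \<in> iso M N" "quadr_equiv M f (\<lambda>x y. g (h x) (h y))" "h ` L = K" "h ` V = W"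
    using assms(4) unfolding qf_iso_mk_formation_iff[OF assms(1,2)] by auto
  obtain h' where h': "h' \<in> iso N P" "quadr_equiv N g (\<lambda>x y. k (h' x) (h' y))" "h' ` K = J" "h' ` W = U"
    using assms(5) unfolding qf_iso_mk_formation_iff[OF assms(2,3)] by auto
  have "h \<in> hom M N" using h(1) unfolding iso_def by simp
  from quadr_equiv_trans[OF h(2) quadr_equiv_comp[OF h'(2) this]] show ?thesis
    unfolding qf_iso_mk_formation_iff[OF assms(1,3)]
    using iso_set_trans[OF h(1) h'(1)] h(3,4) h'(3,4) by (intro exI[of _ "h' \<circ> h"]) (auto simp: image_comp[symmetric])
qed

lemma qf_iso_mk_formation_sym:
  assumes "formation_data M f L V" "formation_data N g K W" "qf_iso (mk_formation M f L V) (mk_formation N g K W)"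
  shows "qf_iso (mk_formation N g K W) (mk_formation M f L V)"
proof -
  have M: "comm_group M" using assms(1) unfolding formation_data_def by simp
  have LV: "L \<subseteq> carrier M" "V \<subseteq> carrier M" using assms(1) unfolding formation_data_def by auto
  obtain h where h: "h \<in> iso M N" "quadr_equiv M f (\<lambda>x y. g (h x) (h y))" "h ` L = K" "h ` V = W"
    using assms(3) unfolding qf_iso_mk_formation_iff[OF assms(1,2)] by auto
  let ?i = "inv_into (carrier M) h"
  have i: "?i \<in> iso N M" using group.iso_set_sym[OF comm_group.axioms(2)[OF M] h(1)] .
  then have ih: "?i \<in> hom N M" unfolding iso_def by simp
  have bij: "bij_betw h (carrier M) (carrier N)" using h(1) unfolding iso_def by simp
  have "quadr_equiv N (\<lambda>x y. g (h (?i x)) (h (?i y))) (\<lambda>x y. f (?i x) (?i y))"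
    using quadr_equiv_comp[OF quadr_equiv_sym[OF h(2)] ih] .
  moreover have "h (?i x) = x" if "x \<in> carrier N" for x using bij that by (simp add: bij_betw_inv_into_right)
  ultimately have "quadr_equiv N g (\<lambda>x y. f (?i x) (?i y))" unfolding quadr_equiv_def by simp
  moreover have "?i ` K = L" "?i ` W = V"
    using bij LV h(3,4) by (auto simp: bij_betw_def inv_into_image_cancel)
  ultimately show ?thesis unfolding qf_iso_mk_formation_iff[OF assms(2,1)] using i by blast
qed

lemma comm_group_DirProd: "comm_group M \<Longrightarrow> comm_group N \<Longrightarrow> comm_group (M \<times>\<times> N)"
  by (rule group.group_comm_groupI)
    (auto simp: comm_group.axioms(2) DirProd_group comm_groupE(4) mult_DirProd')

lemma formation_data_sum:
  assumes "formation_data M f L V" "formation_data N g K W"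
  shows "formation_data (M \<times>\<times> N) (\<lambda>x y. f (fst x) (fst y) + g (snd x) (snd y)) (L \<times> K) (V \<times> W)"
proof -
  have h: "fst \<in> hom (M \<times>\<times> N) M" "snd \<in> hom (M \<times>\<times> N) N" by (auto simp: hom_def DirProd_def)
  show ?thesis using assms unfolding formation_data_def
    by (auto intro!: comm_group_DirProd biadditive_add biadditive_comp[OF _ h(1)] biadditive_comp[OF _ h(2)])
qed

lemma qf_sum_mk_formation:
  assumes "formation_data M f L V" "formation_data N g K W"
  shows "qf_sum (mk_formation M f L V) (mk_formation N g K W) =
    mk_formation (M \<times>\<times> N) (\<lambda>x y. f (fst x) (fst y) + g (snd x) (snd y)) (L \<times> K) (V \<times> W)"
proof -
  have MN: "comm_group M" "comm_group N" "biadditive M f" "biadditive N g" using assms unfolding formation_data_def by auto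
  show ?thesis unfolding qf_sum_def mk_formation_def
    using Q_sum_Q_class[OF MN(1,2) comm_group_DirProd[OF MN(1,2)] ext_form_in_Forms[OF MN(1,3)] ext_form_in_Forms[OF MN(2,4)]]
    by (auto intro!: arg_cong[where f = "Q_class (M \<times>\<times> N)"] ext_form_cong)
qed

lemma qf_iso_sum_mk_formation:
  assumes "formation_data M f L V" "formation_data N g K W" "formation_data M' f' L' V'" "formation_data N' g' K' W'"
    "qf_iso (mk_formation M f L V) (mk_formation M' f' L' V')" "qf_iso (mk_formation N g K W) (mk_formation N' g' K' W')"
  shows "qf_iso (qf_sum (mk_formation M f L V) (mk_formation N g K W)) (qf_sum (mk_formation M' f' L' V') (mk_formation N' g' K' W'))"
proof -
  obtain h where h: "h \<in> iso M M'" "quadr_equiv M f (\<lambda>x y. f' (h x) (h y))" "h ` L = L'" "h ` V = V'"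
    using assms(5) unfolding qf_iso_mk_formation_iff[OF assms(1,3)] by auto
  obtain k where k: "k \<in> iso N N'" "quadr_equiv N g (\<lambda>x y. g' (k x) (k y))" "k ` K = K'" "k ` W = W'"
    using assms(6) unfolding qf_iso_mk_formation_iff[OF assms(2,4)] by auto
  let ?P = "M \<times>\<times> N"
  have p: "fst \<in> hom ?P M" "snd \<in> hom ?P N" by (auto simp: hom_def DirProd_def)
  obtain \<chi> \<chi>' where \<chi>: "biadditive ?P \<chi>" "biadditive ?P \<chi>'"
    "\<forall>x\<in>carrier ?P. \<forall>y\<in>carrier ?P. f' (h (fst x)) (h (fst y)) = f (fst x) (fst y) + \<chi> x y + \<chi> y x"
    "\<forall>x\<in>carrier ?P. \<forall>y\<in>carrier ?P. g' (k (snd x)) (k (snd y)) = g (snd x) (snd y) + \<chi>' x y + \<chi>' y x"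
    using quadr_equiv_comp[OF h(2) p(1)] quadr_equiv_comp[OF k(2) p(2)] unfolding quadr_equiv_def by blast
  show ?thesis unfolding qf_sum_mk_formation[OF assms(1,2)] qf_sum_mk_formation[OF assms(3,4)]
  proof (rule qf_iso_mk_formation_I[OF formation_data_sum[OF assms(1,2)] formation_data_sum[OF assms(3,4)]])
    show "(\<lambda>(x, y). (h x, k y)) \<in> iso (M \<times>\<times> N) (M' \<times>\<times> N')"
      using group.DirProd_iso_set_trans[OF comm_group.axioms(2) h(1) k(1)] assms(1) unfolding formation_data_def by blast
    show "biadditive ?P (\<lambda>x y. \<chi> x y + \<chi>' x y)" using \<chi>(1,2) by (rule biadditive_add)
    show "f' (fst ((\<lambda>(x, y). (h x, k y)) x)) (fst ((\<lambda>(x, y). (h x, k y)) y))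
        + g' (snd ((\<lambda>(x, y). (h x, k y)) x)) (snd ((\<lambda>(x, y). (h x, k y)) y))
      = f (fst x) (fst y) + g (snd x) (snd y) + (\<chi> x y + \<chi>' x y) + (\<chi> y x + \<chi>' y x)"
      if "x \<in> carrier ?P" "y \<in> carrier ?P" for x y
      using bspec[OF bspec[OF \<chi>(3) that(1)] that(2)] bspec[OF bspec[OF \<chi>(4) that(1)] that(2)]
      by (simp add: split_beta)
  qed (use h k in \<open>auto simp: image_paired_Times\<close>)
qed

section \<open>Quasi-formations in terms of biadditive forms\<close>

lemma comm_group_subgroup:
  assumes "comm_group M" "subgroup L M"
  shows "comm_group (M\<lparr>carrier := L\<rparr>)"
proof -
  have "group (M\<lparr>carrier := L\<rparr>)"
    using group.subgroup_imp_group[OF comm_group.axioms(2)[OF assms(1)] assms(2)] .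
  then show ?thesis
    using subgroup.subset[OF assms(2)] comm_groupE(4)[OF assms(1)]
    by (intro group.group_comm_groupI) auto
qed

text \<open>Nonsingularity of \<open>f - f\<^sup>*\<close>, stated with arbitrary homomorphisms in place of extensional ones.\<close>

definition perfect_form :: "('a, 'b) monoid_scheme \<Rightarrow> ('a \<Rightarrow> 'a \<Rightarrow> int) \<Rightarrow> bool" where
  "perfect_form M f \<longleftrightarrow> (\<forall>g\<in>hom M integer_group. \<exists>!x. x \<in> carrier M \<and> (\<forall>y\<in>carrier M. f x y - f y x = g y))"

lemma bij_betw_iff_Ex1:
  assumes "f \<in> A \<rightarrow> B"
  shows "bij_betw f A B \<longleftrightarrow> (\<forall>b\<in>B. \<exists>!a. a \<in> A \<and> f a = b)"
proof
  assume "bij_betw f A B"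
  then show "\<forall>b\<in>B. \<exists>!a. a \<in> A \<and> f a = b" unfolding bij_betw_def inj_on_def by blast
next
  assume *: "\<forall>b\<in>B. \<exists>!a. a \<in> A \<and> f a = b"
  have "inj_on f A" using * assms unfolding inj_on_def by (metis PiE)
  moreover have "f ` A = B" using * assms by auto
  ultimately show "bij_betw f A B" unfolding bij_betw_def by simp
qed

lemma nonsingular_iff:
  assumes M: "comm_group M" and f: "biadditive M f"
  shows "nonsingular M (Q_class M (ext_form M f)) \<longleftrightarrow> perfect_form M f"
proof -
  define l where "l = ext_form M (\<lambda>x y. ext_form M f x y - ext_form M f y x)"
  have b: "biadditive M (ext_form M f)" using biadditive_ext_form[OF M] f by blast
  have l: "l \<in> carrier (Forms M)" unfolding l_def
    using ext_form_in_Forms[OF M biadditive_diff[OF b biadditive_swap[OF b]]] .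
  then have lh: "l \<in> hom M (dual M)" unfolding Forms_def Hom_group_def by simp
  have eq: "l x = g \<longleftrightarrow> (\<forall>y\<in>carrier M. f x y - f y x = g y)"
    if x: "x \<in> carrier M" and g: "g \<in> carrier (dual M)" for x g
  proof -
    have e: "l x \<in> extensional (carrier M)" using lh x unfolding hom_def carrier_dual by auto
    have ge: "g \<in> extensional (carrier M)" using g unfolding carrier_dual by simp
    have "l x y = f x y - f y x" if "y \<in> carrier M" for y using x that unfolding l_def by simp
    then have "(\<forall>y\<in>carrier M. f x y - f y x = g y) \<longleftrightarrow> (\<forall>y\<in>carrier M. l x y = g y)" by simp
    then show ?thesis using extensionalityI[OF e ge] by metis
  qed
  have "nonsingular M (Q_class M (ext_form M f)) \<longleftrightarrow> bij_betw l (carrier M) (carrier (dual M))"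
    unfolding nonsingular_def skew_sym_Q_class[OF M ext_form_in_Forms[OF M f]] l_def[symmetric] iso_def
    using lh by simp
  also have "\<dots> \<longleftrightarrow> (\<forall>g\<in>carrier (dual M). \<exists>!x. x \<in> carrier M \<and> l x = g)"
    using lh by (intro bij_betw_iff_Ex1) (simp add: hom_def)
  also have "\<dots> \<longleftrightarrow> (\<forall>g\<in>carrier (dual M). \<exists>!x. x \<in> carrier M \<and> (\<forall>y\<in>carrier M. f x y - f y x = g y))"
    using eq by (intro ball_cong arg_cong[where f = Ex1] ext refl) auto
  also have "\<dots> \<longleftrightarrow> perfect_form M f"
  proof
    assume *: "\<forall>g\<in>carrier (dual M). \<exists>!x. x \<in> carrier M \<and> (\<forall>y\<in>carrier M. f x y - f y x = g y)"
    show "perfect_form M f" unfolding perfect_form_def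
    proof
      fix g assume "g \<in> hom M integer_group"
      then have "restrict g (carrier M) \<in> carrier (dual M)"
        unfolding carrier_dual hom_def by (auto simp: comm_group_closed[OF M])
      with * have "\<exists>!x. x \<in> carrier M \<and> (\<forall>y\<in>carrier M. f x y - f y x = restrict g (carrier M) y)" by blast
      then show "\<exists>!x. x \<in> carrier M \<and> (\<forall>y\<in>carrier M. f x y - f y x = g y)" by simp
    qed
  next
    assume "perfect_form M f"
    then show "\<forall>g\<in>carrier (dual M). \<exists>!x. x \<in> carrier M \<and> (\<forall>y\<in>carrier M. f x y - f y x = g y)"
      unfolding perfect_form_def carrier_dual hom_def by auto
  qed
  finally show ?thesis .
qed

lemma Lagrangian_iff:
  assumes M: "comm_group M" and f: "biadditive M f"
  shows "Lagrangian M (Q_class M (ext_form M f)) L \<longleftrightarrow> direct_summand M L \<and>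
    L = {x \<in> carrier M. \<forall>y\<in>L. f x y = f y x} \<and> quadr_equiv (M\<lparr>carrier := L\<rparr>) (\<lambda>x y. 0) f"
proof (cases "direct_summand M L")
  case True
  let ?L = "M\<lparr>carrier := L\<rparr>"
  have sub: "subgroup L M" using True unfolding direct_summand_def by simp
  have LM: "L \<subseteq> carrier M" using subgroup.subset[OF sub] .
  have cL: "comm_group ?L" by (rule comm_group_subgroup[OF M sub])
  have i: "(\<lambda>x. x) \<in> hom ?L M" using LM unfolding hom_def by auto
  have bL: "biadditive ?L (ext_form M f)"
    using biadditive_comp[OF _ i, of "ext_form M f"] f biadditive_ext_form[OF M] by simp
  have F: "ext_form M f \<in> carrier (Forms M)" by (rule ext_form_in_Forms[OF M f])
  have "perp M (Q_class M (ext_form M f)) L = {x \<in> carrier M. \<forall>y\<in>L. f x y = f y x}"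
  proof -
    have "ext_form M (\<lambda>x y. ext_form M f x y - ext_form M f y x) x y = 0 \<longleftrightarrow> f x y = f y x"
      if "x \<in> carrier M" "y \<in> L" for x y using that LM by (simp add: subset_iff)
    then show ?thesis unfolding perp_def skew_sym_Q_class[OF M F] by blast
  qed
  moreover have "Q_pullback ?L (\<lambda>x. x) (Q_class M (ext_form M f)) = \<one>\<^bsub>Q_minus ?L\<^esub> \<longleftrightarrow> quadr_equiv ?L (\<lambda>x y. 0) f"
  proof -
    have "Q_pullback ?L (\<lambda>x. x) (Q_class M (ext_form M f)) = Q_class ?L (ext_form ?L (ext_form M f))"
      using Q_pullback_Q_class[OF cL M i F] by simp
    moreover have "Q_class ?L (ext_form ?L (\<lambda>x y. 0)) = Q_class ?L (ext_form ?L (ext_form M f))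
      \<longleftrightarrow> quadr_equiv ?L (ext_form ?L (\<lambda>x y. 0)) (ext_form ?L (ext_form M f))"
      by (rule Q_class_eq_iff[OF cL ext_form_in_Forms[OF cL biadditive_zero] ext_form_in_Forms[OF cL bL]])
    moreover have "\<dots> \<longleftrightarrow> quadr_equiv ?L (\<lambda>x y. 0) f"
      using LM by (intro quadr_equiv_cong) (auto simp: subset_iff)
    ultimately show ?thesis unfolding one_Q_minus[OF cL] by auto
  qed
  ultimately show ?thesis unfolding Lagrangian_def using True by simp
qed (simp add: Lagrangian_def)

lemma is_quasi_formation_mk_formation_iff:
  assumes M: "comm_group M" and f: "biadditive M f"
  shows "is_quasi_formation (mk_formation M f L V) \<longleftrightarrow> perfect_form M f \<and> direct_summand M L \<and>
    L = {x \<in> carrier M. \<forall>y\<in>L. f x y = f y x} \<and> quadr_equiv (M\<lparr>carrier := L\<rparr>) (\<lambda>x y. 0) f \<and>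
    half_rank_summand M V"
  unfolding is_quasi_formation_def mk_formation_def using ext_form_in_Forms[OF M f]
  by (auto simp: nonsingular_iff[OF M f] Lagrangian_iff[OF M f] skew_quadratic_form_def carrier_Q_minus
      half_rank_summand_def fg_free_def)

lemma is_quasi_formation_cases:
  assumes "is_quasi_formation X"
  obtains M f L V where "X = mk_formation M f L V" "formation_data M f L V"
proof -
  have "comm_group (qf_module X)" "qf_form X \<in> carrier (Q_minus (qf_module X))"
    using assms unfolding is_quasi_formation_def skew_quadratic_form_def fg_free_def free_of_rank_def by auto
  moreover have "qf_lag X \<subseteq> carrier (qf_module X)" "qf_half X \<subseteq> carrier (qf_module X)"
    using assms unfolding is_quasi_formation_def Lagrangian_def half_rank_summand_def direct_summand_def
    by (auto dest: subgroup.subset)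
  ultimately show thesis using quasi_formation_cases that by metis
qed

lemma direct_summand_preimage:
  assumes G: "group G" and M: "group M" and h: "h \<in> iso G M" and S: "direct_summand M S"
  shows "direct_summand G {x \<in> carrier G. h x \<in> S}"
proof -
  interpret gh: group_hom G M h
    using G M h unfolding group_hom_def group_hom_axioms_def iso_def by auto
  have bij: "bij_betw h (carrier G) (carrier M)" using h unfolding iso_def by simp
  obtain N where S: "subgroup S M" and N: "subgroup N M" "S \<inter> N = {\<one>\<^bsub>M\<^esub>}" "S <#>\<^bsub>M\<^esub> N = carrier M"
    using S unfolding direct_summand_def by auto
  have pre: "subgroup {x \<in> carrier G. h x \<in> T} G" if "subgroup T M" for T
    by (rule subgroup.intro) (use that in \<open>auto simp: subgroup.m_closed subgroup.m_inv_closed subgroup.one_closed\<close>)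
  show ?thesis unfolding direct_summand_def
  proof (intro conjI exI[of _ "{x \<in> carrier G. h x \<in> N}"] pre S N(1))
    have "x = \<one>\<^bsub>G\<^esub>" if "x \<in> carrier G" "h x \<in> S" "h x \<in> N" for x
      using that N(2) bij gh.hom_one monoid.one_closed[OF group.axioms(1)[OF G]] unfolding bij_betw_def inj_on_def by (metis IntI singletonD)
    then show "{x \<in> carrier G. h x \<in> S} \<inter> {x \<in> carrier G. h x \<in> N} = {\<one>\<^bsub>G\<^esub>}"
      using subgroup.one_closed[OF S] subgroup.one_closed[OF N(1)] by auto
    show "{x \<in> carrier G. h x \<in> S} <#>\<^bsub>G\<^esub> {x \<in> carrier G. h x \<in> N} = carrier G"
    proof
      show "carrier G \<subseteq> {x \<in> carrier G. h x \<in> S} <#>\<^bsub>G\<^esub> {x \<in> carrier G. h x \<in> N}"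
      proof
        fix x assume x: "x \<in> carrier G"
        then have "h x \<in> S <#>\<^bsub>M\<^esub> N" using N(3) by simp
        then obtain a b where ab: "a \<in> S" "b \<in> N" "h x = a \<otimes>\<^bsub>M\<^esub> b" unfolding set_mult_def by auto
        then have "a \<in> carrier M" "b \<in> carrier M" using subgroup.subset[OF S] subgroup.subset[OF N(1)] by auto
        then obtain u v where uv: "u \<in> carrier G" "h u = a" "v \<in> carrier G" "h v = b"
          using bij unfolding bij_betw_def by (metis imageE)
        then have "h (u \<otimes>\<^bsub>G\<^esub> v) = h x" using ab by simp
        then have "u \<otimes>\<^bsub>G\<^esub> v = x" using bij x uv unfolding bij_betw_def inj_on_def by simp
        then show "x \<in> {x \<in> carrier G. h x \<in> S} <#>\<^bsub>G\<^esub> {x \<in> carrier G. h x \<in> N}"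
          using uv ab unfolding set_mult_def by auto
      qed
    qed (auto simp: set_mult_def)
  qed
qed

lemma free_of_rank_iso:
  assumes "free_of_rank M k" "comm_group G" "G \<cong> M"
  shows "free_of_rank G k"
  using assms unfolding free_of_rank_def
  by (meson comm_group.axioms(2) group.iso_sym iso_trans)

lemma half_rank_summand_preimage:
  assumes G: "comm_group G" and M: "comm_group M" and h: "h \<in> iso G M" and S: "half_rank_summand M S"
  shows "half_rank_summand G {x \<in> carrier G. h x \<in> S}"
proof -
  let ?S = "{x \<in> carrier G. h x \<in> S}"
  obtain k where k: "free_of_rank M (2 * k)" "free_of_rank (M\<lparr>carrier := S\<rparr>) k" and dS: "direct_summand M S"
    using S unfolding half_rank_summand_def by auto
  have d: "direct_summand G ?S"
    by (rule direct_summand_preimage[OF comm_group.axioms(2)[OF G] comm_group.axioms(2)[OF M] h dS])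
  have SM: "S \<subseteq> carrier M" using dS unfolding direct_summand_def by (auto dest: subgroup.subset)
  have "h \<in> iso (G\<lparr>carrier := ?S\<rparr>) (M\<lparr>carrier := S\<rparr>)"
    using h SM unfolding iso_def hom_def bij_betw_def inj_on_def by (auto simp: image_iff)
  then have "free_of_rank (G\<lparr>carrier := ?S\<rparr>) k"
    using d by (intro free_of_rank_iso[OF k(2)] comm_group_subgroup[OF G]) (auto simp: direct_summand_def is_iso_def)
  moreover have "free_of_rank G (2 * k)"
    using h by (intro free_of_rank_iso[OF k(1) G]) (auto simp: is_iso_def)
  ultimately show ?thesis unfolding half_rank_summand_def using d by auto
qed

text \<open>Used in both directions: to replace a given module by a group of integer vectors, and to move
a quasi-formation of vectors into the type that carries the classes of the monoid.\<close>

lemma quasi_formation_transport: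
  assumes G: "comm_group G" and D: "formation_data M f L V" and X: "is_quasi_formation (mk_formation M f L V)" and h: "h \<in> iso G M"
  defines "g \<equiv> \<lambda>x y. f (h x) (h y)" and "K \<equiv> {x \<in> carrier G. h x \<in> L}" and "W \<equiv> {x \<in> carrier G. h x \<in> V}"
  shows "formation_data G g K W" "is_quasi_formation (mk_formation G g K W)" "qf_iso (mk_formation G g K W) (mk_formation M f L V)"
proof -
  have M: "comm_group M" and f: "biadditive M f" and LV: "L \<subseteq> carrier M" "V \<subseteq> carrier M"
    using D unfolding formation_data_def by auto
  have hh: "h \<in> hom G M" and bij: "bij_betw h (carrier G) (carrier M)" using h unfolding iso_def by auto
  have hc: "h x \<in> carrier M" if "x \<in> carrier G" for x using hh that unfolding hom_def by auto
  have sur: "\<exists>u\<in>carrier G. h u = x" if "x \<in> carrier M" for x using bij that unfolding bij_betw_def by (metis imageE)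
  have inj: "u = v" if "u \<in> carrier G" "v \<in> carrier G" "h u = h v" for u v
    using bij that unfolding bij_betw_def inj_on_def by auto
  show DG: "formation_data G g K W" unfolding formation_data_def g_def K_def W_def
    using G biadditive_comp[OF f hh] by auto
  have im: "h ` {x \<in> carrier G. h x \<in> T} = T" if "T \<subseteq> carrier M" for T using that sur by (auto simp: image_iff)
  show "qf_iso (mk_formation G g K W) (mk_formation M f L V)"
    by (rule qf_iso_mk_formation_I[OF DG D h biadditive_zero]) (auto simp: g_def K_def W_def im LV)
  have P: "perfect_form M f" "direct_summand M L" "L = {x \<in> carrier M. \<forall>y\<in>L. f x y = f y x}"
    "quadr_equiv (M\<lparr>carrier := L\<rparr>) (\<lambda>x y. 0) f" "half_rank_summand M V"
    using X unfolding is_quasi_formation_mk_formation_iff[OF M f] by auto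
  have "perfect_form G g" unfolding perfect_form_def
  proof
    fix a assume a: "a \<in> hom G integer_group"
    let ?i = "inv_into (carrier G) h"
    have i: "?i \<in> hom M G" using group.iso_set_sym[OF comm_group.axioms(2)[OF G] h] unfolding iso_def by simp
    have ih: "?i (h x) = x" if "x \<in> carrier G" for x using bij that by (simp add: bij_betw_inv_into_left)
    have ai: "a \<circ> ?i \<in> hom M integer_group" by (rule hom_compose[OF i a])
    have "\<exists>!x. x \<in> carrier M \<and> (\<forall>y\<in>carrier M. f x y - f y x = a (?i y))"
      using bspec[OF P(1)[unfolded perfect_form_def] ai] by (simp add: o_def)
    then obtain x where x: "x \<in> carrier M" "\<forall>y\<in>carrier M. f x y - f y x = a (?i y)"
      and u: "\<And>x'. x' \<in> carrier M \<Longrightarrow> \<forall>y\<in>carrier M. f x' y - f y x' = a (?i y) \<Longrightarrow> x' = x" by blast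
    obtain z where z: "z \<in> carrier G" "h z = x" using sur[OF x(1)] by auto
    show "\<exists>!x. x \<in> carrier G \<and> (\<forall>y\<in>carrier G. g x y - g y x = a y)"
    proof (intro ex1I[of _ z] conjI ballI)
      fix y assume "y \<in> carrier G"
      then show "g z y - g y z = a y" using x(2) hc[of y] ih[of y] z unfolding g_def by auto
    next
      fix z' assume z': "z' \<in> carrier G \<and> (\<forall>y\<in>carrier G. g z' y - g y z' = a y)"
      have "\<forall>y\<in>carrier M. f (h z') y - f y (h z') = a (?i y)"
      proof
        fix y assume "y \<in> carrier M"
        then obtain v where "v \<in> carrier G" "h v = y" using sur by blast
        then show "f (h z') y - f y (h z') = a (?i y)" using z' ih[of v] unfolding g_def by auto
      qed
      then show "z' = z" using u[OF hc] z z' inj by blast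
    qed (rule z)
  qed
  moreover have "direct_summand G K" unfolding K_def
    by (rule direct_summand_preimage[OF comm_group.axioms(2)[OF G] comm_group.axioms(2)[OF M] h P(2)])
  moreover have "K = {x \<in> carrier G. \<forall>y\<in>K. g x y = g y x}"
  proof -
    have "h x \<in> L \<longleftrightarrow> (\<forall>y\<in>K. g x y = g y x)" if "x \<in> carrier G" for x
    proof -
      have "(\<forall>y\<in>K. g x y = g y x) \<longleftrightarrow> (\<forall>y\<in>h ` K. f (h x) y = f y (h x))" unfolding g_def by auto
      also have "\<dots> \<longleftrightarrow> h x \<in> L" unfolding K_def im[OF LV(1)] using P(3) hc[OF that] by blast
      finally show ?thesis by simp
    qed
    then show ?thesis unfolding K_def by auto
  qed
  moreover have "quadr_equiv (G\<lparr>carrier := K\<rparr>) (\<lambda>x y. 0) g"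
    unfolding g_def by (rule quadr_equiv_comp[OF P(4)]) (use hh in \<open>auto simp: hom_def K_def\<close>)
  moreover have "half_rank_summand G W" unfolding W_def by (rule half_rank_summand_preimage[OF G M h P(5)])
  ultimately show "is_quasi_formation (mk_formation G g K W)"
    using DG unfolding formation_data_def by (subst is_quasi_formation_mk_formation_iff) auto
qed

section \<open>Free abelian groups of integer vectors\<close>

text \<open>The group \<open>\<int>\<^sup>n\<close>.\<close>

definition Zv :: "nat \<Rightarrow> int vec monoid" where
  "Zv n = \<lparr>carrier = carrier_vec n, monoid.mult = (+), one = 0\<^sub>v n\<rparr>"

lemma carrier_Zv [simp]: "carrier (Zv n) = carrier_vec n"
  and mult_Zv [simp]: "x \<otimes>\<^bsub>Zv n\<^esub> y = x + y"
  and one_Zv [simp]: "\<one>\<^bsub>Zv n\<^esub> = 0\<^sub>v n"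
  unfolding Zv_def by auto

lemma comm_group_Zv [simp]: "comm_group (Zv n)"
proof (rule comm_groupI)
  fix x assume "x \<in> carrier (Zv n)"
  then show "\<exists>y\<in>carrier (Zv n). y \<otimes>\<^bsub>Zv n\<^esub> x = \<one>\<^bsub>Zv n\<^esub>"
    by (intro bexI[of _ "- x"]) auto
qed (auto simp: assoc_add_vec comm_add_vec)

lemma group_Zv [simp]: "group (Zv n)"
  using comm_group.axioms(2)[OF comm_group_Zv] .

lemma inv_Zv: "x \<in> carrier_vec n \<Longrightarrow> inv\<^bsub>Zv n\<^esub> x = - x"
  by (rule group.inv_equality) auto

lemma hom_int_int_multiple:
  assumes g: "g \<in> hom (Zv n) integer_group" and v: "v \<in> carrier_vec n"
  shows "g (c \<cdot>\<^sub>v v) = c * g v"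
proof -
  have add: "g (x + y) = g x + g y" if "x \<in> carrier_vec n" "y \<in> carrier_vec n" for x y
    using g that unfolding hom_def by auto
  have z: "g (0\<^sub>v n) = 0" using add[of "0\<^sub>v n" "0\<^sub>v n"] by simp
  have s: "(c + 1) \<cdot>\<^sub>v v = c \<cdot>\<^sub>v v + v" for c using v by (intro eq_vecI) (auto simp: algebra_simps)
  have a: "g ((c + 1) \<cdot>\<^sub>v v) = g (c \<cdot>\<^sub>v v) + g v" for c unfolding s using v by (intro add) auto
  have v0: "0 \<cdot>\<^sub>v v = 0\<^sub>v n" using v by (intro eq_vecI) auto
  show ?thesis
  proof (induction c rule: int_induct[where k = 0])
    case base
    then show ?case using z v0 by simp
  next
    case (step1 i)
    then show ?case using a[of i] by (simp add: algebra_simps)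
  next
    case (step2 i)
    then show ?case using a[of "i - 1"] by (simp add: algebra_simps)
  qed
qed

lemma hom_int_scalar_prod:
  assumes g: "g \<in> hom (Zv n) integer_group" and x: "x \<in> carrier_vec n"
  shows "g x = vec n (\<lambda>i. g (unit_vec n i)) \<bullet> x"
proof -
  have add: "g (x + y) = g x + g y" if "x \<in> carrier_vec n" "y \<in> carrier_vec n" for x y
    using g that unfolding hom_def by auto
  have z: "g (0\<^sub>v n) = 0" using add[of "0\<^sub>v n" "0\<^sub>v n"] by simp
  let ?t = "\<lambda>k. vec n (\<lambda>i. if i < k then x $ i else 0)"
  have "g (?t k) = (\<Sum>i<k. g (unit_vec n i) * x $ i)" if "k \<le> n" for k
    using that
  proof (induction k)
    case 0
    have "?t 0 = 0\<^sub>v n" by (intro eq_vecI) auto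
    then show ?case using z by simp
  next
    case (Suc k)
    have "?t (Suc k) = ?t k + x $ k \<cdot>\<^sub>v unit_vec n k" using Suc.prems
      by (intro eq_vecI) (auto simp: unit_vec_def less_Suc_eq)
    then have "g (?t (Suc k)) = g (?t k) + x $ k * g (unit_vec n k)"
      by (simp add: add hom_int_int_multiple[OF g])
    then show ?case using Suc by (simp add: algebra_simps)
  qed
  from this[of n] have "g (?t n) = (\<Sum>i<n. g (unit_vec n i) * x $ i)" by simp
  moreover have "?t n = x" using x by (intro eq_vecI) auto
  ultimately show ?thesis using x by (simp add: scalar_prod_def lessThan_atLeast0)
qed

lemma hom_int_mat:
  assumes h: "h \<in> hom (Zv n) (Zv m)"
  shows "\<exists>A\<in>carrier_mat m n. \<forall>x\<in>carrier_vec n. h x = A *\<^sub>v x"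
proof -
  let ?A = "mat m n (\<lambda>(i, j). h (unit_vec n j) $ i)"
  have hc: "h x \<in> carrier_vec m" if "x \<in> carrier_vec n" for x using h that unfolding hom_def by auto
  have "h x = ?A *\<^sub>v x" if x: "x \<in> carrier_vec n" for x
  proof (rule eq_vecI)
    fix i assume i: "i < dim_vec (?A *\<^sub>v x)"
    then have im: "i < m" by simp
    have "(\<lambda>x. h x $ i) \<in> hom (Zv n) integer_group"
      using h im unfolding hom_def by (auto simp: carrier_vecD[OF hc])
    then have "h x $ i = vec n (\<lambda>j. h (unit_vec n j) $ i) \<bullet> x" by (rule hom_int_scalar_prod[OF _ x])
    also have "vec n (\<lambda>j. h (unit_vec n j) $ i) = row ?A i" using im by (intro eq_vecI) auto
    also have "row ?A i \<bullet> x = (?A *\<^sub>v x) $ i" using im by (simp only: index_mult_mat_vec dim_row_mat)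
    finally show "h x $ i = (?A *\<^sub>v x) $ i" .
  qed (use hc[OF x] in auto)
  moreover have "?A \<in> carrier_mat m n" by simp
  ultimately show ?thesis by blast
qed

lemma int_vec_eqI:
  fixes v w :: "int vec"
  assumes "v \<in> carrier_vec n" "w \<in> carrier_vec n" "\<And>u. u \<in> carrier_vec n \<Longrightarrow> v \<bullet> u = w \<bullet> u"
  shows "v = w"
proof (rule eq_vecI)
  fix i assume "i < dim_vec w"
  then show "v $ i = w $ i" using assms(1,2) assms(3)[of "unit_vec n i"] by simp
qed (use assms in auto)

lemma free_of_rank_Zv: "free_of_rank (Zv n) n"
proof -
  let ?F = "free_Abelian_group {..<n}"
  let ?h = "\<lambda>p. vec n (\<lambda>i. Poly_Mapping.lookup p i)"
  have "?h \<in> hom ?F (Zv n)" unfolding hom_def by (auto simp: lookup_add intro!: eq_vecI)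
  moreover have "bij_betw ?h (carrier ?F) (carrier_vec n)"
  proof (rule bij_betw_imageI)
    show "inj_on ?h (carrier ?F)"
    proof (rule inj_onI)
      fix p q assume pq: "p \<in> carrier ?F" "q \<in> carrier ?F" "?h p = ?h q"
      have "Poly_Mapping.lookup p i = Poly_Mapping.lookup q i" for i
      proof (cases "i < n")
        case True then show ?thesis using arg_cong[OF pq(3), of "\<lambda>v. v $ i"] by simp
      next
        case False
        then have "i \<notin> Poly_Mapping.keys p" "i \<notin> Poly_Mapping.keys q" using pq(1,2) by auto
        then show ?thesis by (simp add: in_keys_iff)
      qed
      then show "p = q" by (intro poly_mapping_eqI)
    qed
    show "?h ` carrier ?F = carrier_vec n"
    proof
      show "carrier_vec n \<subseteq> ?h ` carrier ?F"
      proof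
        fix v :: "int vec" assume v: "v \<in> carrier_vec n"
        let ?c = "\<lambda>i. if i < n then v $ i else 0"
        have fin: "finite {i. ?c i \<noteq> 0}" by (rule finite_subset[of _ "{..<n}"]) (auto split: if_splits)
        let ?p = "Poly_Mapping.Abs_poly_mapping ?c"
        have l: "Poly_Mapping.lookup ?p = ?c" using fin by (rule lookup_Abs_poly_mapping)
        have "Poly_Mapping.keys ?p \<subseteq> {..<n}" unfolding subset_iff in_keys_iff l by (auto split: if_splits)
        moreover have "v = ?h ?p" unfolding l using v by (intro eq_vecI) auto
        ultimately show "v \<in> ?h ` carrier ?F" by (intro image_eqI[of _ _ ?p]) auto
      qed
    qed auto
  qed
  ultimately have "?F \<cong> Zv n" unfolding is_iso_def iso_def by auto
  then show ?thesis unfolding free_of_rank_def by simp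
qed

lemma free_of_rank_iff: "free_of_rank G n \<longleftrightarrow> comm_group G \<and> Zv n \<cong> G"
  using free_of_rank_Zv[of n] unfolding free_of_rank_def
  by (meson comm_group.axioms(2) abelian_free_Abelian_group group.iso_sym iso_trans)

text \<open>Mutually inverse integer matrices \<open>P\<close> and \<open>Q\<close> satisfy \<open>tr (P Q) = tr (Q P)\<close>, and these traces are
the two ranks.\<close>

lemma Zv_iso_dim_eq:
  assumes "Zv a \<cong> Zv b" shows "a = b"
proof -
  obtain h where h: "h \<in> iso (Zv a) (Zv b)" using assms unfolding is_iso_def by auto
  let ?i = "inv_into (carrier (Zv a)) h"
  have i: "?i \<in> iso (Zv b) (Zv a)" using group.iso_set_sym[OF group_Zv h] .
  have bij: "bij_betw h (carrier_vec a) (carrier_vec b)" using h unfolding iso_def by simp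
  obtain P where P: "P \<in> carrier_mat b a" "\<And>x. x \<in> carrier_vec a \<Longrightarrow> h x = P *\<^sub>v x"
    using hom_int_mat[of h a b] h unfolding iso_def by auto
  obtain Q where Q: "Q \<in> carrier_mat a b" "\<And>x. x \<in> carrier_vec b \<Longrightarrow> ?i x = Q *\<^sub>v x"
    using hom_int_mat[of ?i b a] i unfolding iso_def by auto
  have unit: "(X *\<^sub>v unit_vec k j) $ i = X $$ (i, j)" if "X \<in> carrier_mat k k" "i < k" "j < k" for X :: "int mat" and i j k
    using that by simp
  have "Q * P = 1\<^sub>m a"
  proof (rule eq_matI)
    fix i j assume "i < dim_row (1\<^sub>m a :: int mat)" "j < dim_col (1\<^sub>m a :: int mat)"
    then have ij: "i < a" "j < a" by auto
    have "Q *\<^sub>v (P *\<^sub>v unit_vec a j) = unit_vec a j"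
      using P Q bij_betw_inv_into_left[OF bij, of "unit_vec a j"]
      by (metis carrier_Zv mult_mat_vec_carrier unit_vec_carrier)
    then have "(Q * P *\<^sub>v unit_vec a j) $ i = unit_vec a j $ i" using P(1) Q(1) by simp
    then show "(Q * P) $$ (i, j) = 1\<^sub>m a $$ (i, j)"
      using unit[OF mult_carrier_mat[OF Q(1) P(1)] ij] ij by simp
  qed (use P Q in auto)
  moreover have "P * Q = 1\<^sub>m b"
  proof (rule eq_matI)
    fix i j assume "i < dim_row (1\<^sub>m b :: int mat)" "j < dim_col (1\<^sub>m b :: int mat)"
    then have ij: "i < b" "j < b" by auto
    have "P *\<^sub>v (Q *\<^sub>v unit_vec b j) = unit_vec b j"
      using P Q bij_betw_inv_into_right[OF bij, of "unit_vec b j"]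
      by (metis carrier_Zv mult_mat_vec_carrier unit_vec_carrier)
    then have "(P * Q *\<^sub>v unit_vec b j) $ i = unit_vec b j $ i" using P(1) Q(1) by simp
    then show "(P * Q) $$ (i, j) = 1\<^sub>m b $$ (i, j)"
      using unit[OF mult_carrier_mat[OF P(1) Q(1)] ij] ij by simp
  qed (use P Q in auto)
  moreover have "(\<Sum>i<a. (Q * P) $$ (i, i)) = (\<Sum>j<b. (P * Q) $$ (j, j))"
  proof -
    have "(\<Sum>i<a. (Q * P) $$ (i, i)) = (\<Sum>i<a. \<Sum>j<b. Q $$ (i, j) * P $$ (j, i))"
      using P(1) Q(1) by (intro sum.cong) (auto simp: scalar_prod_def lessThan_atLeast0)
    also have "\<dots> = (\<Sum>j<b. \<Sum>i<a. P $$ (j, i) * Q $$ (i, j))" by (subst sum.swap) (simp add: mult.commute)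
    also have "\<dots> = (\<Sum>j<b. (P * Q) $$ (j, j))"
      using P(1) Q(1) by (intro sum.cong) (auto simp: scalar_prod_def lessThan_atLeast0)
    finally show ?thesis .
  qed
  ultimately have "(\<Sum>i<a. (1 :: int)) = (\<Sum>j<b. 1)" by simp
  then show ?thesis by simp
qed

lemma subgroup_Zv_smult:
  assumes H: "subgroup H (Zv n)" and v: "v \<in> H"
  shows "c \<cdot>\<^sub>v v \<in> H"
proof -
  have vc: "v \<in> carrier_vec n" using subgroup.subset[OF H] v by auto
  have add: "x + y \<in> H" if "x \<in> H" "y \<in> H" for x y using subgroup.m_closed[OF H that] by simp
  have neg: "- v \<in> H" using subgroup.m_inv_closed[OF H v] inv_Zv[OF vc] by simp
  show ?thesis
  proof (induction c rule: int_induct[where k = 0])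
    case base
    have "0 \<cdot>\<^sub>v v = 0\<^sub>v n" using vc by (intro eq_vecI) auto
    then show ?case using subgroup.one_closed[OF H] by simp
  next
    case (step1 i)
    have "(i + 1) \<cdot>\<^sub>v v = i \<cdot>\<^sub>v v + v" using vc by (intro eq_vecI) (auto simp: algebra_simps)
    then show ?case using add[OF step1(2) v] by simp
  next
    case (step2 i)
    have "(i - 1) \<cdot>\<^sub>v v = i \<cdot>\<^sub>v v + (- v)" using vc by (intro eq_vecI) (auto simp: algebra_simps)
    then show ?case using add[OF step2(2) neg] by simp
  qed
qed

lemma int_ideal_principal:
  assumes z: "0 \<in> I" and diff: "\<And>a b :: int. a \<in> I \<Longrightarrow> b \<in> I \<Longrightarrow> a - b \<in> I"
    and mult: "\<And>a c. a \<in> I \<Longrightarrow> c * a \<in> I"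
  obtains d where "d \<in> I" "\<And>a. a \<in> I \<Longrightarrow> d dvd a"
proof (cases "I = {0}")
  case True
  then show thesis by (intro that[of 0]) auto
next
  case False
  then obtain a where a: "a \<in> I" "a \<noteq> 0" using z by auto
  define P where "P k \<longleftrightarrow> 0 < k \<and> int k \<in> I" for k
  have "P (nat \<bar>a\<bar>)" unfolding P_def using a mult[OF a(1), of "-1"] by (auto simp: abs_if)
  then have L: "P (LEAST k. P k)" and least: "\<And>k. P k \<Longrightarrow> (LEAST k. P k) \<le> k"
    by (auto intro: LeastI Least_le)
  let ?d = "int (LEAST k. P k)"
  have d: "?d \<in> I" "0 < ?d" using L unfolding P_def by auto
  show thesis
  proof (rule that[OF d(1)])
    fix b assume b: "b \<in> I"
    have "b mod ?d \<in> I" using diff[OF b mult[OF d(1), of "b div ?d"]] by (simp add: minus_div_mult_eq_mod)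
    moreover have "0 \<le> b mod ?d" "b mod ?d < ?d" using d(2) by auto
    ultimately have "b mod ?d = 0" using least[of "nat (b mod ?d)"] unfolding P_def by fastforce
    then show "?d dvd b" by (simp add: dvd_eq_mod_eq_0)
  qed
qed

lemma vec_add_right_cancel:
  fixes x y w :: "int vec"
  assumes "x + w = y + w" "x \<in> carrier_vec n" "y \<in> carrier_vec n" "w \<in> carrier_vec n"
  shows "x = y"
proof (rule eq_vecI)
  fix i assume "i < dim_vec y"
  then show "x $ i = y $ i" using assms(2-) arg_cong[OF assms(1), of "\<lambda>v. v $ i"] by simp
qed (use assms in auto)

text \<open>By induction on the rank: the last coordinates of the elements of \<open>H\<close> form an ideal \<open>d\<int>\<close>. Either
\<open>d = 0\<close>, or \<open>H\<close> is the direct sum of its part with last coordinate zero and the multiples of one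
element whose last coordinate is \<open>d\<close>.\<close>

lemma subgroup_Zv_free:
  assumes "subgroup H (Zv n)"
  shows "\<exists>r h. h \<in> hom (Zv r) (Zv n) \<and> inj_on h (carrier_vec r) \<and> h ` carrier_vec r = H"
  using assms
proof (induction n arbitrary: H)
  case 0
  have "v = 0\<^sub>v 0" if "v \<in> carrier_vec 0" for v :: "int vec" using that by (intro eq_vecI) auto
  then have "H = {0\<^sub>v 0}" using subgroup.subset[OF 0] subgroup.one_closed[OF 0] by (auto simp del: vec_of_dim_0)
  then show ?case by (intro exI[of _ 0] exI[of _ "\<lambda>x. x"]) (auto simp: hom_def)
next
  case (Suc n)
  note H = Suc.prems
  have HC: "H \<subseteq> carrier_vec (Suc n)" using subgroup.subset[OF H] by simp
  have add: "x + y \<in> H" if "x \<in> H" "y \<in> H" for x y using subgroup.m_closed[OF H that] by simp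
  have sm: "c \<cdot>\<^sub>v x \<in> H" if "x \<in> H" for c x by (rule subgroup_Zv_smult[OF H that])
  let ?e = "\<lambda>v. v @\<^sub>v (0\<^sub>v (Suc 0) :: int vec)"
  have eadd: "?e (x + y) = ?e x + ?e y" if "x \<in> carrier_vec n" "y \<in> carrier_vec n" for x y
    using that by (intro eq_vecI) auto
  have elast: "?e x $ n = 0" if "x \<in> carrier_vec n" for x using that by auto
  let ?H0 = "{v \<in> carrier_vec n. ?e v \<in> H}"
  have "subgroup ?H0 (Zv n)"
  proof (rule subgroup.intro)
    have "?e (0\<^sub>v n) = 0\<^sub>v (Suc n)" by (intro eq_vecI) auto
    then show "\<one>\<^bsub>Zv n\<^esub> \<in> ?H0" using subgroup.one_closed[OF H] by simp
    fix x assume x: "x \<in> ?H0"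
    have "?e (- x) = -1 \<cdot>\<^sub>v ?e x" using x by (intro eq_vecI) auto
    then show "inv\<^bsub>Zv n\<^esub> x \<in> ?H0" using x sm by (auto simp: inv_Zv)
  qed (auto simp: eadd add)
  from Suc.IH[OF this] obtain r h where
    h: "h \<in> hom (Zv r) (Zv n)" "inj_on h (carrier_vec r)" "h ` carrier_vec r = ?H0" by (elim exE conjE)
  have hadd: "h (x + y) = h x + h y" if "x \<in> carrier_vec r" "y \<in> carrier_vec r" for x y
    using h(1) that unfolding hom_def by auto
  have hc: "h x \<in> carrier_vec n" "?e (h x) \<in> H" if "x \<in> carrier_vec r" for x using h(3) that by auto
  obtain d where d: "d \<in> (\<lambda>x. x $ n) ` H" "\<And>a. a \<in> (\<lambda>x. x $ n) ` H \<Longrightarrow> d dvd a"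
  proof (rule int_ideal_principal[of "(\<lambda>x. x $ n) ` H"])
    show "0 \<in> (\<lambda>x. x $ n) ` H" using subgroup.one_closed[OF H] by (intro image_eqI[of _ _ "0\<^sub>v (Suc n)"]) auto
    fix a b assume "a \<in> (\<lambda>x. x $ n) ` H" "b \<in> (\<lambda>x. x $ n) ` H"
    then obtain x y where xy: "x \<in> H" "a = x $ n" "y \<in> H" "b = y $ n" by auto
    then have "x + -1 \<cdot>\<^sub>v y \<in> H" using add sm by auto
    moreover have "(x + -1 \<cdot>\<^sub>v y) $ n = a - b" using xy HC by auto
    ultimately show "a - b \<in> (\<lambda>x. x $ n) ` H" by (metis imageI)
  next
    fix a c assume "a \<in> (\<lambda>x. x $ n) ` H"
    then obtain x where x: "x \<in> H" "a = x $ n" by auto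
    then have "(c \<cdot>\<^sub>v x) $ n = c * a" using HC by auto
    then show "c * a \<in> (\<lambda>x. x $ n) ` H" using sm[OF x(1)] by (metis imageI)
  qed (rule that)
  have split0: "\<exists>u\<in>carrier_vec r. x = ?e (h u)" if "x \<in> H" "x $ n = 0" for x
  proof -
    have xc: "x \<in> carrier_vec (Suc n)" using that HC by auto
    have xe: "?e (vec_first x n) = x" using that(2) xc by (intro eq_vecI) (auto simp: vec_first_def less_Suc_eq)
    then have "vec_first x n \<in> ?H0" using that(1) by auto
    then have "vec_first x n \<in> h ` carrier_vec r" unfolding h(3) .
    then obtain u where u: "vec_first x n = h u" "u \<in> carrier_vec r" by (elim imageE)
    show ?thesis by (rule bexI[OF _ u(2)]) (use xe u(1) in simp)
  qed
  show ?case
  proof (cases "d = 0")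
    case True
    then have "x $ n = 0" if "x \<in> H" for x using d(2) that by auto
    then have "(\<lambda>u. ?e (h u)) ` carrier_vec r = H" using split0 hc by (auto simp: image_iff)
    moreover have "(\<lambda>u. ?e (h u)) \<in> hom (Zv r) (Zv (Suc n))"
      using hc hadd HC by (auto simp: hom_def eadd)
    moreover have "inj_on (\<lambda>u. ?e (h u)) (carrier_vec r)"
    proof (rule inj_onI)
      fix x y assume xy: "x \<in> carrier_vec r" "y \<in> carrier_vec r" "?e (h x) = ?e (h y)"
      then have "h x = h y" using append_vec_eq[OF hc(1) hc(1)] by blast
      then show "x = y" using h(2) xy(1,2) by (auto dest: inj_onD)
    qed
    ultimately show ?thesis by blast
  next
    case False
    obtain v where v: "v \<in> H" "v $ n = d" using d(1) by auto
    have vc: "v \<in> carrier_vec (Suc n)" using v HC by auto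
    define k where "k u = ?e (h (vec_first u r)) + u $ r \<cdot>\<^sub>v v" for u
    have f: "vec_first u r \<in> carrier_vec r" for u :: "int vec" by simp
    have fadd: "vec_first (x + y) r = vec_first x r + vec_first y r" if "x \<in> carrier_vec (Suc r)" "y \<in> carrier_vec (Suc r)" for x y :: "int vec"
      using that by (intro eq_vecI) (auto simp: vec_first_def)
    have kH: "k u \<in> H" for u unfolding k_def using add[OF hc(2)[OF f] sm[OF v(1)]] .
    have kn: "k u $ n = u $ r * d" for u
      unfolding k_def using hc(1)[OF f, of u] vc v by auto
    have "k \<in> hom (Zv (Suc r)) (Zv (Suc n))"
    proof -
      have "k (x + y) = k x + k y" if "x \<in> carrier_vec (Suc r)" "y \<in> carrier_vec (Suc r)" for x y
        unfolding k_def fadd[OF that] hadd[OF f f] eadd[OF hc(1)[OF f] hc(1)[OF f]]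
        using hc(1)[OF f, of x] hc(1)[OF f, of y] vc that by (intro eq_vecI) (auto simp: algebra_simps)
      then show ?thesis using kH HC by (auto simp: hom_def)
    qed
    moreover have "inj_on k (carrier_vec (Suc r))"
    proof (rule inj_onI)
      fix x y assume xy: "x \<in> carrier_vec (Suc r)" "y \<in> carrier_vec (Suc r)" "k x = k y"
      then have r: "x $ r = y $ r" using kn[of x] kn[of y] False by simp
      have "?e (h (vec_first x r)) + x $ r \<cdot>\<^sub>v v = ?e (h (vec_first y r)) + x $ r \<cdot>\<^sub>v v"
        using xy(3) r unfolding k_def by simp
      moreover have "?e (h (vec_first u r)) \<in> carrier_vec (Suc n)" for u using hc(2)[OF f] HC by auto
      ultimately have "?e (h (vec_first x r)) = ?e (h (vec_first y r))"
        using vc vec_add_right_cancel by (metis smult_carrier_vec)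
      then have "h (vec_first x r) = h (vec_first y r)" using append_vec_eq[OF hc(1)[OF f] hc(1)[OF f]] by simp
      then have e: "vec_first x r = vec_first y r" by (rule inj_onD[OF h(2) _ f f])
      show "x = y"
      proof (rule eq_vecI)
        fix i assume "i < dim_vec y"
        then have "i < r \<or> i = r" using xy by auto
        then show "x $ i = y $ i" using r arg_cong[OF e, of "\<lambda>v. v $ i"] by (auto simp: vec_first_def)
      qed (use xy in auto)
    qed
    moreover have "k ` carrier_vec (Suc r) = H"
    proof
      show "H \<subseteq> k ` carrier_vec (Suc r)"
      proof
        fix x assume x: "x \<in> H"
        then obtain q where q: "x $ n = d * q" using d(2)[of "x $ n"] by (auto elim: dvdE)
        have xc: "x \<in> carrier_vec (Suc n)" using x HC by auto
        have "x + (- q) \<cdot>\<^sub>v v \<in> H" by (rule add[OF x sm[OF v(1)]])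
        moreover have "(x + (- q) \<cdot>\<^sub>v v) $ n = 0" using xc vc v q by auto
        ultimately obtain u where u: "u \<in> carrier_vec r" "x + (- q) \<cdot>\<^sub>v v = ?e (h u)" using split0 by blast
        let ?u = "u @\<^sub>v vec 1 (\<lambda>_. q)"
        have "vec_first ?u r = u" using u by (intro eq_vecI) (auto simp: vec_first_def)
        moreover have "?u $ r = q" using u by auto
        ultimately have "k ?u = (x + (- q) \<cdot>\<^sub>v v) + q \<cdot>\<^sub>v v" unfolding k_def u(2) by simp
        also have "\<dots> = x" using xc vc by (intro eq_vecI) auto
        finally show "x \<in> k ` carrier_vec (Suc r)" using append_carrier_vec[OF u(1), of "vec 1 (\<lambda>_. q)" 1] by (intro image_eqI[of _ _ ?u]) auto
      qed
    qed (use kH in auto)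
    ultimately show ?thesis by blast
  qed
qed

section \<open>Quasi-formations given by matrices\<close>

text \<open>The kernel of the retraction \<open>p\<close> is a complement of the image of \<open>s\<close>.\<close>

lemma split_mono_summand:
  assumes M: "comm_group M" and K: "comm_group K" and s: "s \<in> hom K M" and p: "p \<in> hom M K"
    and ps: "\<And>u. u \<in> carrier K \<Longrightarrow> p (s u) = u"
  shows "direct_summand M (s ` carrier K)" "s \<in> iso K (M\<lparr>carrier := s ` carrier K\<rparr>)"
proof -
  interpret M: comm_group M by (rule M)
  interpret K: comm_group K by (rule K)
  interpret s: group_hom K M s by unfold_locales (rule s)
  interpret p: group_hom M K p by unfold_locales (rule p)
  let ?N = "{x \<in> carrier M. p x = \<one>\<^bsub>K\<^esub>}"
  have S: "subgroup (s ` carrier K) M" by (rule s.img_is_subgroup)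
  have N: "subgroup ?N M" by (rule subgroup.intro) auto
  have "x = \<one>\<^bsub>M\<^esub>" if "x \<in> s ` carrier K" "x \<in> ?N" for x
  proof -
    obtain u where u: "x = s u" "u \<in> carrier K" using \<open>x \<in> s ` carrier K\<close> by (elim imageE)
    then have "u = \<one>\<^bsub>K\<^esub>" using ps[OF u(2)] that(2) by simp
    then show ?thesis using u(1) by simp
  qed
  then have "s ` carrier K \<inter> ?N = {\<one>\<^bsub>M\<^esub>}"
    using subgroup.one_closed[OF S] subgroup.one_closed[OF N] by blast
  moreover have "s ` carrier K <#>\<^bsub>M\<^esub> ?N = carrier M"
  proof
    show "carrier M \<subseteq> s ` carrier K <#>\<^bsub>M\<^esub> ?N"
    proof
      fix x assume x: "x \<in> carrier M"
      let ?a = "s (p x)"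
      have a: "?a \<in> carrier M" using x by simp
      have "inv\<^bsub>M\<^esub> ?a \<otimes>\<^bsub>M\<^esub> x \<in> ?N" using x a ps[of "p x"] by simp
      moreover have "?a \<otimes>\<^bsub>M\<^esub> (inv\<^bsub>M\<^esub> ?a \<otimes>\<^bsub>M\<^esub> x) = x" using x a by (simp add: M.m_assoc[symmetric])
      moreover have "?a \<in> s ` carrier K" using x by simp
      ultimately show "x \<in> s ` carrier K <#>\<^bsub>M\<^esub> ?N" unfolding set_mult_def by force
    qed
  qed (auto simp: set_mult_def)
  ultimately show "direct_summand M (s ` carrier K)" unfolding direct_summand_def using S N by blast
  have "inj_on s (carrier K)" by (rule inj_on_inverseI[of _ p]) (rule ps)
  then show "s \<in> iso K (M\<lparr>carrier := s ` carrier K\<rparr>)"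
    using s by (auto simp: iso_def hom_def bij_betw_def)
qed

lemma summand_retraction:
  assumes M: "comm_group M" and K: "comm_group K" and S: "direct_summand M S"
    and s: "s \<in> hom K M" and inj: "inj_on s (carrier K)" and im: "s ` carrier K = S"
  shows "\<exists>p\<in>hom M K. \<forall>u\<in>carrier K. p (s u) = u"
proof -
  interpret M: comm_group M by (rule M)
  interpret K: comm_group K by (rule K)
  interpret s: group_hom K M s by unfold_locales (rule s)
  obtain N where N: "subgroup N M" "S \<inter> N = {\<one>\<^bsub>M\<^esub>}" "S <#>\<^bsub>M\<^esub> N = carrier M" and SS: "subgroup S M"
    using S unfolding direct_summand_def by auto
  interpret N: subgroup N M by (rule N(1))
  (* The complement N determines the S-component of x, hence its preimage u under s. *)
  define P where "P x u \<longleftrightarrow> u \<in> carrier K \<and> inv\<^bsub>M\<^esub> (s u) \<otimes>\<^bsub>M\<^esub> x \<in> N" for x u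
  have ex: "\<exists>u. P x u" if x: "x \<in> carrier M" for x
  proof -
    have "x \<in> S <#>\<^bsub>M\<^esub> N" using N(3) x by simp
    then obtain a b where ab: "a \<in> S" "b \<in> N" "x = a \<otimes>\<^bsub>M\<^esub> b" unfolding set_mult_def by auto
    then obtain u where u: "u \<in> carrier K" "a = s u" using im by auto
    have "inv\<^bsub>M\<^esub> (s u) \<otimes>\<^bsub>M\<^esub> x = b" unfolding ab(3) u(2) using u(1) N.mem_carrier[OF ab(2)]
      by (simp add: M.m_assoc[symmetric])
    then show ?thesis unfolding P_def using u(1) ab(2) by auto
  qed
  have uniq: "u = v" if "P x u" "P x v" "x \<in> carrier M" for x u v
  proof -
    have u: "u \<in> carrier K" and v: "v \<in> carrier K" using that unfolding P_def by auto
    have su: "s u \<in> carrier M" "s v \<in> carrier M" using u v by auto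
    have "(inv\<^bsub>M\<^esub> (s u) \<otimes>\<^bsub>M\<^esub> x) \<otimes>\<^bsub>M\<^esub> inv\<^bsub>M\<^esub> (inv\<^bsub>M\<^esub> (s v) \<otimes>\<^bsub>M\<^esub> x) \<in> N"
      using that unfolding P_def by auto
    also have "(inv\<^bsub>M\<^esub> (s u) \<otimes>\<^bsub>M\<^esub> x) \<otimes>\<^bsub>M\<^esub> inv\<^bsub>M\<^esub> (inv\<^bsub>M\<^esub> (s v) \<otimes>\<^bsub>M\<^esub> x) = inv\<^bsub>M\<^esub> (s u) \<otimes>\<^bsub>M\<^esub> s v"
      using su that(3) by (simp add: M.inv_mult_group M.m_assoc) (simp add: M.m_assoc[symmetric])
    finally have "inv\<^bsub>M\<^esub> (s u) \<otimes>\<^bsub>M\<^esub> s v \<in> N" .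
    moreover have "inv\<^bsub>M\<^esub> (s u) \<otimes>\<^bsub>M\<^esub> s v \<in> S"
      using subgroup.m_closed[OF SS subgroup.m_inv_closed[OF SS]] im u v by blast
    ultimately have "inv\<^bsub>M\<^esub> (s u) \<otimes>\<^bsub>M\<^esub> s v = \<one>\<^bsub>M\<^esub>" using N(2) by auto
    then have "s u = s v" using su by (metis M.inv_closed M.inv_inv M.inv_equality)
    then show "u = v" by (rule inj_onD[OF inj _ u v])
  qed
  define p where "p x = (SOME u. P x u)" for x
  have p: "P x (p x)" if "x \<in> carrier M" for x unfolding p_def by (rule someI_ex[OF ex[OF that]])
  have "p \<in> hom M K"
  proof (rule homI)
    fix x assume x: "x \<in> carrier M"
    then show "p x \<in> carrier K" using p unfolding P_def by auto
    fix y assume y: "y \<in> carrier M"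
    have pk: "p x \<in> carrier K" "p y \<in> carrier K" using p[OF x] p[OF y] unfolding P_def by auto
    then have sc: "s (p x) \<in> carrier M" "s (p y) \<in> carrier M" by auto
    have "(inv\<^bsub>M\<^esub> (s (p x)) \<otimes>\<^bsub>M\<^esub> x) \<otimes>\<^bsub>M\<^esub> (inv\<^bsub>M\<^esub> (s (p y)) \<otimes>\<^bsub>M\<^esub> y) \<in> N"
      using p[OF x] p[OF y] unfolding P_def by auto
    also have "(inv\<^bsub>M\<^esub> (s (p x)) \<otimes>\<^bsub>M\<^esub> x) \<otimes>\<^bsub>M\<^esub> (inv\<^bsub>M\<^esub> (s (p y)) \<otimes>\<^bsub>M\<^esub> y)
        = inv\<^bsub>M\<^esub> (s (p x \<otimes>\<^bsub>K\<^esub> p y)) \<otimes>\<^bsub>M\<^esub> (x \<otimes>\<^bsub>M\<^esub> y)"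
      using x y pk sc by (simp add: M.inv_mult M.m_ac)
    finally have "P (x \<otimes>\<^bsub>M\<^esub> y) (p x \<otimes>\<^bsub>K\<^esub> p y)" unfolding P_def using pk by simp
    then show "p (x \<otimes>\<^bsub>M\<^esub> y) = p x \<otimes>\<^bsub>K\<^esub> p y" using uniq p x y by (meson M.m_closed)
  qed
  moreover have "p (s u) = u" if u: "u \<in> carrier K" for u
  proof -
    have "P (s u) u" unfolding P_def using u by simp
    then show ?thesis using uniq p u by (meson s.hom_closed)
  qed
  ultimately show ?thesis by blast
qed

text \<open>The group \<open>\<int>\<^sup>n \<oplus> \<int>\<^sup>n\<close>, where the second summand plays the role of the dual of the first one.\<close>

definition Zp :: "nat \<Rightarrow> (int vec \<times> int vec) monoid" where
  "Zp n = Zv n \<times>\<times> Zv n"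

lemma carrier_Zp [simp]: "carrier (Zp n) = carrier_vec n \<times> carrier_vec n"
  and mult_Zp [simp]: "x \<otimes>\<^bsub>Zp n\<^esub> y = (fst x + fst y, snd x + snd y)"
  and one_Zp [simp]: "\<one>\<^bsub>Zp n\<^esub> = (0\<^sub>v n, 0\<^sub>v n)"
  unfolding Zp_def by (auto simp: DirProd_def split_beta)

lemma comm_group_Zp [simp]: "comm_group (Zp n)"
  unfolding Zp_def by (simp add: comm_group_DirProd)

lemma append_iso: "(\<lambda>(u, w). u @\<^sub>v w) \<in> iso (Zv n \<times>\<times> Zv k) (Zv (n + k))"
proof -
  have "inj_on (\<lambda>(u, w). u @\<^sub>v w) (carrier_vec n \<times> carrier_vec k :: (int vec \<times> int vec) set)"
    by (rule inj_onI) (auto simp: append_vec_eq[of _ n])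
  moreover have "(\<lambda>(u, w). u @\<^sub>v w) ` (carrier_vec n \<times> carrier_vec k) = (carrier_vec (n + k) :: int vec set)"
  proof
    show "(carrier_vec (n + k) :: int vec set) \<subseteq> (\<lambda>(u, w). u @\<^sub>v w) ` (carrier_vec n \<times> carrier_vec k)"
    proof
      fix v :: "int vec" assume "v \<in> carrier_vec (n + k)"
      then show "v \<in> (\<lambda>(u, w). u @\<^sub>v w) ` (carrier_vec n \<times> carrier_vec k)"
        by (intro image_eqI[of _ _ "(vec_first v n, vec_last v k)"]) (auto simp: vec_first_last_append)
    qed
  qed auto
  ultimately show ?thesis unfolding iso_def hom_def bij_betw_def
    by (auto simp: append_vec_add[of _ n _ _ k])
qed

lemma free_of_rank_Zp: "free_of_rank (Zp n) (2 * n)"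
proof -
  have "Zp n \<cong> Zv (n + n)" using append_iso[of n n] unfolding Zp_def is_iso_def by auto
  then show ?thesis using free_of_rank_iso[OF free_of_rank_Zv comm_group_Zp] by (simp add: mult_2)
qed

definition hyp_pairing :: "int vec \<times> int vec \<Rightarrow> int vec \<times> int vec \<Rightarrow> int" where
  "hyp_pairing x y = snd x \<bullet> fst y"

text \<open>The quasi-formation on the hyperbolic form of \<open>\<int>\<^sup>n\<close> whose half-rank summand has the columns of \<open>A\<close> on
top of \<open>B\<close> as a basis.\<close>

definition matrix_formation :: "nat \<Rightarrow> int mat \<Rightarrow> int mat \<Rightarrow> (int vec \<times> int vec) quasi_formation" where
  "matrix_formation n A B = mk_formation (Zp n) hyp_pairing (carrier_vec n \<times> {0\<^sub>v n}) ((\<lambda>u. (A *\<^sub>v u, B *\<^sub>v u)) ` carrier_vec n)"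

lemma biadditive_hyp_pairing: "biadditive (Zp n) hyp_pairing"
  unfolding biadditive_def hyp_pairing_def
  by (auto simp: add_scalar_prod_distrib[of _ n] scalar_prod_add_distrib[of _ n])

lemma matrix_formation_data:
  assumes "A \<in> carrier_mat n n" "B \<in> carrier_mat n n"
  shows "formation_data (Zp n) hyp_pairing (carrier_vec n \<times> {0\<^sub>v n}) ((\<lambda>u. (A *\<^sub>v u, B *\<^sub>v u)) ` carrier_vec n)"
  unfolding formation_data_def using assms by (auto simp: biadditive_hyp_pairing)

lemma is_quasi_formation_matrix_formation:
  assumes "primitive_pair n A B"
  shows "is_quasi_formation (matrix_formation n A B)"
proof -
  obtain C D where A: "A \<in> carrier_mat n n" and B: "B \<in> carrier_mat n n"
    and C: "C \<in> carrier_mat n n" and D: "D \<in> carrier_mat n n" and CD: "C * A + D * B = 1\<^sub>m n"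
    using assms unfolding primitive_pair_def by auto
  let ?L = "carrier_vec n \<times> {0\<^sub>v n} :: (int vec \<times> int vec) set"
  have "perfect_form (Zp n) hyp_pairing" unfolding perfect_form_def
  proof
    fix g assume g: "g \<in> hom (Zp n) integer_group"
    then have add: "g (a + c, b + d) = g (a, b) + g (c, d)"
      if "a \<in> carrier_vec n" "b \<in> carrier_vec n" "c \<in> carrier_vec n" "d \<in> carrier_vec n" for a b c d
      using that unfolding hom_def by auto
    have "(\<lambda>u. g (u, 0\<^sub>v n)) \<in> hom (Zv n) integer_group" "(\<lambda>w. g (0\<^sub>v n, w)) \<in> hom (Zv n) integer_group"
      unfolding hom_def by (auto simp: add[symmetric])
    note h = hom_int_scalar_prod[OF this(1)] hom_int_scalar_prod[OF this(2)]
    define c d where "c = vec n (\<lambda>i. g (unit_vec n i, 0\<^sub>v n))" and "d = vec n (\<lambda>i. g (0\<^sub>v n, unit_vec n i))"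
    have cd: "c \<in> carrier_vec n" "d \<in> carrier_vec n" unfolding c_def d_def by auto
    have gv: "g (u, w) = c \<bullet> u + d \<bullet> w" if "u \<in> carrier_vec n" "w \<in> carrier_vec n" for u w
      using add[of u "0\<^sub>v n" "0\<^sub>v n" w] that h(1)[OF that(1)] h(2)[OF that(2)] unfolding c_def d_def by simp
    show "\<exists>!x. x \<in> carrier (Zp n) \<and> (\<forall>y\<in>carrier (Zp n). hyp_pairing x y - hyp_pairing y x = g y)"
    proof (intro ex1I[of _ "(- d, c)"] conjI ballI)
      fix y assume "y \<in> carrier (Zp n)"
      then show "hyp_pairing (- d, c) y - hyp_pairing y (- d, c) = g y"
        using cd gv[of "fst y" "snd y"] comm_scalar_prod[of "snd y" n d]
        by (auto simp: hyp_pairing_def)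
    next
      fix x assume x: "x \<in> carrier (Zp n) \<and> (\<forall>y\<in>carrier (Zp n). hyp_pairing x y - hyp_pairing y x = g y)"
      obtain a b where ab: "x = (a, b)" "a \<in> carrier_vec n" "b \<in> carrier_vec n" using x by auto
      have "b \<bullet> u = c \<bullet> u" if u: "u \<in> carrier_vec n" for u
      proof -
        have "hyp_pairing x (u, 0\<^sub>v n) - hyp_pairing (u, 0\<^sub>v n) x = g (u, 0\<^sub>v n)" using x u by auto
        then show ?thesis using gv[OF u zero_carrier_vec] u cd ab by (simp add: hyp_pairing_def)
      qed
      then have "b = c" by (rule int_vec_eqI[OF ab(3) cd(1)])
      moreover have "a \<bullet> w = (- d) \<bullet> w" if w: "w \<in> carrier_vec n" for w
      proof -
        have "hyp_pairing x (0\<^sub>v n, w) - hyp_pairing (0\<^sub>v n, w) x = g (0\<^sub>v n, w)" using x w by auto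
        then show ?thesis using gv[OF zero_carrier_vec w] w cd ab comm_scalar_prod[of w n a]
          by (simp add: hyp_pairing_def)
      qed
      then have "a = - d" by (intro int_vec_eqI[OF ab(2)]) (use cd in auto)
      ultimately show "x = (- d, c)" using ab by simp
    qed (use cd in auto)
  qed
  moreover have "direct_summand (Zp n) ?L"
  proof -
    have "direct_summand (Zp n) ((\<lambda>u. (u, 0\<^sub>v n)) ` carrier (Zv n))"
      by (rule split_mono_summand(1)[of _ _ _ fst]) (auto simp: hom_def)
    moreover have "(\<lambda>u. (u, 0\<^sub>v n)) ` carrier (Zv n) = ?L" by auto
    ultimately show ?thesis by simp
  qed
  moreover have "?L = {x \<in> carrier (Zp n). \<forall>y\<in>?L. hyp_pairing x y = hyp_pairing y x}"
  proof -
    have "b = 0\<^sub>v n" if "b \<in> carrier_vec n" "\<forall>u\<in>carrier_vec n. b \<bullet> u = 0" for b :: "int vec"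
      using that by (intro int_vec_eqI[of _ n]) auto
    then show ?thesis by (auto simp: hyp_pairing_def)
  qed
  moreover have "quadr_equiv (Zp n\<lparr>carrier := ?L\<rparr>) (\<lambda>x y. 0) hyp_pairing"
    unfolding quadr_equiv_def by (intro exI[of _ "\<lambda>x y. 0"]) (auto simp: biadditive_def hyp_pairing_def)
  moreover have "half_rank_summand (Zp n) ((\<lambda>u. (A *\<^sub>v u, B *\<^sub>v u)) ` carrier_vec n)"
  proof -
    let ?s = "\<lambda>u. (A *\<^sub>v u, B *\<^sub>v u)" and ?p = "\<lambda>x. C *\<^sub>v fst x + D *\<^sub>v snd x"
    have s: "?s \<in> hom (Zv n) (Zp n)" using A B by (auto simp: hom_def mult_add_distrib_mat_vec)
    have p: "?p \<in> hom (Zp n) (Zv n)" using C D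
      by (auto simp: hom_def mult_add_distrib_mat_vec[of _ n n] intro!: eq_vecI)
    have ps: "?p (?s u) = u" if "u \<in> carrier (Zv n)" for u
    proof -
      have "?p (?s u) = (C * A + D * B) *\<^sub>v u" using A B C D that by (simp add: add_mult_distrib_mat_vec[of _ n n])
      then show ?thesis using that by (simp add: CD)
    qed
    note d = split_mono_summand[OF comm_group_Zp comm_group_Zv s p ps]
    have "free_of_rank (Zp n\<lparr>carrier := ?s ` carrier (Zv n)\<rparr>) n"
      unfolding free_of_rank_iff using d comm_group_subgroup[OF comm_group_Zp]
      by (auto simp: is_iso_def direct_summand_def)
    then show ?thesis unfolding half_rank_summand_def using d(1) free_of_rank_Zp[of n] by auto
  qed
  ultimately show ?thesis
    unfolding matrix_formation_def is_quasi_formation_mk_formation_iff[OF comm_group_Zp biadditive_hyp_pairing]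
    by - (intro conjI; assumption)
qed

lemma matrix_formation_sum:
  assumes "A \<in> carrier_mat n n" "B \<in> carrier_mat n n" "A' \<in> carrier_mat k k" "B' \<in> carrier_mat k k"
  shows "qf_iso (qf_sum (matrix_formation n A B) (matrix_formation k A' B')) (matrix_formation (n + k) (block_sum A A') (block_sum B B'))"
  unfolding matrix_formation_def qf_sum_mk_formation[OF matrix_formation_data[OF assms(1,2)] matrix_formation_data[OF assms(3,4)]]
proof (rule qf_iso_mk_formation_I[OF formation_data_sum[OF matrix_formation_data[OF assms(1,2)] matrix_formation_data[OF assms(3,4)]]
      matrix_formation_data[OF block_sum_carrier[OF assms(1,3)] block_sum_carrier[OF assms(2,4)]]])
  let ?h = "\<lambda>x :: (int vec \<times> int vec) \<times> (int vec \<times> int vec). (fst (fst x) @\<^sub>v fst (snd x), snd (fst x) @\<^sub>v snd (snd x))"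
  let ?P = "Zp n \<times>\<times> Zp k"
  have eq: "a @\<^sub>v b = c @\<^sub>v d \<longleftrightarrow> a = c \<and> b = d" if "a \<in> carrier_vec n" "c \<in> carrier_vec n" for a b c d :: "int vec"
    using append_vec_eq[OF that] .
  have inj: "inj_on ?h (carrier ?P)" by (rule inj_onI) (auto simp: eq)
  have sur: "?h ` carrier ?P = carrier (Zp (n + k))"
  proof
    show "carrier (Zp (n + k)) \<subseteq> ?h ` carrier ?P"
    proof
      fix v assume v: "v \<in> carrier (Zp (n + k))"
      then show "v \<in> ?h ` carrier ?P"
        by (intro image_eqI[of _ _ "((vec_first (fst v) n, vec_first (snd v) n), (vec_last (fst v) k, vec_last (snd v) k))"])
          (auto simp: vec_first_last_append)
    qed
  qed auto
  have "?h \<in> hom ?P (Zp (n + k))"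
    by (auto simp: hom_def append_vec_add[of _ n _ _ k])
  then show "?h \<in> iso ?P (Zp (n + k))" unfolding iso_def bij_betw_def using inj sur by simp
  show "biadditive ?P (\<lambda>x y. 0)" by (rule biadditive_zero)
  show "hyp_pairing (?h x) (?h y) = hyp_pairing (fst x) (fst y) + hyp_pairing (snd x) (snd y) + 0 + 0"
    if "x \<in> carrier ?P" "y \<in> carrier ?P" for x y
    using that by (auto simp: hyp_pairing_def scalar_prod_append[of _ n _ k])
  have z: "0\<^sub>v n @\<^sub>v 0\<^sub>v k = (0\<^sub>v (n + k) :: int vec)" by (intro eq_vecI) auto
  have first_last: "\<exists>a\<in>carrier_vec n. \<exists>b\<in>carrier_vec k. v = a @\<^sub>v b" if "v \<in> carrier_vec (n + k)" for v :: "int vec"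
    using that by (metis vec_first_carrier vec_last_carrier vec_first_last_append)
  show "?h ` ((carrier_vec n \<times> {0\<^sub>v n}) \<times> carrier_vec k \<times> {0\<^sub>v k}) = carrier_vec (n + k) \<times> {0\<^sub>v (n + k)}"
  proof (intro equalityI subsetI)
    fix v :: "int vec \<times> int vec" assume "v \<in> carrier_vec (n + k) \<times> {0\<^sub>v (n + k)}"
    then obtain a b where "a \<in> carrier_vec n" "b \<in> carrier_vec k" "v = (a @\<^sub>v b, 0\<^sub>v (n + k))"
      using first_last by (metis SigmaE singletonD)
    then show "v \<in> ?h ` ((carrier_vec n \<times> {0\<^sub>v n}) \<times> carrier_vec k \<times> {0\<^sub>v k})"
      using z by (intro image_eqI[of _ _ "((a, 0\<^sub>v n), (b, 0\<^sub>v k))"]) auto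
  qed (auto simp: z)
  have d: "block_sum X Y *\<^sub>v (u @\<^sub>v w) = X *\<^sub>v u @\<^sub>v Y *\<^sub>v w"
    if "X \<in> carrier_mat n n" "Y \<in> carrier_mat k k" "u \<in> carrier_vec n" "w \<in> carrier_vec k" for X Y u w
    using mult_mat_vec_split[OF that] that(1,2) unfolding block_sum_def by simp
  show "?h ` ((\<lambda>u. (A *\<^sub>v u, B *\<^sub>v u)) ` carrier_vec n \<times> (\<lambda>u. (A' *\<^sub>v u, B' *\<^sub>v u)) ` carrier_vec k) =
    (\<lambda>u. (block_sum A A' *\<^sub>v u, block_sum B B' *\<^sub>v u)) ` carrier_vec (n + k)"
  proof (intro equalityI subsetI)
    fix v assume "v \<in> (\<lambda>u. (block_sum A A' *\<^sub>v u, block_sum B B' *\<^sub>v u)) ` carrier_vec (n + k)"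
    then obtain u where u: "u \<in> carrier_vec (n + k)" "v = (block_sum A A' *\<^sub>v u, block_sum B B' *\<^sub>v u)" by auto
    then obtain a b where ab: "a \<in> carrier_vec n" "b \<in> carrier_vec k" "u = a @\<^sub>v b"
      using first_last by blast
    then have "v = (block_sum A A' *\<^sub>v (a @\<^sub>v b), block_sum B B' *\<^sub>v (a @\<^sub>v b))" using u(2) by simp
    with ab show "v \<in> ?h ` ((\<lambda>u. (A *\<^sub>v u, B *\<^sub>v u)) ` carrier_vec n \<times> (\<lambda>u. (A' *\<^sub>v u, B' *\<^sub>v u)) ` carrier_vec k)"
      by (intro image_eqI[of _ _ "((A *\<^sub>v a, B *\<^sub>v a), (A' *\<^sub>v b, B' *\<^sub>v b))"])
        (auto simp: d assms)
  next
    fix v assume "v \<in> ?h ` ((\<lambda>u. (A *\<^sub>v u, B *\<^sub>v u)) ` carrier_vec n \<times> (\<lambda>u. (A' *\<^sub>v u, B' *\<^sub>v u)) ` carrier_vec k)"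
    then obtain a b where ab: "a \<in> carrier_vec n" "b \<in> carrier_vec k"
      "v = (A *\<^sub>v a @\<^sub>v A' *\<^sub>v b, B *\<^sub>v a @\<^sub>v B' *\<^sub>v b)" by auto
    then show "v \<in> (\<lambda>u. (block_sum A A' *\<^sub>v u, block_sum B B' *\<^sub>v u)) ` carrier_vec (n + k)"
      by (intro image_eqI[of _ _ "a @\<^sub>v b"]) (auto simp: d assms)
  qed
qed

text \<open>The map \<open>(x, y) \<mapsto> (x + (R + R\<^sup>T) y, y)\<close> changes the hyperbolic form by the symmetrisation of
\<open>y\<^sup>T R y'\<close>, which is zero in \<open>Q\<^sub>-\<close>.\<close>

lemma matrix_formation_shear:
  assumes A: "A \<in> carrier_mat n n" and B: "B \<in> carrier_mat n n" and R: "R \<in> carrier_mat n n"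
  shows "qf_iso (matrix_formation n A B) (matrix_formation n (A + (R + transpose_mat R) * B) B)"
proof -
  let ?S = "R + transpose_mat R"
  have S: "?S \<in> carrier_mat n n" using R by simp
  have SB: "?S * B \<in> carrier_mat n n" using S B by (rule mult_carrier_mat)
  have A': "A + ?S * B \<in> carrier_mat n n" using SB by simp
  let ?h = "\<lambda>x. (fst x + ?S *\<^sub>v snd x, snd x)"
  have Sc: "?S *\<^sub>v w \<in> carrier_vec n" if "w \<in> carrier_vec n" for w using S that by (rule mult_mat_vec_carrier)
  have cancel: "u - y + y = u" "u + y - y = u" if "u \<in> carrier_vec n" "y \<in> carrier_vec n" for u y :: "int vec"
    using that by (auto intro!: eq_vecI)
  have iso: "?h \<in> iso (Zp n) (Zp n)"
  proof -
    have "?h \<in> hom (Zp n) (Zp n)"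
    proof (rule homI)
      fix x assume x: "x \<in> carrier (Zp n)"
      then show "?h x \<in> carrier (Zp n)" using Sc[of "snd x"] by auto
      fix y assume y: "y \<in> carrier (Zp n)"
      have four: "(a + b) + (p + q) = (a + p) + (b + q)"
        if "a \<in> carrier_vec n" "b \<in> carrier_vec n" "p \<in> carrier_vec n" "q \<in> carrier_vec n" for a b p q :: "int vec"
        using that by (intro eq_vecI) auto
      have c: "fst x \<in> carrier_vec n" "fst y \<in> carrier_vec n" "snd x \<in> carrier_vec n" "snd y \<in> carrier_vec n"
        using x y by auto
      show "?h (x \<otimes>\<^bsub>Zp n\<^esub> y) = ?h x \<otimes>\<^bsub>Zp n\<^esub> ?h y"
        using four[OF c(1,2) Sc[OF c(3)] Sc[OF c(4)]] mult_add_distrib_mat_vec[OF S c(3,4)] by simp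
    qed
    moreover have "bij_betw ?h (carrier (Zp n)) (carrier (Zp n))"
    proof (rule bij_betw_byWitness[of _ "\<lambda>x. (fst x - ?S *\<^sub>v snd x, snd x)"])
      have c: "fst x \<in> carrier_vec n" "?S *\<^sub>v snd x \<in> carrier_vec n" "snd x \<in> carrier_vec n"
        if "x \<in> carrier (Zp n)" for x using that Sc[of "snd x"] by auto
      show "\<forall>x\<in>carrier (Zp n). (fst (?h x) - ?S *\<^sub>v snd (?h x), snd (?h x)) = x"
        using cancel(2)[OF c(1,2)] by (simp only: fst_conv snd_conv prod.collapse) simp
      show "\<forall>x\<in>carrier (Zp n). ?h (fst x - ?S *\<^sub>v snd x, snd x) = x"
        using cancel(1)[OF c(1,2)] by (simp only: fst_conv snd_conv prod.collapse) simp
      show "?h ` carrier (Zp n) \<subseteq> carrier (Zp n)"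
        using c by (intro image_subsetI) (metis SigmaI add_carrier_vec carrier_Zp)
      show "(\<lambda>x. (fst x - ?S *\<^sub>v snd x, snd x)) ` carrier (Zp n) \<subseteq> carrier (Zp n)"
        using c by (intro image_subsetI) (metis SigmaI minus_carrier_vec carrier_Zp)
    qed
    ultimately show ?thesis unfolding iso_def by simp
  qed
  show ?thesis unfolding matrix_formation_def
  proof (rule qf_iso_mk_formation_I[OF matrix_formation_data[OF A B] matrix_formation_data[OF A' B] iso, where \<chi> = "\<lambda>x y. snd x \<bullet> (R *\<^sub>v snd y)"])
    show "biadditive (Zp n) (\<lambda>x y. snd x \<bullet> (R *\<^sub>v snd y))"
      using R by (auto simp: biadditive_def mult_add_distrib_mat_vec[of _ n n]
          add_scalar_prod_distrib[of _ n] scalar_prod_add_distrib[of _ n])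
    show "hyp_pairing (?h x) (?h y) = hyp_pairing x y + snd x \<bullet> (R *\<^sub>v snd y) + snd y \<bullet> (R *\<^sub>v snd x)"
      if xy: "x \<in> carrier (Zp n)" "y \<in> carrier (Zp n)" for x y
    proof -
      have c: "fst y \<in> carrier_vec n" "snd x \<in> carrier_vec n" "snd y \<in> carrier_vec n"
        "R *\<^sub>v snd y \<in> carrier_vec n" "transpose_mat R *\<^sub>v snd y \<in> carrier_vec n" "R *\<^sub>v snd x \<in> carrier_vec n"
        using xy R by auto
      have "?S *\<^sub>v snd y = R *\<^sub>v snd y + transpose_mat R *\<^sub>v snd y"
        using R c by (intro add_mult_distrib_mat_vec) auto
      moreover have "snd x \<bullet> (transpose_mat R *\<^sub>v snd y) = snd y \<bullet> (R *\<^sub>v snd x)"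
        using transpose_vec_mult_scalar[OF R c(2,3)] comm_scalar_prod[OF c(2,5)] by simp
      ultimately show ?thesis using c
        by (simp add: hyp_pairing_def scalar_prod_add_distrib[of _ n])
    qed
    show "?h ` (carrier_vec n \<times> {0\<^sub>v n}) = carrier_vec n \<times> {0\<^sub>v n}"
    proof -
      have "?S *\<^sub>v 0\<^sub>v n = 0\<^sub>v n" using R by (intro eq_vecI) auto
      then have "?h x = x" if "x \<in> carrier_vec n \<times> {0\<^sub>v n}" for x using that by auto
      then show ?thesis by (simp cong: image_cong)
    qed
    have "?h (A *\<^sub>v u, B *\<^sub>v u) = ((A + ?S * B) *\<^sub>v u, B *\<^sub>v u)" if "u \<in> carrier_vec n" for u
      using that A B S SB by (simp add: add_mult_distrib_mat_vec[OF A SB])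
    then show "?h ` (\<lambda>u. (A *\<^sub>v u, B *\<^sub>v u)) ` carrier_vec n = (\<lambda>u. ((A + ?S * B) *\<^sub>v u, B *\<^sub>v u)) ` carrier_vec n"
      unfolding image_image by (intro image_cong) auto
  qed
qed

text \<open>The coordinates on \<open>K \<oplus> K\<^sup>*\<close> with respect to a basis of \<open>K\<close> and its dual basis.\<close>

lemma dual_iso:
  assumes K: "comm_group K" and \<kappa>: "\<kappa> \<in> iso (Zv n) K"
  defines "\<kappa>' \<equiv> inv_into (carrier_vec n) \<kappa>"
  shows "(\<lambda>x. (\<kappa> (fst x), \<lambda>y\<in>carrier K. snd x \<bullet> \<kappa>' y)) \<in> iso (Zp n) (K \<times>\<times> dual K)"
proof -
  have bij: "bij_betw \<kappa> (carrier_vec n) (carrier K)" and \<kappa>h: "\<kappa> \<in> hom (Zv n) K"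
    using \<kappa> unfolding iso_def by auto
  have "\<kappa>' \<in> iso K (Zv n)" using group.iso_set_sym[OF group_Zv \<kappa>] unfolding \<kappa>'_def by simp
  then have \<kappa>'h: "\<kappa>' \<in> hom K (Zv n)" unfolding iso_def by simp
  have c: "\<kappa>' y \<in> carrier_vec n" if "y \<in> carrier K" for y using \<kappa>'h that unfolding hom_def by auto
  have cc: "\<kappa> u \<in> carrier K" if "u \<in> carrier_vec n" for u using \<kappa>h that unfolding hom_def by auto
  have \<kappa>'\<kappa>: "\<kappa>' (\<kappa> u) = u" if "u \<in> carrier_vec n" for u
    using bij that unfolding \<kappa>'_def by (rule bij_betw_inv_into_left)
  let ?d = "\<lambda>w. \<lambda>y\<in>carrier K. w \<bullet> \<kappa>' y"
  have dc: "?d w \<in> carrier (dual K)" if "w \<in> carrier_vec n" for w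
    using \<kappa>'h that c comm_group_closed[OF K]
    by (auto simp: carrier_dual hom_def scalar_prod_add_distrib[of _ n])
  have dadd: "?d (v + w) = ?d v \<otimes>\<^bsub>dual K\<^esub> ?d w" if "v \<in> carrier_vec n" "w \<in> carrier_vec n" for v w
    unfolding mult_dual using that c by (intro restrict_ext) (auto simp: add_scalar_prod_distrib[of _ n])
  have dinj: "v = w" if "v \<in> carrier_vec n" "w \<in> carrier_vec n" "?d v = ?d w" for v w
  proof (rule int_vec_eqI[OF that(1,2)])
    fix u :: "int vec" assume u: "u \<in> carrier_vec n"
    show "v \<bullet> u = w \<bullet> u" using fun_cong[OF that(3), of "\<kappa> u"] cc[OF u] \<kappa>'\<kappa>[OF u] by simp
  qed
  have dsur: "\<exists>w\<in>carrier_vec n. g = ?d w" if g: "g \<in> carrier (dual K)" for g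
  proof -
    have gh: "g \<in> hom K integer_group" and e: "g \<in> extensional (carrier K)"
      using g unfolding carrier_dual hom_def by auto
    let ?w = "vec n (\<lambda>i. (g \<circ> \<kappa>) (unit_vec n i))"
    have gk: "(g \<circ> \<kappa>) u = ?w \<bullet> u" if "u \<in> carrier_vec n" for u
      by (rule hom_int_scalar_prod[OF hom_compose[OF \<kappa>h gh] that])
    have "g = ?d ?w"
    proof (rule extensionalityI[OF e])
      fix y assume y: "y \<in> carrier K"
      then have "\<kappa> (\<kappa>' y) = y" using bij unfolding \<kappa>'_def by (simp add: bij_betw_inv_into_right)
      then show "g y = ?d ?w y" using gk[OF c[OF y]] y by simp
    qed simp
    then show ?thesis by (intro bexI[of _ ?w]) auto
  qed
  let ?h = "\<lambda>x. (\<kappa> (fst x), ?d (snd x))"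
  have "?h \<in> hom (Zp n) (K \<times>\<times> dual K)"
  proof (rule homI)
    fix x assume x: "x \<in> carrier (Zp n)"
    then show "?h x \<in> carrier (K \<times>\<times> dual K)" using cc[of "fst x"] dc[of "snd x"] by auto
    fix y assume y: "y \<in> carrier (Zp n)"
    have v: "fst x \<in> carrier_vec n" "snd x \<in> carrier_vec n" "fst y \<in> carrier_vec n" "snd y \<in> carrier_vec n"
      using x y by auto
    have "\<kappa> (fst x + fst y) = \<kappa> (fst x) \<otimes>\<^bsub>K\<^esub> \<kappa> (fst y)" using \<kappa>h v unfolding hom_def by auto
    then show "?h (x \<otimes>\<^bsub>Zp n\<^esub> y) = ?h x \<otimes>\<^bsub>K \<times>\<times> dual K\<^esub> ?h y"
      using dadd[OF v(2,4)] by (simp add: mult_DirProd')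
  qed
  moreover have "inj_on ?h (carrier (Zp n))"
  proof (rule inj_onI)
    fix x y assume x: "x \<in> carrier (Zp n)" and y: "y \<in> carrier (Zp n)" and e: "?h x = ?h y"
    have "fst x = fst y" using e x y bij unfolding bij_betw_def by (auto dest: inj_onD)
    moreover have "snd x = snd y" by (rule dinj) (use e x y in auto)
    ultimately show "x = y" by (simp add: prod_eq_iff)
  qed
  moreover have "?h ` carrier (Zp n) = carrier (K \<times>\<times> dual K)"
  proof
    show "carrier (K \<times>\<times> dual K) \<subseteq> ?h ` carrier (Zp n)"
    proof
      fix p assume "p \<in> carrier (K \<times>\<times> dual K)"
      then obtain y g where p: "p = (y, g)" "y \<in> carrier K" "g \<in> carrier (dual K)" by auto
      obtain w where w: "w \<in> carrier_vec n" "g = ?d w" using dsur[OF p(3)] by auto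
      have "\<kappa> (\<kappa>' y) = y" using bij p(2) unfolding \<kappa>'_def by (simp add: bij_betw_inv_into_right)
      then show "p \<in> ?h ` carrier (Zp n)"
        using c[OF p(2)] w p(1) by (intro image_eqI[of _ _ "(\<kappa>' y, w)"]) auto
    qed
    show "?h ` carrier (Zp n) \<subseteq> carrier (K \<times>\<times> dual K)" using cc dc by auto
  qed
  ultimately show ?thesis unfolding iso_def bij_betw_def by simp
qed

text \<open>The group laws are transported along the isomorphism of \<open>dual_iso\<close>.\<close>

lemma comm_group_dual:
  assumes "free_of_rank K n"
  shows "comm_group (K \<times>\<times> dual K)"
proof -
  have K: "comm_group K" using assms unfolding free_of_rank_iff by simp
  obtain \<kappa> where \<kappa>: "\<kappa> \<in> iso (Zv n) K" using assms unfolding free_of_rank_iff is_iso_def by auto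
  have triv: "G\<lparr>one := \<one>\<^bsub>G\<^esub>\<rparr> = G" for G :: "('c, 'd) monoid_scheme" by simp
  show ?thesis
  proof -
    let ?h = "\<lambda>x. (\<kappa> (fst x), \<lambda>y\<in>carrier K. snd x \<bullet> inv_into (carrier_vec n) \<kappa> y)"
    have h: "?h \<in> iso (Zp n) (K \<times>\<times> dual K)" by (rule dual_iso[OF K \<kappa>])
    have c: "inv_into (carrier_vec n) \<kappa> y \<in> carrier_vec n" if "y \<in> carrier K" for y
      using \<kappa> that unfolding iso_def by (auto simp: bij_betw_def inv_into_into)
    have "(\<lambda>y\<in>carrier K. 0\<^sub>v n \<bullet> inv_into (carrier_vec n) \<kappa> y) = (\<lambda>y\<in>carrier K. 0)"
      using c by (intro restrict_ext) auto
    moreover have "\<kappa> (0\<^sub>v n) = \<one>\<^bsub>K\<^esub>"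
      using hom_one[of \<kappa> "Zv n" K] \<kappa> comm_group.axioms(2)[OF K] unfolding iso_def by simp
    ultimately have "?h \<one>\<^bsub>Zp n\<^esub> = \<one>\<^bsub>K \<times>\<times> dual K\<^esub>" by (simp add: one_dual)
    with comm_group.iso_imp_img_comm_group[OF comm_group_Zp h] show ?thesis by (simp only: triv)
  qed
qed

lemma hyp_formation_data:
  assumes "free_of_rank K n" "L \<subseteq> carrier (K \<times>\<times> dual K)" "V \<subseteq> carrier (K \<times>\<times> dual K)"
  shows "formation_data (K \<times>\<times> dual K) (\<lambda>x y. snd x (fst y)) L V"
  unfolding formation_data_def using assms comm_group_dual[OF assms(1)]
  by (auto simp: biadditive_def carrier_dual mult_dual)

lemma matrix_formation_iso_hyp:
  assumes f: "free_of_rank K n" and \<kappa>: "\<kappa> \<in> iso (Zv n) K"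
    and A: "A \<in> carrier_mat n n" and B: "B \<in> carrier_mat n n"
    and V: "(\<lambda>u. (\<kappa> (A *\<^sub>v u), \<lambda>y\<in>carrier K. (B *\<^sub>v u) \<bullet> inv_into (carrier_vec n) \<kappa> y)) ` carrier_vec n = V"
  shows "qf_iso (matrix_formation n A B) \<lparr>qf_module = hyp_module K, qf_form = hyp_form K,
      qf_lag = carrier K \<times> {\<one>\<^bsub>dual K\<^esub>}, qf_half = V\<rparr>"
    and "formation_data (K \<times>\<times> dual K) (\<lambda>x y. snd x (fst y)) (carrier K \<times> {\<one>\<^bsub>dual K\<^esub>}) V"
proof -
  have K: "comm_group K" using f unfolding free_of_rank_iff by simp
  let ?\<kappa>' = "inv_into (carrier_vec n) \<kappa>"
  let ?h = "\<lambda>x. (\<kappa> (fst x), \<lambda>y\<in>carrier K. snd x \<bullet> ?\<kappa>' y)"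
  have h: "?h \<in> iso (Zp n) (K \<times>\<times> dual K)" by (rule dual_iso[OF K \<kappa>])
  have bij: "bij_betw \<kappa> (carrier_vec n) (carrier K)" using \<kappa> unfolding iso_def by simp
  have c: "?\<kappa>' y \<in> carrier_vec n" if "y \<in> carrier K" for y
    using bij that by (auto simp: bij_betw_def inv_into_into)
  have hc: "?h x \<in> carrier (K \<times>\<times> dual K)" if "x \<in> carrier (Zp n)" for x
    using h that unfolding iso_def hom_def by blast
  have z: "(\<lambda>y\<in>carrier K. 0\<^sub>v n \<bullet> ?\<kappa>' y) = \<one>\<^bsub>dual K\<^esub>"
    unfolding one_dual using c by (intro restrict_ext) auto
  have V': "?h ` (\<lambda>u. (A *\<^sub>v u, B *\<^sub>v u)) ` carrier_vec n = V" using V by (simp add: image_image)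
  have L': "?h ` (carrier_vec n \<times> {0\<^sub>v n}) = carrier K \<times> {\<one>\<^bsub>dual K\<^esub>}"
  proof -
    have "?h ` (carrier_vec n \<times> {0\<^sub>v n}) = (\<lambda>k. (k, \<one>\<^bsub>dual K\<^esub>)) ` \<kappa> ` carrier_vec n"
      using z by (auto simp: image_iff)
    also have "\<kappa> ` carrier_vec n = carrier K" using bij unfolding bij_betw_def by simp
    also have "(\<lambda>k. (k, \<one>\<^bsub>dual K\<^esub>)) ` carrier K = carrier K \<times> {\<one>\<^bsub>dual K\<^esub>}" by auto
    finally show ?thesis .
  qed
  have VL: "V \<subseteq> carrier (K \<times>\<times> dual K)" "carrier K \<times> {\<one>\<^bsub>dual K\<^esub>} \<subseteq> carrier (K \<times>\<times> dual K)"
  proof -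
    have s: "?h ` S \<subseteq> carrier (K \<times>\<times> dual K)" if "S \<subseteq> carrier (Zp n)" for S using hc that by blast
    show "V \<subseteq> carrier (K \<times>\<times> dual K)" unfolding V'[symmetric] by (rule s) (use A B in auto)
    show "carrier K \<times> {\<one>\<^bsub>dual K\<^esub>} \<subseteq> carrier (K \<times>\<times> dual K)" unfolding L'[symmetric] by (rule s) auto
  qed
  show D: "formation_data (K \<times>\<times> dual K) (\<lambda>x y. snd x (fst y)) (carrier K \<times> {\<one>\<^bsub>dual K\<^esub>}) V"
    by (rule hyp_formation_data[OF f VL(2,1)])
  have eq: "\<lparr>qf_module = hyp_module K, qf_form = hyp_form K, qf_lag = carrier K \<times> {\<one>\<^bsub>dual K\<^esub>}, qf_half = V\<rparr>
    = mk_formation (K \<times>\<times> dual K) (\<lambda>x y. snd x (fst y)) (carrier K \<times> {\<one>\<^bsub>dual K\<^esub>}) V"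
    unfolding mk_formation_def hyp_module_def hyp_form_def ext_form_def ..
  show "qf_iso (matrix_formation n A B) \<lparr>qf_module = hyp_module K, qf_form = hyp_form K,
      qf_lag = carrier K \<times> {\<one>\<^bsub>dual K\<^esub>}, qf_half = V\<rparr>"
    unfolding eq matrix_formation_def
  proof (rule qf_iso_mk_formation_I[OF matrix_formation_data[OF A B] D h biadditive_zero])
    show "snd (?h x) (fst (?h y)) = hyp_pairing x y + 0 + 0" if "x \<in> carrier (Zp n)" "y \<in> carrier (Zp n)" for x y
      using that bij by (auto simp: hyp_pairing_def bij_betw_inv_into_left bij_betw_apply)
  qed (rule L', rule V')
qed

lemma matrix_formation_iso_trivial_formation:
  assumes "free_of_rank K n"
  shows "qf_iso (matrix_formation n (0\<^sub>m n n) (1\<^sub>m n)) (trivial_formation K)"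
    and "formation_data (K \<times>\<times> dual K) (\<lambda>x y. snd x (fst y)) (carrier K \<times> {\<one>\<^bsub>dual K\<^esub>}) ({\<one>\<^bsub>K\<^esub>} \<times> carrier (dual K))"
proof -
  obtain \<kappa> where \<kappa>: "\<kappa> \<in> iso (Zv n) K" using assms unfolding free_of_rank_iff is_iso_def by auto
  have K: "comm_group K" using assms unfolding free_of_rank_iff by simp
  let ?h = "\<lambda>x. (\<kappa> (fst x), \<lambda>y\<in>carrier K. snd x \<bullet> inv_into (carrier_vec n) \<kappa> y)"
  have h: "?h \<in> iso (Zp n) (K \<times>\<times> dual K)" by (rule dual_iso[OF K \<kappa>])
  have k0: "\<kappa> (0\<^sub>v n) = \<one>\<^bsub>K\<^esub>"
    using hom_one[of \<kappa> "Zv n" K] \<kappa> comm_group.axioms(2)[OF K] unfolding iso_def by simp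
  have inj: "inj_on \<kappa> (carrier_vec n)" using \<kappa> unfolding iso_def bij_betw_def by simp
  have V: "(\<lambda>u. (\<kappa> (0\<^sub>m n n *\<^sub>v u), \<lambda>y\<in>carrier K. (1\<^sub>m n *\<^sub>v u) \<bullet> inv_into (carrier_vec n) \<kappa> y)) ` carrier_vec n
      = {\<one>\<^bsub>K\<^esub>} \<times> carrier (dual K)" (is "?f ` _ = _")
  proof -
    have f: "?f u = ?h (0\<^sub>v n, u)" if "u \<in> carrier_vec n" for u
    proof -
      have "0\<^sub>m n n *\<^sub>v u = 0\<^sub>v n" using that by (intro eq_vecI) auto
      then show ?thesis using that by simp
    qed
    have im: "?h ` carrier (Zp n) = carrier (K \<times>\<times> dual K)" using h unfolding iso_def bij_betw_def by simp
    show ?thesis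
    proof (intro equalityI subsetI)
      fix p assume "p \<in> ?f ` carrier_vec n"
      then obtain u where u: "u \<in> carrier_vec n" "p = ?h (0\<^sub>v n, u)" using f by auto
      then have "p \<in> ?h ` carrier (Zp n)" by (intro image_eqI[of _ _ "(0\<^sub>v n, u)"]) auto
      then have "p \<in> carrier (K \<times>\<times> dual K)" unfolding im .
      then show "p \<in> {\<one>\<^bsub>K\<^esub>} \<times> carrier (dual K)" using u k0 by auto
    next
      fix p assume p: "p \<in> {\<one>\<^bsub>K\<^esub>} \<times> carrier (dual K)"
      then have "p \<in> carrier (K \<times>\<times> dual K)" using K by (auto simp: comm_groupE(2))
      then have "p \<in> ?h ` carrier (Zp n)" unfolding im .
      then obtain x where x: "p = ?h x" "x \<in> carrier (Zp n)" by (elim imageE)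
      then have "\<kappa> (fst x) = \<kappa> (0\<^sub>v n)" using p k0 by auto
      then have "fst x = 0\<^sub>v n" using inj x(2) by (auto dest: inj_onD)
      then have "p = ?f (snd x)" using f[of "snd x"] x by (metis carrier_Zp mem_Times_iff prod.collapse)
      then show "p \<in> ?f ` carrier_vec n" using x(2) by auto
    qed
  qed
  show "qf_iso (matrix_formation n (0\<^sub>m n n) (1\<^sub>m n)) (trivial_formation K)"
    using matrix_formation_iso_hyp(1)[OF assms \<kappa> _ _ V] unfolding trivial_formation_def by simp
  show "formation_data (K \<times>\<times> dual K) (\<lambda>x y. snd x (fst y)) (carrier K \<times> {\<one>\<^bsub>dual K\<^esub>}) ({\<one>\<^bsub>K\<^esub>} \<times> carrier (dual K))"
    using matrix_formation_iso_hyp(2)[OF assms \<kappa> _ _ V] by simp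
qed

text \<open>For unimodular \<open>A\<close> the half-rank summand is the graph of \<open>B A\<^sup>-\<^sup>1\<close>. The inverse of \<open>A\<close> is the adjugate
times \<open>det A\<close>, since \<open>det A = \<plusminus>1\<close>.\<close>

lemma matrix_formation_iso_boundary:
  assumes f: "free_of_rank K n" and A: "A \<in> carrier_mat n n" and B: "B \<in> carrier_mat n n" and d: "\<bar>det A\<bar> = 1"
  shows "\<exists>\<rho>\<in>carrier (Forms K). qf_iso (matrix_formation n A B) (boundary K \<rho>) \<and>
    formation_data (K \<times>\<times> dual K) (\<lambda>x y. snd x (fst y)) (carrier K \<times> {\<one>\<^bsub>dual K\<^esub>}) ((\<lambda>x. (x, \<rho> x)) ` carrier K)"
proof -
  obtain \<kappa> where \<kappa>: "\<kappa> \<in> iso (Zv n) K" using f unfolding free_of_rank_iff is_iso_def by auto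
  have K: "comm_group K" using f unfolding free_of_rank_iff by simp
  let ?\<kappa>' = "inv_into (carrier_vec n) \<kappa>"
  have bij: "bij_betw \<kappa> (carrier_vec n) (carrier K)" using \<kappa> unfolding iso_def by simp
  have "?\<kappa>' \<in> iso K (Zv n)" using group.iso_set_sym[OF group_Zv \<kappa>] by simp
  then have \<kappa>'h: "?\<kappa>' \<in> hom K (Zv n)" unfolding iso_def by simp
  have c: "?\<kappa>' y \<in> carrier_vec n" if "y \<in> carrier K" for y using \<kappa>'h that unfolding hom_def by auto
  have cc: "\<kappa> u \<in> carrier K" if "u \<in> carrier_vec n" for u using bij that by (rule bij_betw_apply)
  define T where "T = det A \<cdot>\<^sub>m adj_mat A"
  have T: "T \<in> carrier_mat n n" unfolding T_def using adj_mat(1)[OF A] by simp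
  have dd: "det A * det A = 1" using d by (metis abs_mult_self_eq mult_1)
  have TA: "T * A = 1\<^sub>m n" "A * T = 1\<^sub>m n"
  proof -
    have "det A \<cdot>\<^sub>m (det A \<cdot>\<^sub>m 1\<^sub>m n) = 1\<^sub>m n"
      using dd by (intro eq_matI) (auto simp: mult.assoc[symmetric])
    then show "T * A = 1\<^sub>m n" "A * T = 1\<^sub>m n" unfolding T_def
      using adj_mat[OF A] mult_smult_assoc_mat[OF adj_mat(1)[OF A] A] mult_smult_distrib[OF A adj_mat(1)[OF A]] by simp_all
  qed
  define g where "g x y = (B *\<^sub>v (T *\<^sub>v ?\<kappa>' x)) \<bullet> ?\<kappa>' y" for x y
  define \<rho> where "\<rho> = ext_form K g"
  have "biadditive (Zv n) (\<lambda>u w. (B *\<^sub>v (T *\<^sub>v u)) \<bullet> w)"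
    using B T by (auto simp: biadditive_def mult_add_distrib_mat_vec[of _ n n]
        add_scalar_prod_distrib[of _ n] scalar_prod_add_distrib[of _ n])
  from biadditive_comp[OF this \<kappa>'h] have \<rho>: "\<rho> \<in> carrier (Forms K)"
    unfolding \<rho>_def g_def by (rule ext_form_in_Forms[OF K])
  have V: "(\<lambda>u. (\<kappa> (A *\<^sub>v u), \<lambda>y\<in>carrier K. (B *\<^sub>v u) \<bullet> ?\<kappa>' y)) ` carrier_vec n = (\<lambda>x. (x, \<rho> x)) ` carrier K"
    (is "?f ` _ = _")
  proof (intro equalityI subsetI)
    fix p assume "p \<in> ?f ` carrier_vec n"
    then obtain u where u: "u \<in> carrier_vec n" "p = ?f u" by auto
    have Au: "A *\<^sub>v u \<in> carrier_vec n" using A u(1) by simp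
    have "T *\<^sub>v ?\<kappa>' (\<kappa> (A *\<^sub>v u)) = T *\<^sub>v (A *\<^sub>v u)" using bij_betw_inv_into_left[OF bij Au] by simp
    also have "\<dots> = u" using T A u(1) TA by (simp add: assoc_mult_mat_vec[symmetric])
    finally have "\<rho> (\<kappa> (A *\<^sub>v u)) = (\<lambda>y\<in>carrier K. (B *\<^sub>v u) \<bullet> ?\<kappa>' y)"
      unfolding \<rho>_def ext_form_def g_def using cc[OF Au] by simp
    then show "p \<in> (\<lambda>x. (x, \<rho> x)) ` carrier K" unfolding u(2) using cc[OF Au] by (intro image_eqI[of _ _ "\<kappa> (A *\<^sub>v u)"]) auto
  next
    fix p assume "p \<in> (\<lambda>x. (x, \<rho> x)) ` carrier K"
    then obtain x where x: "x \<in> carrier K" "p = (x, \<rho> x)" by auto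
    let ?u = "T *\<^sub>v ?\<kappa>' x"
    have u: "?u \<in> carrier_vec n" using T c[OF x(1)] by simp
    have "A *\<^sub>v ?u = ?\<kappa>' x" using assoc_mult_mat_vec[OF A T c[OF x(1)]] c[OF x(1)] TA by simp
    then have "\<kappa> (A *\<^sub>v ?u) = x" using bij_betw_inv_into_right[OF bij x(1)] by simp
    moreover have "\<rho> x = (\<lambda>y\<in>carrier K. (B *\<^sub>v ?u) \<bullet> ?\<kappa>' y)" unfolding \<rho>_def ext_form_def g_def using x(1) by simp
    ultimately show "p \<in> ?f ` carrier_vec n" unfolding x(2) using u by (intro image_eqI[of _ _ ?u]) auto
  qed
  show ?thesis
    using \<rho> matrix_formation_iso_hyp[OF f \<kappa> A B V] unfolding boundary_def by (intro bexI[of _ \<rho>]) auto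
qed

section \<open>Hyperbolic coordinates and the theorem\<close>

text \<open>A nonsingular form with a Lagrangian \<open>L\<close> is hyperbolic. Let \<open>\<alpha>\<close> be a basis of \<open>L\<close> with retraction
\<open>\<gamma>\<close>. Nonsingularity yields elements \<open>\<beta>\<^sub>0 w\<close> with \<open>f (\<beta>\<^sub>0 w) y - f y (\<beta>\<^sub>0 w) = w \<cdot> \<gamma> y\<close>, and because \<open>L\<close>
is its own orthogonal complement these elements span a complement of \<open>L\<close>. On it the form \<open>f\<close> need not vanish
in \<open>Q\<^sub>-\<close>. Adding \<open>\<alpha> (h w)\<close> changes it by \<open>- w' \<cdot> h w\<close> up to symmetrised forms, so \<open>h\<close> can be
chosen to cancel it.\<close>

lemma Lagrangian_coordinates:
  assumes f: "biadditive (Zv m) f" and perf: "perfect_form (Zv m) f" and dL: "direct_summand (Zv m) L"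
    and perp: "L = {x \<in> carrier (Zv m). \<forall>y\<in>L. f x y = f y x}"
    and quad: "quadr_equiv (Zv m\<lparr>carrier := L\<rparr>) (\<lambda>x y. 0) f"
  shows "\<exists>r \<Theta>. \<Theta> \<in> iso (Zp r) (Zv m) \<and> quadr_equiv (Zp r) hyp_pairing (\<lambda>x y. f (\<Theta> x) (\<Theta> y)) \<and>
    \<Theta> ` (carrier_vec r \<times> {0\<^sub>v r}) = L"
proof -
  have fl: "f (x + y) z = f x z + f y z" and fr: "f z (x + y) = f z x + f z y"
    if "x \<in> carrier_vec m" "y \<in> carrier_vec m" "z \<in> carrier_vec m" for x y z
    using f that unfolding biadditive_def by auto
  have LM: "L \<subseteq> carrier_vec m" using perp by auto
  have LL: "f x y = f y x" if "x \<in> L" "y \<in> L" for x y using perp that by blast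
  obtain r \<alpha> where \<alpha>: "\<alpha> \<in> hom (Zv r) (Zv m)" "inj_on \<alpha> (carrier_vec r)" "\<alpha> ` carrier_vec r = L"
    using subgroup_Zv_free dL unfolding direct_summand_def by metis
  have \<alpha>L: "\<alpha> u \<in> L" if "u \<in> carrier_vec r" for u using \<alpha>(3) that by blast
  have \<alpha>c: "\<alpha> u \<in> carrier_vec m" if "u \<in> carrier_vec r" for u using \<alpha>L[OF that] LM by blast
  have \<alpha>add: "\<alpha> (u + v) = \<alpha> u + \<alpha> v" if "u \<in> carrier_vec r" "v \<in> carrier_vec r" for u v
    using \<alpha>(1) that unfolding hom_def by auto
  obtain \<gamma> where \<gamma>: "\<gamma> \<in> hom (Zv m) (Zv r)" and \<gamma>\<alpha>: "\<And>u. u \<in> carrier_vec r \<Longrightarrow> \<gamma> (\<alpha> u) = u"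
    using summand_retraction[OF comm_group_Zv comm_group_Zv dL \<alpha>(1)] \<alpha>(2,3) by auto
  have \<gamma>c: "\<gamma> x \<in> carrier_vec r" if "x \<in> carrier_vec m" for x using \<gamma> that unfolding hom_def by auto
  have \<gamma>add: "\<gamma> (x + y) = \<gamma> x + \<gamma> y" if "x \<in> carrier_vec m" "y \<in> carrier_vec m" for x y
    using \<gamma> that unfolding hom_def by auto
  define Q where "Q w x \<longleftrightarrow> x \<in> carrier_vec m \<and> (\<forall>y\<in>carrier_vec m. f x y - f y x = w \<bullet> \<gamma> y)" for w x
  have ex1: "\<exists>!x. Q w x" if w: "w \<in> carrier_vec r" for w
  proof -
    have "(\<lambda>y. w \<bullet> \<gamma> y) \<in> hom (Zv m) integer_group"
      using w \<gamma>c by (auto simp: hom_def \<gamma>add scalar_prod_add_distrib[of _ r])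
    from bspec[OF perf[unfolded perfect_form_def] this] show ?thesis unfolding Q_def by simp
  qed
  (* beta0 spans a complement of L that is dual to L under the skew form. *)
  define \<beta>0 where "\<beta>0 w = (THE x. Q w x)" for w
  have Q: "Q w (\<beta>0 w)" if "w \<in> carrier_vec r" for w unfolding \<beta>0_def by (rule theI'[OF ex1[OF that]])
  have \<beta>0c: "\<beta>0 w \<in> carrier_vec m" if "w \<in> carrier_vec r" for w using Q[OF that] unfolding Q_def by simp
  have \<beta>0eq: "f (\<beta>0 w) y - f y (\<beta>0 w) = w \<bullet> \<gamma> y" if "w \<in> carrier_vec r" "y \<in> carrier_vec m" for w y
    using Q[OF that(1)] that(2) unfolding Q_def by simp
  have \<beta>0add: "\<beta>0 (v + w) = \<beta>0 v + \<beta>0 w" if v: "v \<in> carrier_vec r" and w: "w \<in> carrier_vec r" for v w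
  proof -
    have "Q (v + w) (\<beta>0 v + \<beta>0 w)" unfolding Q_def
    proof (intro conjI ballI)
      fix y :: "int vec" assume y: "y \<in> carrier_vec m"
      show "f (\<beta>0 v + \<beta>0 w) y - f y (\<beta>0 v + \<beta>0 w) = (v + w) \<bullet> \<gamma> y"
        using \<beta>0eq[OF v y] \<beta>0eq[OF w y] fl[OF \<beta>0c[OF v] \<beta>0c[OF w] y] fr[OF \<beta>0c[OF v] \<beta>0c[OF w] y]
          add_scalar_prod_distrib[OF v w \<gamma>c[OF y]] by simp
    qed (use \<beta>0c v w in auto)
    then show ?thesis using ex1[of "v + w"] Q[of "v + w"] v w by auto
  qed
  have pair: "f (\<beta>0 w) (\<alpha> u) = f (\<alpha> u) (\<beta>0 w) + w \<bullet> u" if "w \<in> carrier_vec r" "u \<in> carrier_vec r" for w u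
    using \<beta>0eq[OF that(1) \<alpha>c[OF that(2)]] \<gamma>\<alpha>[OF that(2)] by simp
  (* The correction along L that makes the quadratic form vanish on the complement. *)
  define h where "h w = vec r (\<lambda>i. f (\<beta>0 w) (\<beta>0 (unit_vec r i)))" for w
  have hc: "h w \<in> carrier_vec r" for w unfolding h_def by simp
  have hadd: "h (v + w) = h v + h w" if "v \<in> carrier_vec r" "w \<in> carrier_vec r" for v w
    unfolding h_def \<beta>0add[OF that] using fl[OF \<beta>0c[OF that(1)] \<beta>0c[OF that(2)] \<beta>0c] by (intro eq_vecI) auto
  have hw: "f (\<beta>0 v) (\<beta>0 w) = w \<bullet> h v" if v: "v \<in> carrier_vec r" and w: "w \<in> carrier_vec r" for v w
  proof -
    have "(\<lambda>w. f (\<beta>0 v) (\<beta>0 w)) \<in> hom (Zv r) integer_group"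
      using fr[OF \<beta>0c \<beta>0c \<beta>0c[OF v]] by (auto simp: hom_def \<beta>0add)
    from hom_int_scalar_prod[OF this w] show ?thesis unfolding h_def[symmetric]
      using comm_scalar_prod[OF hc w] by simp
  qed
  define \<beta> where "\<beta> w = \<beta>0 w + \<alpha> (h w)" for w
  have \<beta>c: "\<beta> w \<in> carrier_vec m" if "w \<in> carrier_vec r" for w
    unfolding \<beta>_def using \<beta>0c[OF that] \<alpha>c[OF hc] by simp
  have four: "(a + b) + (p + q) = (a + p) + (b + q)"
    if "a \<in> carrier_vec k" "b \<in> carrier_vec k" "p \<in> carrier_vec k" "q \<in> carrier_vec k" for a b p q :: "int vec" and k
    using that by (intro eq_vecI) auto
  have \<beta>add: "\<beta> (v + w) = \<beta> v + \<beta> w" if "v \<in> carrier_vec r" "w \<in> carrier_vec r" for v w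
    unfolding \<beta>_def \<beta>0add[OF that] hadd[OF that] \<alpha>add[OF hc hc]
    by (rule four[OF \<beta>0c[OF that(1)] \<beta>0c[OF that(2)] \<alpha>c[OF hc] \<alpha>c[OF hc]])
  have \<beta>pair: "f (\<beta> w) (\<alpha> u) = f (\<alpha> u) (\<beta> w) + w \<bullet> u" if w: "w \<in> carrier_vec r" and u: "u \<in> carrier_vec r" for w u
    unfolding \<beta>_def using fl[OF \<beta>0c[OF w] \<alpha>c[OF hc] \<alpha>c[OF u]] fr[OF \<beta>0c[OF w] \<alpha>c[OF hc] \<alpha>c[OF u]]
      pair[OF w u] LL[OF \<alpha>L[OF hc] \<alpha>L[OF u]] by simp
  define \<Theta> where "\<Theta> x = \<alpha> (fst x) + \<beta> (snd x)" for x
  have \<Theta>c: "\<Theta> x \<in> carrier_vec m" if "x \<in> carrier (Zp r)" for x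
    unfolding \<Theta>_def using that \<alpha>c[of "fst x"] \<beta>c[of "snd x"] by auto
  have \<Theta>hom: "\<Theta> \<in> hom (Zp r) (Zv m)"
  proof (rule homI)
    fix x y assume x: "x \<in> carrier (Zp r)" and y: "y \<in> carrier (Zp r)"
    have c: "fst x \<in> carrier_vec r" "fst y \<in> carrier_vec r" "snd x \<in> carrier_vec r" "snd y \<in> carrier_vec r"
      using x y by auto
    show "\<Theta> (x \<otimes>\<^bsub>Zp r\<^esub> y) = \<Theta> x \<otimes>\<^bsub>Zv m\<^esub> \<Theta> y"
      using four[OF \<alpha>c[OF c(1)] \<alpha>c[OF c(2)] \<beta>c[OF c(3)] \<beta>c[OF c(4)]] c
      by (simp add: \<Theta>_def \<alpha>add \<beta>add)
  qed (use \<Theta>c in simp)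
  have \<Theta>pair: "f (\<Theta> x) (\<alpha> u) = f (\<alpha> u) (\<Theta> x) + snd x \<bullet> u" if x: "x \<in> carrier (Zp r)" and u: "u \<in> carrier_vec r" for x u
  proof -
    have c: "fst x \<in> carrier_vec r" "snd x \<in> carrier_vec r" using x by auto
    show ?thesis unfolding \<Theta>_def
      using fl[OF \<alpha>c[OF c(1)] \<beta>c[OF c(2)] \<alpha>c[OF u]] fr[OF \<alpha>c[OF c(1)] \<beta>c[OF c(2)] \<alpha>c[OF u]]
        \<beta>pair[OF c(2) u] LL[OF \<alpha>L[OF c(1)] \<alpha>L[OF u]] by simp
  qed
  have inj: "inj_on \<Theta> (carrier (Zp r))"
  proof (rule inj_onI)
    fix x y assume x: "x \<in> carrier (Zp r)" and y: "y \<in> carrier (Zp r)" and e: "\<Theta> x = \<Theta> y"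
    have c: "fst x \<in> carrier_vec r" "fst y \<in> carrier_vec r" "snd x \<in> carrier_vec r" "snd y \<in> carrier_vec r"
      using x y by auto
    have s: "snd x = snd y"
      by (rule int_vec_eqI[OF c(3,4)]) (use \<Theta>pair[OF x] \<Theta>pair[OF y] e in simp)
    have "\<alpha> (fst x) = \<alpha> (fst y)"
      by (rule vec_add_right_cancel[OF _ \<alpha>c[OF c(1)] \<alpha>c[OF c(2)] \<beta>c[OF c(3)]]) (use e s in \<open>simp add: \<Theta>_def\<close>)
    then have "fst x = fst y" by (rule inj_onD[OF \<alpha>(2) _ c(1,2)])
    then show "x = y" using s by (simp add: prod_eq_iff)
  qed
  have sur: "\<exists>p\<in>carrier (Zp r). x = \<Theta> p" if x: "x \<in> carrier_vec m" for x
  proof -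
    have "(\<lambda>u. f x (\<alpha> u) - f (\<alpha> u) x) \<in> hom (Zv r) integer_group"
      using fl[OF \<alpha>c \<alpha>c x] fr[OF \<alpha>c \<alpha>c x] by (auto simp: hom_def \<alpha>add)
    note g = hom_int_scalar_prod[OF this]
    define w where "w = vec r (\<lambda>i. f x (\<alpha> (unit_vec r i)) - f (\<alpha> (unit_vec r i)) x)"
    have w: "w \<in> carrier_vec r" "\<And>u. u \<in> carrier_vec r \<Longrightarrow> f x (\<alpha> u) - f (\<alpha> u) x = w \<bullet> u"
      unfolding w_def by (rule vec_carrier, rule g)
    define z where "z = x - \<beta> w"
    have zc: "z \<in> carrier_vec m" and xz: "x = z + \<beta> w"
      unfolding z_def using x \<beta>c[OF w(1)] by (auto intro!: eq_vecI)
    have "f z y = f y z" if y: "y \<in> L" for y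
    proof -
      obtain u where u: "u \<in> carrier_vec r" "y = \<alpha> u" using y \<alpha>(3) by blast
      show ?thesis using w(2)[OF u(1)] fl[OF zc \<beta>c[OF w(1)] \<alpha>c[OF u(1)]] fr[OF zc \<beta>c[OF w(1)] \<alpha>c[OF u(1)]]
        \<beta>pair[OF w(1) u(1)] unfolding u(2) xz[symmetric] by simp
    qed
    then have "z \<in> L" using zc perp by auto
    then obtain u where u: "u \<in> carrier_vec r" "z = \<alpha> u" using \<alpha>(3) by blast
    have "x = \<Theta> (u, w)" unfolding \<Theta>_def using xz u(2) by simp
    then show ?thesis using u(1) w(1) by auto
  qed
  have "\<Theta> ` carrier (Zp r) = carrier_vec m" using sur \<Theta>c by blast
  then have iso: "\<Theta> \<in> iso (Zp r) (Zv m)" unfolding iso_def bij_betw_def using \<Theta>hom inj by simp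
  obtain \<kappa> where \<kappa>: "biadditive (Zv m\<lparr>carrier := L\<rparr>) \<kappa>" "\<And>x y. x \<in> L \<Longrightarrow> y \<in> L \<Longrightarrow> f x y = \<kappa> x y + \<kappa> y x"
    using quad unfolding quadr_equiv_def by auto
  (* In order: the form kappa, whose symmetrisation is f on L; the mixed term, where f (alpha a) (beta w) is replaced by
     f (beta w) (alpha a) minus the pairing; the two remaining terms on the complement. *)
  define \<chi> where "\<chi> x y = \<kappa> (\<alpha> (fst x)) (\<alpha> (fst y)) + (f (\<beta> (snd x)) (\<alpha> (fst y)) - snd x \<bullet> fst y)
      + (f (\<beta>0 (snd x)) (\<alpha> (h (snd y))) + \<kappa> (\<alpha> (h (snd x))) (\<alpha> (h (snd y))))" for x y
  have "biadditive (Zp r) \<chi>"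
  proof -
    have \<kappa>l: "\<kappa> (x + y) z = \<kappa> x z + \<kappa> y z" and \<kappa>r: "\<kappa> z (x + y) = \<kappa> z x + \<kappa> z y"
      if "x \<in> L" "y \<in> L" "z \<in> L" for x y z using \<kappa>(1) that unfolding biadditive_def by auto
    show ?thesis unfolding biadditive_def
    proof (intro ballI conjI)
      fix x y z assume "x \<in> carrier (Zp r)" "y \<in> carrier (Zp r)" "z \<in> carrier (Zp r)"
      then have c: "fst x \<in> carrier_vec r" "snd x \<in> carrier_vec r" "fst y \<in> carrier_vec r"
        "snd y \<in> carrier_vec r" "fst z \<in> carrier_vec r" "snd z \<in> carrier_vec r" by auto
      show "\<chi> (x \<otimes>\<^bsub>Zp r\<^esub> y) z = \<chi> x z + \<chi> y z"
        using c by (simp add: \<chi>_def \<alpha>add \<beta>add \<beta>0add hadd hc \<kappa>l fl \<alpha>L \<alpha>c \<beta>c \<beta>0c add_scalar_prod_distrib[of _ r])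
      show "\<chi> x (y \<otimes>\<^bsub>Zp r\<^esub> z) = \<chi> x y + \<chi> x z"
        using c by (simp add: \<chi>_def \<alpha>add \<beta>add \<beta>0add hadd hc \<kappa>r fr \<alpha>L \<alpha>c \<beta>c \<beta>0c scalar_prod_add_distrib[of _ r])
    qed
  qed
  moreover have "f (\<Theta> x) (\<Theta> y) = hyp_pairing x y + \<chi> x y + \<chi> y x" if "x \<in> carrier (Zp r)" "y \<in> carrier (Zp r)" for x y
  proof -
    obtain a v b w where xy: "x = (a, v)" "y = (b, w)" by (cases x, cases y)
    then have c: "a \<in> carrier_vec r" "v \<in> carrier_vec r" "b \<in> carrier_vec r" "w \<in> carrier_vec r" using that by auto
    have e1: "f (\<alpha> a + \<beta> v) (\<alpha> b + \<beta> w) = f (\<alpha> a) (\<alpha> b) + f (\<alpha> a) (\<beta> w) + (f (\<beta> v) (\<alpha> b) + f (\<beta> v) (\<beta> w))"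
      using c by (simp add: fl fr \<alpha>c \<beta>c)
    have e2: "f (\<beta> v) (\<beta> w) = f (\<beta>0 v) (\<beta>0 w) + f (\<beta>0 v) (\<alpha> (h w)) + (f (\<alpha> (h v)) (\<beta>0 w) + f (\<alpha> (h v)) (\<alpha> (h w)))"
      unfolding \<beta>_def using c by (simp add: fl fr \<alpha>c \<beta>0c hc)
    have e3: "f (\<beta> w) (\<alpha> a) = f (\<alpha> a) (\<beta> w) + w \<bullet> a" by (rule \<beta>pair[OF c(4,1)])
    have e4: "f (\<beta>0 w) (\<alpha> (h v)) = f (\<alpha> (h v)) (\<beta>0 w) + w \<bullet> h v" by (rule pair[OF c(4) hc])
    have e5: "f (\<beta>0 v) (\<beta>0 w) = w \<bullet> h v" by (rule hw[OF c(2,4)])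
    have e6: "f (\<alpha> a) (\<alpha> b) = \<kappa> (\<alpha> a) (\<alpha> b) + \<kappa> (\<alpha> b) (\<alpha> a)" by (rule \<kappa>(2)[OF \<alpha>L[OF c(1)] \<alpha>L[OF c(3)]])
    have e7: "f (\<alpha> (h v)) (\<alpha> (h w)) = \<kappa> (\<alpha> (h v)) (\<alpha> (h w)) + \<kappa> (\<alpha> (h w)) (\<alpha> (h v))"
      by (rule \<kappa>(2)[OF \<alpha>L[OF hc] \<alpha>L[OF hc]])
    show ?thesis unfolding xy \<Theta>_def \<chi>_def hyp_pairing_def fst_conv snd_conv e1 using e2 e3 e4 e5 e6 e7 by linarith
  qed
  ultimately have "quadr_equiv (Zp r) hyp_pairing (\<lambda>x y. f (\<Theta> x) (\<Theta> y))" unfolding quadr_equiv_def by blast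
  moreover have "\<Theta> ` (carrier_vec r \<times> {0\<^sub>v r}) = L"
  proof -
    have "\<beta> (0\<^sub>v r) = 0\<^sub>v m"
      by (rule vec_add_right_cancel[of _ "\<beta> (0\<^sub>v r)"]) (use \<beta>add[of "0\<^sub>v r" "0\<^sub>v r"] \<beta>c[of "0\<^sub>v r"] in auto)
    then have "\<Theta> (u, 0\<^sub>v r) = \<alpha> u" if "u \<in> carrier_vec r" for u unfolding \<Theta>_def using \<alpha>c[OF that] by simp
    then have "\<Theta> ` (carrier_vec r \<times> {0\<^sub>v r}) = \<alpha> ` carrier_vec r" by (force simp: image_iff)
    then show ?thesis using \<alpha>(3) by simp
  qed
  ultimately show ?thesis using iso by blast
qed

lemma int_mat_eqI:
  fixes X Y :: "int mat"
  assumes X: "X \<in> carrier_mat m n" and Y: "Y \<in> carrier_mat m n"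
    and eq: "\<And>u. u \<in> carrier_vec n \<Longrightarrow> X *\<^sub>v u = Y *\<^sub>v u"
  shows "X = Y"
proof (rule eq_matI)
  fix i j assume "i < dim_row Y" "j < dim_col Y"
  then show "X $$ (i, j) = Y $$ (i, j)"
    using X Y arg_cong[OF eq[of "unit_vec n j"], of "\<lambda>v. v $ i"] by simp
qed (use X Y in auto)

text \<open>The matrices \<open>A\<close> and \<open>B\<close> express a basis \<open>\<nu>\<close> of \<open>V\<close> in hyperbolic coordinates, and \<open>C\<close> and \<open>D\<close>
express a retraction of the module onto \<open>V\<close>.\<close>

lemma quasi_formation_iso_matrix_formation:
  assumes D: "formation_data (Zv m) f L V" and X: "is_quasi_formation (mk_formation (Zv m) f L V)"
  shows "\<exists>n A B. primitive_pair n A B \<and> qf_iso (matrix_formation n A B) (mk_formation (Zv m) f L V)"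
proof -
  have f: "biadditive (Zv m) f" using D unfolding formation_data_def by simp
  have P: "perfect_form (Zv m) f" "direct_summand (Zv m) L" "L = {x \<in> carrier (Zv m). \<forall>y\<in>L. f x y = f y x}"
    "quadr_equiv (Zv m\<lparr>carrier := L\<rparr>) (\<lambda>x y. 0) f" "half_rank_summand (Zv m) V"
    using X unfolding is_quasi_formation_mk_formation_iff[OF comm_group_Zv f] by auto
  obtain r \<Theta> where \<Theta>: "\<Theta> \<in> iso (Zp r) (Zv m)" "quadr_equiv (Zp r) hyp_pairing (\<lambda>x y. f (\<Theta> x) (\<Theta> y))"
    "\<Theta> ` (carrier_vec r \<times> {0\<^sub>v r}) = L"
    using Lagrangian_coordinates[OF f P(1,2,3,4)] by blast
  obtain k where k: "free_of_rank (Zv m) (2 * k)" "free_of_rank (Zv m\<lparr>carrier := V\<rparr>) k" and dV: "direct_summand (Zv m) V"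
    using P(5) unfolding half_rank_summand_def by auto
  have "m = 2 * k" using k(1) unfolding free_of_rank_iff by (auto dest: Zv_iso_dim_eq)
  moreover have "m = 2 * r"
  proof -
    have "Zv (2 * r) \<cong> Zp r" using free_of_rank_Zp[of r] unfolding free_of_rank_iff by simp
    then have "Zv (2 * r) \<cong> Zv m" using \<Theta>(1) iso_trans unfolding is_iso_def by (metis iso_set_trans ex_in_conv)
    then show ?thesis by (auto dest: Zv_iso_dim_eq)
  qed
  (* The half-rank condition makes A and B square. *)
  ultimately have kr: "k = r" by simp
  obtain \<nu> where \<nu>iso: "\<nu> \<in> iso (Zv r) (Zv m\<lparr>carrier := V\<rparr>)"
    using k(2) unfolding kr free_of_rank_iff is_iso_def by auto
  have VM: "V \<subseteq> carrier_vec m" using D unfolding formation_data_def by simp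
  have \<nu>: "\<nu> \<in> hom (Zv r) (Zv m)" "inj_on \<nu> (carrier_vec r)" "\<nu> ` carrier_vec r = V"
    using \<nu>iso VM unfolding iso_def hom_def bij_betw_def by auto
  obtain \<mu> where \<mu>: "\<mu> \<in> hom (Zv m) (Zv r)" and \<mu>\<nu>: "\<And>u. u \<in> carrier_vec r \<Longrightarrow> \<mu> (\<nu> u) = u"
    using summand_retraction[OF comm_group_Zv comm_group_Zv dV \<nu>(1)] \<nu>(2,3) by auto
  let ?i = "inv_into (carrier (Zp r)) \<Theta>"
  have bij: "bij_betw \<Theta> (carrier (Zp r)) (carrier (Zv m))" using \<Theta>(1) unfolding iso_def by simp
  have "?i \<in> iso (Zv m) (Zp r)"
    using group.iso_set_sym[OF comm_group.axioms(2)[OF comm_group_Zp] \<Theta>(1)] .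
  then have i: "?i \<in> hom (Zv m) (Zp r)" unfolding iso_def by simp
  have "?i \<circ> \<nu> \<in> hom (Zv r) (Zp r)" by (rule hom_compose[OF \<nu>(1) i])
  then have "(\<lambda>u. fst (?i (\<nu> u))) \<in> hom (Zv r) (Zv r)" "(\<lambda>u. snd (?i (\<nu> u))) \<in> hom (Zv r) (Zv r)"
    unfolding hom_def by (auto simp: Pi_iff mem_Times_iff)
  from hom_int_mat[OF this(1)] hom_int_mat[OF this(2)] obtain A B where A: "A \<in> carrier_mat r r" and B: "B \<in> carrier_mat r r"
    and AB: "\<And>u. u \<in> carrier_vec r \<Longrightarrow> ?i (\<nu> u) = (A *\<^sub>v u, B *\<^sub>v u)" by (metis prod.collapse)
  have \<nu>c: "\<nu> u \<in> carrier (Zv m)" if "u \<in> carrier_vec r" for u using \<nu>(1) that unfolding hom_def by auto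
  have \<Theta>AB: "\<Theta> (A *\<^sub>v u, B *\<^sub>v u) = \<nu> u" if "u \<in> carrier_vec r" for u
    using bij_betw_inv_into_right[OF bij \<nu>c[OF that]] unfolding AB[OF that] .
  have \<Theta>h: "\<Theta> \<in> hom (Zp r) (Zv m)" using \<Theta>(1) unfolding iso_def by simp
  have inl: "(\<lambda>u. (u, 0\<^sub>v r)) \<in> hom (Zv r) (Zp r)" "(\<lambda>w. (0\<^sub>v r, w)) \<in> hom (Zv r) (Zp r)"
    by (auto simp: hom_def)
  note mt = hom_compose[OF \<Theta>h \<mu>]
  obtain C D where C: "C \<in> carrier_mat r r" "\<And>u. u \<in> carrier_vec r \<Longrightarrow> \<mu> (\<Theta> (u, 0\<^sub>v r)) = C *\<^sub>v u"
    and D': "D \<in> carrier_mat r r" "\<And>w. w \<in> carrier_vec r \<Longrightarrow> \<mu> (\<Theta> (0\<^sub>v r, w)) = D *\<^sub>v w"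
    using hom_int_mat[OF hom_compose[OF inl(1) mt]] hom_int_mat[OF hom_compose[OF inl(2) mt]] by auto
  have "C * A + D * B = 1\<^sub>m r"
  proof (rule int_mat_eqI[of _ r r])
    fix u :: "int vec" assume u: "u \<in> carrier_vec r"
    have Au: "A *\<^sub>v u \<in> carrier_vec r" and Bu: "B *\<^sub>v u \<in> carrier_vec r" using A B u by auto
    have "u = \<mu> (\<Theta> (A *\<^sub>v u, B *\<^sub>v u))" using \<mu>\<nu>[OF u] \<Theta>AB[OF u] by simp
    also have "(A *\<^sub>v u, B *\<^sub>v u) = (A *\<^sub>v u, 0\<^sub>v r) \<otimes>\<^bsub>Zp r\<^esub> (0\<^sub>v r, B *\<^sub>v u)" using Au Bu by simp
    also have "\<mu> (\<Theta> \<dots>) = \<mu> (\<Theta> (A *\<^sub>v u, 0\<^sub>v r)) + \<mu> (\<Theta> (0\<^sub>v r, B *\<^sub>v u))"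
      using hom_mult[OF mt, of "(A *\<^sub>v u, 0\<^sub>v r)" "(0\<^sub>v r, B *\<^sub>v u)"] Au Bu by simp
    also have "\<dots> = C *\<^sub>v (A *\<^sub>v u) + D *\<^sub>v (B *\<^sub>v u)" unfolding C(2)[OF Au] D'(2)[OF Bu] ..
    also have "\<dots> = (C * A + D * B) *\<^sub>v u" using A B C(1) D'(1) u by (simp add: add_mult_distrib_mat_vec[of _ r r])
    finally show "(C * A + D * B) *\<^sub>v u = 1\<^sub>m r *\<^sub>v u" using u by simp
  qed (use A B C(1) D'(1) in auto)
  then have prim: "primitive_pair r A B" unfolding primitive_pair_def using A B C(1) D'(1) by blast
  have "\<Theta> ` (\<lambda>u. (A *\<^sub>v u, B *\<^sub>v u)) ` carrier_vec r = V"
    unfolding image_image \<nu>(3)[symmetric] using \<Theta>AB by (intro image_cong) auto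
  then have "qf_iso (matrix_formation r A B) (mk_formation (Zv m) f L V)"
    unfolding matrix_formation_def qf_iso_mk_formation_iff[OF matrix_formation_data[OF A B] D] using \<Theta> by blast
  then show ?thesis using prim by blast
qed

text \<open>On this class isomorphism is an equivalence relation and is compatible with sums. It contains the
intermediate sums and hyperbolic forms without a proof that they are quasi-formations.\<close>

definition presented :: "'a quasi_formation \<Rightarrow> bool" where
  "presented X \<longleftrightarrow> (\<exists>M f L V. X = mk_formation M f L V \<and> formation_data M f L V)"

lemma presented_mk_formation: "formation_data M f L V \<Longrightarrow> presented (mk_formation M f L V)"
  unfolding presented_def by blast

lemma presented_matrix_formation: "A \<in> carrier_mat n n \<Longrightarrow> B \<in> carrier_mat n n \<Longrightarrow> presented (matrix_formation n A B)"
  unfolding matrix_formation_def by (rule presented_mk_formation[OF matrix_formation_data])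

lemma qf_iso_trans:
  "presented X \<Longrightarrow> presented Y \<Longrightarrow> presented Z \<Longrightarrow> qf_iso X Y \<Longrightarrow> qf_iso Y Z \<Longrightarrow> qf_iso X Z"
  unfolding presented_def using qf_iso_mk_formation_trans by blast

lemma qf_iso_sym: "presented X \<Longrightarrow> presented Y \<Longrightarrow> qf_iso X Y \<Longrightarrow> qf_iso Y X"
  unfolding presented_def using qf_iso_mk_formation_sym by blast

lemma presented_sum:
  assumes "presented X" "presented Y"
  shows "presented (qf_sum X Y)"
proof -
  obtain M f L V N g K W where XY: "X = mk_formation M f L V" "Y = mk_formation N g K W"
    and D: "formation_data M f L V" "formation_data N g K W"
    using assms unfolding presented_def by blast
  show ?thesis unfolding XY qf_sum_mk_formation[OF D] by (rule presented_mk_formation[OF formation_data_sum[OF D]])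
qed

lemma qf_iso_sum:
  "presented X \<Longrightarrow> presented Y \<Longrightarrow> presented X' \<Longrightarrow> presented Y' \<Longrightarrow> qf_iso X X' \<Longrightarrow> qf_iso Y Y' \<Longrightarrow>
    qf_iso (qf_sum X Y) (qf_sum X' Y')"
  unfolding presented_def using qf_iso_sum_mk_formation by blast

lemma presented_trivial_formation: "free_of_rank K n \<Longrightarrow> presented (trivial_formation K)"
  using presented_mk_formation[OF matrix_formation_iso_trivial_formation(2)]
  unfolding mk_formation_def trivial_formation_def hyp_module_def hyp_form_def ext_form_def by blast

lemma presented_boundary:
  "formation_data (K \<times>\<times> dual K) (\<lambda>x y. snd x (fst y)) (carrier K \<times> {\<one>\<^bsub>dual K\<^esub>}) ((\<lambda>x. (x, \<rho> x)) ` carrier K)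
    \<Longrightarrow> presented (boundary K \<rho>)"
  using presented_mk_formation
  unfolding mk_formation_def boundary_def hyp_module_def hyp_form_def ext_form_def by blast

lemma free_of_rank_free_Abelian_group: "free_of_rank (free_Abelian_group {..<k :: nat}) k"
  unfolding free_of_rank_def
  by (simp add: abelian_free_Abelian_group iso_refl)

lemma sum_trivial_iso_matrix_formation:
  assumes X: "presented X" and A: "A \<in> carrier_mat n n" and B: "B \<in> carrier_mat n n"
    and iso: "qf_iso X (matrix_formation n A B)" and P: "free_of_rank P k" and R: "R \<in> carrier_mat (n + k) (n + k)"
  shows "qf_iso (qf_sum X (trivial_formation P))
    (matrix_formation (n + k) (block_sum A (0\<^sub>m k k) + (R + transpose_mat R) * block_sum B (1\<^sub>m k)) (block_sum B (1\<^sub>m k)))"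
proof -
  let ?A = "block_sum A (0\<^sub>m k k)" and ?B = "block_sum B (1\<^sub>m k)" and ?T = "trivial_formation P"
  let ?S = "R + transpose_mat R" and ?E = "matrix_formation k (0\<^sub>m k k) (1\<^sub>m k)"
  have c: "?A \<in> carrier_mat (n + k) (n + k)" "?B \<in> carrier_mat (n + k) (n + k)" using A B by auto
  have S: "?S \<in> carrier_mat (n + k) (n + k)" using R by simp
  have c': "?A + ?S * ?B \<in> carrier_mat (n + k) (n + k)" using mult_carrier_mat[OF S c(2)] by simp
  have pE: "presented ?E" by (rule presented_matrix_formation) auto
  have pT: "presented ?T" by (rule presented_trivial_formation[OF P])
  have pS: "presented (matrix_formation n A B)" by (rule presented_matrix_formation[OF A B])
  have T: "qf_iso ?T ?E" by (rule qf_iso_sym[OF pE pT matrix_formation_iso_trivial_formation(1)[OF P]])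
  have 1: "qf_iso (qf_sum X ?T) (qf_sum (matrix_formation n A B) ?E)"
    by (rule qf_iso_sum[OF X pT pS pE iso T])
  have 2: "qf_iso (qf_sum (matrix_formation n A B) ?E) (matrix_formation (n + k) ?A ?B)" by (rule matrix_formation_sum[OF A B]) auto
  have 3: "qf_iso (matrix_formation (n + k) ?A ?B) (matrix_formation (n + k) (?A + ?S * ?B) ?B)"
    by (rule matrix_formation_shear[OF c R])
  show ?thesis
    using qf_iso_trans[OF presented_sum[OF X pT] presented_sum[OF pS pE] presented_matrix_formation[OF c] 1 2]
      qf_iso_trans[OF presented_sum[OF X pT] presented_matrix_formation[OF c] presented_matrix_formation[OF c' c(2)] _ 3] by blast
qed

theorem proposition20:
  shows "\<forall>a \<in> carrier l3_Z. elementary a"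
proof
  fix a assume "a \<in> carrier l3_Z"
  then obtain X where X: "is_quasi_formation X" and a: "a = {(X, Y). l3_equiv X Y} `` {X}"
    unfolding l3_Z_def by (auto elim!: quotientE)
  obtain M f L V where XM: "X = mk_formation M f L V" and D: "formation_data M f L V"
    using is_quasi_formation_cases[OF X] by blast
  have pX: "presented X" unfolding XM by (rule presented_mk_formation[OF D])
  obtain m where "free_of_rank M m"
    using X unfolding XM is_quasi_formation_def skew_quadratic_form_def fg_free_def mk_formation_def by auto
  then obtain h where h: "h \<in> iso (Zv m) M" unfolding free_of_rank_iff is_iso_def by auto
  obtain g K W where Z: "formation_data (Zv m) g K W" "is_quasi_formation (mk_formation (Zv m) g K W)" "qf_iso (mk_formation (Zv m) g K W) X"
    using quasi_formation_transport[OF comm_group_Zv D X[unfolded XM] h] unfolding XM by blast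
  obtain n A B where P: "primitive_pair n A B" and isoZ: "qf_iso (matrix_formation n A B) (mk_formation (Zv m) g K W)"
    using quasi_formation_iso_matrix_formation[OF Z(1,2)] by blast
  have A: "A \<in> carrier_mat n n" and B: "B \<in> carrier_mat n n" using P unfolding primitive_pair_def by auto
  have "qf_iso (matrix_formation n A B) X"
    by (rule qf_iso_trans[OF presented_matrix_formation[OF A B] presented_mk_formation[OF Z(1)] pX isoZ Z(3)])
  then have isoX: "qf_iso X (matrix_formation n A B)" by (rule qf_iso_sym[OF presented_matrix_formation[OF A B] pX])
  obtain N A1 B1 where st: "stab_shear n A B N A1 B1" and det: "\<bar>det A1\<bar> = 1"
    using exists_stab_shear_unimodular[OF P] by blast
  have P1: "primitive_pair N A1 B1" by (rule primitive_pair_stab_shear[OF P st])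
  then have A1: "A1 \<in> carrier_mat N N" and B1: "B1 \<in> carrier_mat N N" unfolding primitive_pair_def by auto
  have pS1: "presented (matrix_formation N A1 B1)" by (rule presented_matrix_formation[OF A1 B1])
  obtain k R where k: "N = n + k" "R \<in> carrier_mat N N"
    "A1 = block_sum A (0\<^sub>m k k) + (R + transpose_mat R) * block_sum B (1\<^sub>m k)" "B1 = block_sum B (1\<^sub>m k)"
    using st unfolding stab_shear_def by auto
  let ?F = "\<lambda>k :: nat. free_Abelian_group {..<k}"
  have isoXT: "qf_iso (qf_sum X (trivial_formation (?F k))) (matrix_formation N A1 B1)"
    using sum_trivial_iso_matrix_formation[OF pX A B isoX free_of_rank_free_Abelian_group[of k], of R] k by simp
  have "?F (2 * N) \<cong> Zp N" using free_of_rank_Zp[of N] unfolding free_of_rank_def by simp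
  then obtain h' where h': "h' \<in> iso (?F (2 * N)) (Zp N)" unfolding is_iso_def by auto
  obtain g' K' W' where Y: "formation_data (?F (2 * N)) g' K' W'" "is_quasi_formation (mk_formation (?F (2 * N)) g' K' W')"
    "qf_iso (mk_formation (?F (2 * N)) g' K' W') (matrix_formation N A1 B1)"
    using quasi_formation_transport[OF abelian_free_Abelian_group matrix_formation_data[OF A1 B1] _ h']
      is_quasi_formation_matrix_formation[OF P1] unfolding matrix_formation_def by blast
  define Y where "Y = mk_formation (?F (2 * N)) g' K' W'"
  note Y = Y[folded Y_def]
  have pY: "presented Y" unfolding Y_def by (rule presented_mk_formation[OF Y(1)])
  have isoYT: "qf_iso (qf_sum Y (trivial_formation (?F 0))) (matrix_formation N A1 B1)"
  proof -
    have d0: "block_sum A1 (0\<^sub>m 0 0) = A1" "block_sum B1 (1\<^sub>m 0) = B1"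
      using A1 B1 unfolding block_sum_def by (auto intro!: eq_matI)
    have "A1 + (0\<^sub>m N N + transpose_mat (0\<^sub>m N N)) * B1 = A1" using A1 B1 by simp
    then show ?thesis
      using sum_trivial_iso_matrix_formation[OF pY A1 B1 Y(3) free_of_rank_free_Abelian_group[of 0], of "0\<^sub>m N N"]
      unfolding d0 by simp
  qed
  have pT: "presented (trivial_formation (?F j))" for j :: nat
    by (rule presented_trivial_formation[OF free_of_rank_free_Abelian_group])
  have "qf_iso (qf_sum X (trivial_formation (?F k))) (qf_sum Y (trivial_formation (?F 0)))"
    by (rule qf_iso_trans[OF presented_sum[OF pX pT] pS1 presented_sum[OF pY pT] isoXT
          qf_iso_sym[OF presented_sum[OF pY pT] pS1 isoYT]])
  then have "stably_iso X Y" unfolding stably_iso_def fg_free_def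
    using free_of_rank_free_Abelian_group by blast
  then have "l3_equiv X Y" by (rule l3_stable[OF X Y(2)])
  then have "Y \<in> a" unfolding a by simp
  moreover obtain \<rho> where \<rho>: "\<rho> \<in> carrier (Forms (?F N))" "qf_iso (matrix_formation N A1 B1) (boundary (?F N) \<rho>)"
    "presented (boundary (?F N) \<rho>)"
    using matrix_formation_iso_boundary[OF free_of_rank_free_Abelian_group A1 B1 det] presented_boundary by blast
  moreover have "qf_iso Y (boundary (?F N) \<rho>)"
    by (rule qf_iso_trans[OF pY pS1 \<rho>(3) Y(3) \<rho>(2)])
  moreover have "fg_free (?F N)" unfolding fg_free_def using free_of_rank_free_Abelian_group by blast
  ultimately show "elementary a" unfolding elementary_def by blast
qed

end
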